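(* Let $(X,T)$ be a topological dynamical system and let $d\in\mathbb{N}$. Suppose that the non-wandering set $\Omega(X)$ is finite dimensional, that the set of periodic points $P(X,T)$ is closed, and that $perdim(X,T)<\frac{d}{2}$. Then the set of continuous functions $f:X\to[0,1]^d$ for which the orbit map $I_f:(X,T)\to(([0,1]^d)^{\mathbb{Z}},\mathrm{shift})$, $I_f(x)=(f(T^kx))_{k\in\mathbb{Z}}$, is an embedding is comeagre in $C(X,[0,1]^d)$.
   Context: A topological dynamical system $(X,T)$ is a compact metric space $X$ together with a homeomorphism $T:X\to X$. A point $x\in X$ is non-wandering if for every open set $U\ni x$ there is $k\in\mathbb{Z}\setminus\{0\}$ with $U\cap T^kU\neq\emptyset$; $\Omega(X)$ is the set of non-wandering points. $P(X,T)$ is the set of periodic points and $P_m$ the set of periodic points of period $\le m$. Dimension $dim$ is Lebesgue covering dimension, and $perdim(X,T)<c$ means $\frac{dim(P_m)}{m}<c$ for every $m\in\mathbb{N}$. The space $C(X,[0,1]^d)$ of continuous functions carries the supremum norm topology; a set is comeagre if it is the complement of a countable union of nowhere dense sets. The map $I_f$ is an embedding if it is injective (it is automatically continuous and equivariant). *)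

theory Defs
  imports "HOL-Analysis.Analysis"
begin

definition tds :: "'a::metric_space set \<Rightarrow> ('a \<Rightarrow> 'a) \<Rightarrow> bool" where
  "tds X T \<longleftrightarrow> compact X \<and> homeomorphic_map (top_of_set X) (top_of_set X) T"

(* Only the restriction of T to X matters, so the inverse is inv_into X T. *)
definition iterate :: "'a set \<Rightarrow> ('a \<Rightarrow> 'a) \<Rightarrow> int \<Rightarrow> 'a \<Rightarrow> 'a" where
  "iterate X T k = (if k \<ge> 0 then T ^^ nat k else inv_into X T ^^ nat (- k))"

definition nonwandering :: "'a::topological_space set \<Rightarrow> ('a \<Rightarrow> 'a) \<Rightarrow> 'a set" where
  "nonwandering X T =
    {x \<in> X. \<forall>U. openin (top_of_set X) U \<and> x \<in> U \<longrightarrow>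
       (\<exists>k::int. k \<noteq> 0 \<and> U \<inter> iterate X T k ` U \<noteq> {})}"

definition periodic_points :: "'a set \<Rightarrow> ('a \<Rightarrow> 'a) \<Rightarrow> 'a set" where
  "periodic_points X T = {x \<in> X. \<exists>n\<ge>1. (T ^^ n) x = x}"

(* A point whose least period is at most m is the same as a point having some period n
   with 1 \<le> n \<le> m. *)
definition periodic_points_le :: "'a set \<Rightarrow> ('a \<Rightarrow> 'a) \<Rightarrow> nat \<Rightarrow> 'a set" where
  "periodic_points_le X T m = {x \<in> X. \<exists>n\<in>{1..m}. (T ^^ n) x = x}"

definition finite_open_cover :: "'a topology \<Rightarrow> 'a set set \<Rightarrow> bool" where
  "finite_open_cover X \<U> \<longleftrightarrow> finite \<U> \<and> (\<forall>U\<in>\<U>. openin X U) \<and> \<Union>\<U> = topspace X"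

definition refines :: "'a set set \<Rightarrow> 'a set set \<Rightarrow> bool" where
  "refines \<V> \<U> \<longleftrightarrow> (\<forall>V\<in>\<V>. \<exists>U\<in>\<U>. V \<subseteq> U)"

definition covering_dim_le :: "'a topology \<Rightarrow> int \<Rightarrow> bool" where
  "covering_dim_le X n \<longleftrightarrow>
    (\<forall>\<U>. finite_open_cover X \<U> \<longrightarrow>
      (\<exists>\<V>. finite_open_cover X \<V> \<and> refines \<V> \<U> \<and>
           (\<forall>x\<in>topspace X. int (card {V \<in> \<V>. x \<in> V}) \<le> n + 1)))"

(* Lebesgue covering dimension: -1 for the empty space, and \<infinity> (the infimum of the
   empty set) when no integer bounds the dimension. *)
definition covering_dim :: "'a topology \<Rightarrow> ereal" where
  "covering_dim X = Inf {ereal (of_int n) | n. - 1 \<le> n \<and> covering_dim_le X n}"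

definition perdim_less :: "'a::topological_space set \<Rightarrow> ('a \<Rightarrow> 'a) \<Rightarrow> real \<Rightarrow> bool" where
  "perdim_less X T c \<longleftrightarrow>
    (\<forall>m::nat. m \<ge> 1 \<longrightarrow>
       covering_dim (top_of_set (periodic_points_le X T m)) / ereal (real m) < ereal c)"

definition nowhere_dense_in :: "'a topology \<Rightarrow> 'a set \<Rightarrow> bool" where
  "nowhere_dense_in X N \<longleftrightarrow> N \<subseteq> topspace X \<and> X interior_of (X closure_of N) = {}"

definition comeagre_in :: "'a topology \<Rightarrow> 'a set \<Rightarrow> bool" where
  "comeagre_in X S \<longleftrightarrow>
    S \<subseteq> topspace X \<and>
    (\<exists>\<N>. countable \<N> \<and> (\<forall>N\<in>\<N>. nowhere_dense_in X N) \<and> topspace X - S = \<Union>\<N>)"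

definition unit_cube :: "(real ^ 'd) set" where
  "unit_cube = {v. \<forall>i. v $ i \<in> {0..1}}"

(* C(X, [0,1]^d) with the supremum metric. The points of cfunspace are functions that are
   undefined outside X. Values are compared in the Euclidean norm of real ^ 'd, which gives
   the same topology as any other norm. *)
definition cube_funspace :: "'a::topological_space set \<Rightarrow> ('a \<Rightarrow> real ^ 'd) metric" where
  "cube_funspace X = cfunspace (top_of_set X) (submetric euclidean_metric unit_cube)"

definition orbit_map :: "'a set \<Rightarrow> ('a \<Rightarrow> 'a) \<Rightarrow> ('a \<Rightarrow> 'b) \<Rightarrow> 'a \<Rightarrow> (int \<Rightarrow> 'b)" where
  "orbit_map X T f x = (\<lambda>k. f (iterate X T k x))"

(* On a compact space this is the same as being a topological embedding into the product
   (see orbit_embedding_iff_embedding_map below). *)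
definition orbit_embedding :: "'a set \<Rightarrow> ('a \<Rightarrow> 'a) \<Rightarrow> ('a \<Rightarrow> 'b) \<Rightarrow> bool" where
  "orbit_embedding X T f \<longleftrightarrow> inj_on (orbit_map X T f) X"

lemma mspace_cube_funspace:
  assumes "f \<in> mspace (cube_funspace X)"
  shows "continuous_map (top_of_set X) (top_of_set unit_cube) f"
  using assms by (simp add: cube_funspace_def mtopology_of_submetric)

lemma continuous_map_funpow:
  "continuous_map X X g \<Longrightarrow> continuous_map X X (g ^^ n)"
  by (induction n) (auto simp: continuous_map_compose id_def[symmetric])

lemma continuous_map_iterate:
  assumes "tds X T"
  shows "continuous_map (top_of_set X) (top_of_set X) (iterate X T k)"
proof -
  have h: "homeomorphic_map (top_of_set X) (top_of_set X) T"
    using assms by (simp add: tds_def)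
  then obtain g where g: "homeomorphic_maps (top_of_set X) (top_of_set X) T g"
    using homeomorphic_map_maps by blast
  have "inv_into X T x = g x" if "x \<in> X" for x
  proof -
    have "g x \<in> X" "T (g x) = x"
      using g that by (auto simp: homeomorphic_maps_def continuous_map_def)
    moreover have "inj_on T X"
      using h by (simp add: homeomorphic_map_def)
    ultimately show ?thesis
      by (metis inv_into_f_f)
  qed
  then have "continuous_map (top_of_set X) (top_of_set X) (inv_into X T)"
    using g by (auto simp: homeomorphic_maps_def intro: continuous_map_eq)
  then show ?thesis
    using continuous_map_funpow homeomorphic_imp_continuous_map[OF h]
    unfolding iterate_def by metis
qed

lemma orbit_embedding_iff_embedding_map:
  fixes f :: "'a::metric_space \<Rightarrow> real ^ 'd"
  assumes "tds X T" "f \<in> mspace (cube_funspace X)"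
  shows "orbit_embedding X T f \<longleftrightarrow>
    embedding_map (top_of_set X) (product_topology (\<lambda>_::int. top_of_set unit_cube) UNIV)
      (orbit_map X T f)"
proof
  let ?P = "product_topology (\<lambda>_::int. top_of_set (unit_cube :: (real ^ 'd) set)) UNIV"
  assume "orbit_embedding X T f"
  then have inj: "inj_on (orbit_map X T f) (topspace (top_of_set X))"
    by (simp add: orbit_embedding_def)
  have "continuous_map (top_of_set X) (top_of_set unit_cube) (\<lambda>x. f (iterate X T k x))" for k
    using continuous_map_compose[OF continuous_map_iterate[OF assms(1)]
        mspace_cube_funspace[OF assms(2)]]
    by (simp add: o_def)
  then have cont: "continuous_map (top_of_set X) ?P (orbit_map X T f)"
    by (simp add: continuous_map_componentwise_UNIV orbit_map_def)
  have "Hausdorff_space ?P"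
    by (simp add: Hausdorff_space_product_topology Hausdorff_space_subtopology)
  moreover have "compact_space (top_of_set X)"
    using assms(1) by (simp add: tds_def compact_space_subtopology)
  ultimately show "embedding_map (top_of_set X) ?P (orbit_map X T f)"
    using continuous_imp_closed_map[OF cont] cont inj
      injective_closed_imp_embedding_map by blast
next
  assume "embedding_map (top_of_set X)
      (product_topology (\<lambda>_::int. top_of_set unit_cube) UNIV) (orbit_map X T f)"
  then show "orbit_embedding X T f"
    using embedding_map_imp_homeomorphic_space
    by (auto simp: orbit_embedding_def embedding_map_def homeomorphic_map_def)
qed

end

theory Submission
  imports Defs
begin

text \<open>
  For a compact set \<open>Z\<close> of pairs of distinct points, the functions whose orbit map separates all pairs
  in \<open>Z\<close> form an open set, so it suffices to cover the complement of the diagonal by countably many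
  \<open>Z\<close> for which this set is dense.  To separate \<open>K1\<close> from \<open>K2\<close>, perturb the function so that, at
  finitely many times \<open>S\<close>, it is a piecewise linear function of a partition of unity of order at most
  \<open>D + 1\<close>, with vertex values in general position; two such images are disjoint when \<open>D1 + D2\<close> is less
  than \<open>card S * d\<close>.  On aperiodic nonwandering points \<open>S\<close> can be chosen as large as desired, and on points of
  exact period \<open>p\<close> the hypothesis on the periodic dimension is what is needed for \<open>S = {..<p}\<close>.

  The dimension of the wandering set is not bounded.  However, an orbit spends only a bounded number of
  times outside a given neighbourhood of the nonwandering set, and such a neighbourhood can be chosen to
  carry partitions of unity of the order dictated by the nonwandering set.  So the perturbation is made at a late
  time window in which the orbits stay near the nonwandering set; the window depends on the point.
\<close>

subsection \<open>Linear algebra in general position\<close>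

text \<open>Values can be prescribed at the times \<open>S\<close> only if the iterates involved do
  not collide: \<open>(T ^^ s) x\<close> and \<open>(T ^^ t) y\<close> must not be one point with
  two demands on it. This governs the case distinctions. Two points \<open>m\<close> steps apart on
  one orbit without period are observed at multiples of \<open>m + 1\<close> only, where their
  iterates never coincide. A finite orbit leaves no such room; two of its points are compared
  through the symmetry that equal itineraries would force. Iterates of a wandering and of a
  nonwandering point never meet, but those inside the nonwandering set do, so there the function is
  first made generic and then left alone.

  The bound on \<open>D1 + D2\<close> is general position in dimension
  \<open>card S * CARD('d)\<close>: simplices with \<open>D1 + 1\<close> and \<open>D2 + 1\<close>
  vertices are disjoint if together they have at most one vertex more than the dimension. The moved
  vertices must be generic, the others may be arbitrary, and this is why one of the two sets may be
  periodic with fewer distinct iterates than \<open>card S\<close>. Closedness of the periodic set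
  makes the aperiodic part sigma-compact, as the countable covers require.\<close>

lemma underdetermined_system:
  fixes u :: "'k \<Rightarrow> 'i \<Rightarrow> real"
  assumes "finite K" "finite I" "card K < card I"
  shows "\<exists>c. (\<exists>i\<in>I. c i \<noteq> 0) \<and> (\<forall>k\<in>K. (\<Sum>i\<in>I. c i * u k i) = 0)"
  using assms
proof (induction K arbitrary: I u rule: finite_induct)
  case empty
  then have "I \<noteq> {}" by auto
  then show ?case by (intro exI[of _ "\<lambda>_. 1"]) auto
next
  case (insert j K)
  show ?case
  proof (cases "\<forall>i\<in>I. u j i = 0")
    case True
    have "card K < card I" using insert by auto
    from insert.IH[OF insert.prems(1) this, of u] obtain c
      where "\<exists>i\<in>I. c i \<noteq> 0" "\<forall>k\<in>K. (\<Sum>i\<in>I. c i * u k i) = 0" by blast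
    then show ?thesis using True by (intro exI[of _ c]) auto
  next
    case False
    then obtain i0 where i0: "i0 \<in> I" "u j i0 \<noteq> 0" by blast
    define I' where "I' = I - {i0}"
    have I': "finite I'" "card K < card I'" "i0 \<notin> I'" "I = insert i0 I'"
      using insert i0 by (auto simp: I'_def)
    \<comment> \<open>Gaussian elimination: equation \<open>j\<close> serves as pivot for the
      unknown \<open>i0\<close>, whose value is restored in \<open>c'\<close> below.\<close>
    define u' where "u' k i = u k i - u k i0 * u j i / u j i0" for k i
    from insert.IH[OF I'(1,2), of u'] obtain c
      where c: "\<exists>i\<in>I'. c i \<noteq> 0" "\<forall>k\<in>K. (\<Sum>i\<in>I'. c i * u' k i) = 0" by blast
    define s where "s = (\<Sum>i\<in>I'. c i * u j i)"
    define c' where "c' = c(i0 := - s / u j i0)"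
    have sum: "(\<Sum>i\<in>I. c' i * u k i) = - s / u j i0 * u k i0 + (\<Sum>i\<in>I'. c i * u k i)" for k
    proof -
      have "(\<Sum>i\<in>I'. c' i * u k i) = (\<Sum>i\<in>I'. c i * u k i)"
        using I'(3) by (intro sum.cong) (auto simp: c'_def)
      then show ?thesis using I' by (simp add: c'_def)
    qed
    have "(\<Sum>i\<in>I'. c i * u k i) = s * u k i0 / u j i0" if "k \<in> K" for k
    proof -
      have "0 = (\<Sum>i\<in>I'. c i * u k i - c i * u j i * (u k i0 / u j i0))"
      proof -
        have "c i * u k i - c i * u j i * (u k i0 / u j i0) = c i * u' k i" for i
          by (simp add: u'_def right_diff_distrib)
        then show ?thesis using c(2) that by simp
      qed
      also have "\<dots> = (\<Sum>i\<in>I'. c i * u k i) - s * (u k i0 / u j i0)"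
        by (simp add: sum_subtractf s_def sum_distrib_right sum_divide_distrib)
      finally show ?thesis by simp
    qed
    then have "\<forall>k\<in>K. (\<Sum>i\<in>I. c' i * u k i) = 0" by (simp add: sum)
    moreover have "(\<Sum>i\<in>I. c' i * u j i) = 0" using i0 by (simp add: sum s_def)
    moreover have "\<exists>i\<in>I. c' i \<noteq> 0" using c(1) I' by (auto simp: c'_def)
    ultimately show ?thesis by blast
  qed
qed

text \<open>Subtracting one of the points removes the unknown constant \<open>e\<close> and one
  equation, so \<open>card K \<le> card I\<close> is enough here although the homogeneous system
  needs a strict inequality.\<close>

lemma hyperplane_through_points:
  fixes p :: "'k \<Rightarrow> 'i \<Rightarrow> real"
  assumes "finite K" "finite I" "card K \<le> card I" "K \<noteq> {}"
  shows "\<exists>c e. (\<exists>i\<in>I. c i \<noteq> 0) \<and> (\<forall>k\<in>K. (\<Sum>i\<in>I. c i * p k i) = e)"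
proof -
  from assms obtain k0 where k0: "k0 \<in> K" by blast
  have "card (K - {k0}) < card I"
    using assms k0 by (metis card_Diff1_less order_less_le_trans)
  from underdetermined_system[OF _ assms(2) this, of "\<lambda>k i. p k i - p k0 i"] assms(1)
  obtain c where c: "\<exists>i\<in>I. c i \<noteq> 0"
    "\<forall>k\<in>K - {k0}. (\<Sum>i\<in>I. c i * (p k i - p k0 i)) = 0" by auto
  have "(\<Sum>i\<in>I. c i * p k i) = (\<Sum>i\<in>I. c i * p k0 i)" if "k \<in> K" for k
    using c(2) that by (cases "k = k0") (auto simp: right_diff_distrib sum_subtractf)
  with c(1) show ?thesis by blast
qed

text \<open>For each new hyperplane the point moves along one coordinate \<open>i0\<close>
  transversal to it. A hyperplane parallel to that direction is among those already avoided and
  stays avoided; every other one excludes a single step length.\<close>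

lemma avoid_hyperplanes:
  fixes a0 :: "'i \<Rightarrow> real" and H :: "(('i \<Rightarrow> real) \<times> real) set"
  assumes "finite H" "finite I" "\<And>c e. (c, e) \<in> H \<Longrightarrow> \<exists>i\<in>I. c i \<noteq> 0"
    and "\<And>i. i \<in> I \<Longrightarrow> a0 i \<in> {0..1}" "\<epsilon> > 0"
  shows "\<exists>a. (\<forall>i\<in>I. a i \<in> {0..1} \<and> \<bar>a i - a0 i\<bar> \<le> \<epsilon>) \<and>
             (\<forall>(c, e)\<in>H. (\<Sum>i\<in>I. c i * a i) \<noteq> e)"
  using assms
proof (induction H arbitrary: \<epsilon> rule: finite_induct)
  case empty
  then show ?case by (intro exI[of _ a0]) auto
next
  case (insert h H)
  obtain c e where h: "h = (c, e)" by force
  from insert.prems(2) h obtain i0 where i0: "i0 \<in> I" "c i0 \<noteq> 0" by blast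
  have "\<And>c e. (c, e) \<in> H \<Longrightarrow> \<exists>i\<in>I. c i \<noteq> 0" using insert.prems(2) by blast
  from insert.IH[OF insert.prems(1) this insert.prems(3), where \<epsilon> = "\<epsilon> / 2"] insert.prems(4)
  obtain a where a: "\<And>i. i \<in> I \<Longrightarrow> a i \<in> {0..1} \<and> \<bar>a i - a0 i\<bar> \<le> \<epsilon> / 2"
    and aH: "\<And>c e. (c, e) \<in> H \<Longrightarrow> (\<Sum>i\<in>I. c i * a i) \<noteq> e"
    by fastforce
  have upd: "(\<Sum>i\<in>I. b i * (a(i0 := a i0 + t)) i) = (\<Sum>i\<in>I. b i * a i) + b i0 * t" for b t
  proof -
    have "(\<Sum>i\<in>I. b i * (a(i0 := a i0 + t)) i) = (\<Sum>i\<in>I. b i * a i + (if i = i0 then b i0 * t else 0))"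
      by (intro sum.cong) (auto simp: algebra_simps)
    then show ?thesis using insert.prems(1) i0 by (simp add: sum.distrib)
  qed
  \<comment> \<open>The step lengths that respect the unit interval and the second half of the
    tolerance. Since \<open>a i0\<close> lies in the unit interval, one direction is always free and
    this interval is not degenerate.\<close>
  define T where "T = {max (- \<epsilon> / 2) (- a i0) .. min (\<epsilon> / 2) (1 - a i0)}"
  have "max (- \<epsilon> / 2) (- a i0) < min (\<epsilon> / 2) (1 - a i0)"
    using a[OF i0(1)] insert.prems(4) by auto
  then have "infinite T" unfolding T_def by (rule infinite_Icc)
  moreover have "finite {t. \<exists>(b, f)\<in>insert h H. (\<Sum>i\<in>I. b i * a i) + b i0 * t = f}" (is "finite ?B")
  proof -
    have "finite {t. (\<Sum>i\<in>I. b i * a i) + b i0 * t = f}" if "(b, f) \<in> insert h H" for b f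
    proof (cases "b i0 = 0")
      case True
      with that i0 h have "(b, f) \<in> H" by auto
      then show ?thesis using aH True by simp
    next
      case False
      then have "{t. (\<Sum>i\<in>I. b i * a i) + b i0 * t = f} \<subseteq> {(f - (\<Sum>i\<in>I. b i * a i)) / b i0}"
        by (auto simp: field_simps)
      then show ?thesis using finite_subset by blast
    qed
    then have "finite (\<Union>(b, f)\<in>insert h H. {t. (\<Sum>i\<in>I. b i * a i) + b i0 * t = f})"
      using insert.hyps(1) by (intro finite_UN_I) auto
    then show ?thesis by (rule rev_finite_subset) auto
  qed
  ultimately obtain t where t: "t \<in> T" "t \<notin> ?B"
    using finite_subset[of T ?B] by blast
  have "(a(i0 := a i0 + t)) i \<in> {0..1} \<and> \<bar>(a(i0 := a i0 + t)) i - a0 i\<bar> \<le> \<epsilon>" if "i \<in> I" for i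
  proof (cases "i = i0")
    case True
    have "\<bar>a i0 + t - a0 i0\<bar> \<le> \<bar>a i0 - a0 i0\<bar> + \<bar>t\<bar>" by linarith
    also have "\<dots> \<le> \<epsilon> / 2 + \<epsilon> / 2"
      using a[OF i0(1)] t(1) by (intro add_mono) (auto simp: T_def)
    finally show ?thesis using True a[OF i0(1)] t(1) by (auto simp: T_def)
  qed (use a[OF that] insert.prems(4) in auto)
  moreover have "\<forall>(b, f)\<in>insert h H. (\<Sum>i\<in>I. b i * (a(i0 := a i0 + t)) i) \<noteq> f"
    using t(2) unfolding upd by blast
  ultimately show ?case by blast
qed

lemma general_position:
  fixes a0 o' :: "'j \<Rightarrow> 'i \<Rightarrow> real" and b :: "'k \<Rightarrow> 'i \<Rightarrow> real"
  assumes "finite J" "finite K" "finite I" "\<epsilon> > 0"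
    and "\<And>j i. j \<in> J \<Longrightarrow> i \<in> I \<Longrightarrow> a0 j i \<in> {0..1}"
  shows "\<exists>a. (\<forall>j\<in>J. \<forall>i\<in>I. a j i \<in> {0..1} \<and> \<bar>a j i - a0 j i\<bar> \<le> \<epsilon>) \<and>
    (\<forall>\<xi> \<mu>. sum \<xi> J = 1 \<longrightarrow> sum \<mu> K = 1 \<longrightarrow>
       card {j\<in>J. \<xi> j \<noteq> 0} + card {k\<in>K. \<mu> k \<noteq> 0} \<le> Suc (card I) \<longrightarrow>
       (\<exists>i\<in>I. (\<Sum>j\<in>J. \<xi> j * (a j i + o' j i)) \<noteq> (\<Sum>k\<in>K. \<mu> k * b k i)))"
  using assms
proof (induction J rule: finite_induct)
  case empty
  then show ?case by simp
next
  case (insert j0 J)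
  have "\<And>j i. j \<in> J \<Longrightarrow> i \<in> I \<Longrightarrow> a0 j i \<in> {0..1}" using insert.prems(4) by blast
  from insert.IH[OF insert.prems(1,2,3) this] obtain a
    where a: "\<And>j i. j \<in> J \<Longrightarrow> i \<in> I \<Longrightarrow> a j i \<in> {0..1} \<and> \<bar>a j i - a0 j i\<bar> \<le> \<epsilon>"
    and gen: "\<And>\<xi> \<mu>. sum \<xi> J = 1 \<Longrightarrow> sum \<mu> K = 1 \<Longrightarrow>
       card {j\<in>J. \<xi> j \<noteq> 0} + card {k\<in>K. \<mu> k \<noteq> 0} \<le> Suc (card I) \<Longrightarrow>
       (\<exists>i\<in>I. (\<Sum>j\<in>J. \<xi> j * (a j i + o' j i)) \<noteq> (\<Sum>k\<in>K. \<mu> k * b k i))"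
    by blast
  \<comment> \<open>The supports without \<open>j0\<close>: the bound drops from
    \<open>Suc (card I)\<close> to \<open>card I\<close> because \<open>j0\<close> is counted in the
    former. \<open>B\<close> is nonempty since the coefficients in \<open>\<mu>\<close> sum to
    1.\<close>
  define Q where "Q = {(A, B). A \<subseteq> J \<and> B \<subseteq> K \<and> B \<noteq> {} \<and> card A + card B \<le> card I}"
  have "\<forall>q\<in>Q. \<exists>c e. (\<exists>i\<in>I. c i \<noteq> 0) \<and> (\<forall>j\<in>fst q. (\<Sum>i\<in>I. c i * (a j i + o' j i)) = e) \<and>
      (\<forall>k\<in>snd q. (\<Sum>i\<in>I. c i * b k i) = e)"
  proof
    fix q assume "q \<in> Q"
    then obtain A B where q: "q = (A, B)" "A \<subseteq> J" "B \<subseteq> K" "B \<noteq> {}" "card A + card B \<le> card I"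
      by (auto simp: Q_def)
    have fin: "finite A" "finite B" using q insert finite_subset by metis+
    have "card (Inl ` A \<union> Inr ` B) = card A + card B"
      using fin by (subst card_Un_disjoint) (auto simp: card_image)
    then obtain c e where ce: "\<exists>i\<in>I. c i \<noteq> 0"
      "\<forall>k\<in>Inl ` A \<union> Inr ` B. (\<Sum>i\<in>I. c i * (case_sum (\<lambda>j i. a j i + o' j i) b) k i) = e"
      using hyperplane_through_points[of "Inl ` A \<union> Inr ` B" I "case_sum (\<lambda>j i. a j i + o' j i) b"]
        fin q insert.prems by auto
    show "\<exists>c e. (\<exists>i\<in>I. c i \<noteq> 0) \<and> (\<forall>j\<in>fst q. (\<Sum>i\<in>I. c i * (a j i + o' j i)) = e) \<and>
      (\<forall>k\<in>snd q. (\<Sum>i\<in>I. c i * b k i) = e)"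
    proof (intro exI[of _ c] exI[of _ e] conjI ballI)
      show "(\<Sum>i\<in>I. c i * (a j i + o' j i)) = e" if "j \<in> fst q" for j
        using ce(2) q(1) that by (auto dest!: bspec[of _ _ "Inl j"])
      show "(\<Sum>i\<in>I. c i * b k i) = e" if "k \<in> snd q" for k
        using ce(2) q(1) that by (auto dest!: bspec[of _ _ "Inr k"])
    qed (use ce in auto)
  qed
  from bchoice[OF this] obtain C where "\<forall>q\<in>Q. \<exists>e. (\<exists>i\<in>I. C q i \<noteq> 0) \<and>
      (\<forall>j\<in>fst q. (\<Sum>i\<in>I. C q i * (a j i + o' j i)) = e) \<and>
      (\<forall>k\<in>snd q. (\<Sum>i\<in>I. C q i * b k i) = e)" ..
  from bchoice[OF this] obtain E where "\<forall>q\<in>Q. (\<exists>i\<in>I. C q i \<noteq> 0) \<and>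
      (\<forall>j\<in>fst q. (\<Sum>i\<in>I. C q i * (a j i + o' j i)) = E q) \<and>
      (\<forall>k\<in>snd q. (\<Sum>i\<in>I. C q i * b k i) = E q)" ..
  then have CE: "\<And>q. q \<in> Q \<Longrightarrow> \<exists>i\<in>I. C q i \<noteq> 0"
      "\<And>q j. q \<in> Q \<Longrightarrow> j \<in> fst q \<Longrightarrow> (\<Sum>i\<in>I. C q i * (a j i + o' j i)) = E q"
      "\<And>q k. q \<in> Q \<Longrightarrow> k \<in> snd q \<Longrightarrow> (\<Sum>i\<in>I. C q i * b k i) = E q"
    by blast+
  define H where "H = (\<lambda>q. (C q, E q - (\<Sum>i\<in>I. C q i * o' j0 i))) ` Q"
  have "finite Q"
    by (rule finite_subset[of _ "Pow J \<times> Pow K"]) (use insert.hyps insert.prems(1) in \<open>auto simp: Q_def\<close>)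
  then have "finite H" by (simp add: H_def)
  have "\<exists>a. (\<forall>i\<in>I. a i \<in> {0..1} \<and> \<bar>a i - a0 j0 i\<bar> \<le> \<epsilon>) \<and>
             (\<forall>(c, e)\<in>H. (\<Sum>i\<in>I. c i * a i) \<noteq> e)"
  proof (rule avoid_hyperplanes[OF \<open>finite H\<close> insert.prems(2)])
    show "\<exists>i\<in>I. c i \<noteq> 0" if "(c, e) \<in> H" for c e
      using that CE(1) unfolding H_def by blast
  qed (use insert.prems in auto)
  then obtain v where v: "\<And>i. i \<in> I \<Longrightarrow> v i \<in> {0..1} \<and> \<bar>v i - a0 j0 i\<bar> \<le> \<epsilon>"
    and "\<And>c e. (c, e) \<in> H \<Longrightarrow> (\<Sum>i\<in>I. c i * v i) \<noteq> e"
    by blast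
  then have vH: "\<And>q. q \<in> Q \<Longrightarrow> (\<Sum>i\<in>I. C q i * v i) \<noteq> E q - (\<Sum>i\<in>I. C q i * o' j0 i)"
    unfolding H_def by blast
  define a' where "a' = a(j0 := v)"
  have a'J: "a' j = a j" if "j \<in> J" for j using that insert.hyps by (auto simp: a'_def)
  have "\<exists>i\<in>I. (\<Sum>j\<in>insert j0 J. \<xi> j * (a' j i + o' j i)) \<noteq> (\<Sum>k\<in>K. \<mu> k * b k i)"
    if s: "sum \<xi> (insert j0 J) = 1" "sum \<mu> K = 1"
      "card {j\<in>insert j0 J. \<xi> j \<noteq> 0} + card {k\<in>K. \<mu> k \<noteq> 0} \<le> Suc (card I)" for \<xi> \<mu>
  proof (cases "\<xi> j0 = 0")
    case True
    then have "{j\<in>insert j0 J. \<xi> j \<noteq> 0} = {j\<in>J. \<xi> j \<noteq> 0}" by auto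
    with s gen[of \<xi> \<mu>] insert.hyps True obtain i where
      "i \<in> I" "(\<Sum>j\<in>J. \<xi> j * (a j i + o' j i)) \<noteq> (\<Sum>k\<in>K. \<mu> k * b k i)" by auto
    then show ?thesis using insert.hyps True by (intro bexI[of _ i]) (auto simp: a'J)
  next
    case False
    define A where "A = {j\<in>J. \<xi> j \<noteq> 0}"
    define B where "B = {k\<in>K. \<mu> k \<noteq> 0}"
    have "{j\<in>insert j0 J. \<xi> j \<noteq> 0} = insert j0 A" using False by (auto simp: A_def)
    then have "card A + card B \<le> card I"
      using s(3) insert.hyps by (simp add: A_def B_def)
    moreover have "B \<noteq> {}"
    proof
      assume "B = {}"
      then have "sum \<mu> K = 0" by (intro sum.neutral) (auto simp: B_def)
      with s(2) show False by simp
    qed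
    ultimately have q: "(A, B) \<in> Q" by (auto simp: Q_def A_def B_def)
    define c where "c = C (A, B)"
    define e where "e = E (A, B)"
    have cj: "\<xi> j * (\<Sum>i\<in>I. c i * (a j i + o' j i)) = \<xi> j * e" if "j \<in> J" for j
      using CE(2)[OF q, of j] that by (auto simp: A_def c_def e_def)
    have ck: "\<mu> k * (\<Sum>i\<in>I. c i * b k i) = \<mu> k * e" if "k \<in> K" for k
      using CE(3)[OF q, of k] that by (auto simp: B_def c_def e_def)
    show ?thesis
    proof (rule ccontr)
      assume "\<not> ?thesis"
      then have eq: "(\<Sum>j\<in>insert j0 J. \<xi> j * (a' j i + o' j i)) = (\<Sum>k\<in>K. \<mu> k * b k i)"
        if "i \<in> I" for i using that by blast
      \<comment> \<open>The functional \<open>c\<close> equals \<open>e\<close> on all points of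
        \<open>A\<close> and \<open>B\<close>, so applied to the relation it leaves a condition on
        the position of \<open>j0\<close> alone.\<close>
      have "(\<Sum>i\<in>I. c i * (\<Sum>k\<in>K. \<mu> k * b k i)) = (\<Sum>i\<in>I. \<Sum>k\<in>K. \<mu> k * (c i * b k i))"
        by (simp add: sum_distrib_left algebra_simps)
      also have "\<dots> = (\<Sum>k\<in>K. \<mu> k * (\<Sum>i\<in>I. c i * b k i))"
        by (subst sum.swap) (simp add: sum_distrib_left)
      also have "\<dots> = (\<Sum>k\<in>K. \<mu> k * e)" using ck by (intro sum.cong) auto
      also have "\<dots> = e" using s(2) by (simp flip: sum_distrib_right)
      finally have 1: "(\<Sum>i\<in>I. c i * (\<Sum>k\<in>K. \<mu> k * b k i)) = e" .
      have "(\<Sum>i\<in>I. c i * (\<Sum>j\<in>insert j0 J. \<xi> j * (a' j i + o' j i)))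
          = (\<Sum>i\<in>I. \<Sum>j\<in>insert j0 J. \<xi> j * (c i * (a' j i + o' j i)))"
        by (intro sum.cong refl, subst sum_distrib_left) (intro sum.cong refl, simp)
      also have "\<dots> = (\<Sum>j\<in>insert j0 J. \<xi> j * (\<Sum>i\<in>I. c i * (a' j i + o' j i)))"
        by (subst sum.swap) (simp only: sum_distrib_left)
      also have "\<dots> = \<xi> j0 * (\<Sum>i\<in>I. c i * (v i + o' j0 i)) + (\<Sum>j\<in>J. \<xi> j * e)"
        using insert.hyps cj by (simp add: a'_def) (intro sum.cong, auto)
      also have "(\<Sum>j\<in>J. \<xi> j * e) = (1 - \<xi> j0) * e"
        using s(1) insert.hyps by (simp flip: sum_distrib_right)
      finally have "e = \<xi> j0 * (\<Sum>i\<in>I. c i * (v i + o' j0 i)) + (1 - \<xi> j0) * e"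
        using 1 eq by simp
      then have "\<xi> j0 * ((\<Sum>i\<in>I. c i * (v i + o' j0 i)) - e) = 0"
        unfolding right_diff_distrib left_diff_distrib by linarith
      then have "(\<Sum>i\<in>I. c i * (v i + o' j0 i)) = e" using False by simp
      then have "(\<Sum>i\<in>I. c i * v i) = e - (\<Sum>i\<in>I. c i * o' j0 i)"
        by (simp add: distrib_left sum.distrib)
      then show False using vH[OF q] by (simp add: c_def e_def)
    qed
  qed
  moreover have "a' j i \<in> {0..1} \<and> \<bar>a' j i - a0 j i\<bar> \<le> \<epsilon>" if "j \<in> insert j0 J" "i \<in> I" for j i
    using that v a by (auto simp: a'_def)
  ultimately show ?case by blast
qed

subsection \<open>Continuous cube-valued functions on a compact system\<close>

lemma tietze_interval:
  fixes g :: "'a::metric_space \<Rightarrow> real"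
  assumes "compact X" "compact L" "L \<subseteq> X" "continuous_on L g" "g ` L \<subseteq> {a..b}" "a \<le> b"
  obtains h where "continuous_on X h" "h ` X \<subseteq> {a..b}" "\<And>x. x \<in> L \<Longrightarrow> h x = g x"
proof -
  have "normal_space (top_of_set X)"
    by (intro metrizable_imp_normal_space metrizable_space_subtopology metrizable_space_euclidean)
  moreover have "closedin (top_of_set X) L"
    using assms by (simp add: compact_imp_closed closed_subset)
  moreover have "continuous_map (subtopology (top_of_set X) L) euclideanreal g"
    using assms by (simp add: subtopology_subtopology Int_absorb1)
  ultimately obtain h where "continuous_map (top_of_set X) euclideanreal h"
    "\<And>x. x \<in> L \<Longrightarrow> h x = g x" "h ` topspace (top_of_set X) \<subseteq> {a..b}"
    using Tietze_extension_closed_real_interval assms(5,6) by metis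
  then show ?thesis using that by auto
qed

locale compact_system =
  fixes X :: "'a::metric_space set" and T :: "'a \<Rightarrow> 'a"
  assumes compact_X: "compact X" and cont_T: "continuous_on X T"
    and inj_T: "inj_on T X" and surj_T: "T ` X = X"
begin

lemma funpow_in: "x \<in> X \<Longrightarrow> (T ^^ n) x \<in> X"
  using surj_T by (induction n) auto

lemma funpow_image: "(T ^^ n) ` X = X"
proof (induction n)
  case (Suc n)
  then show ?case unfolding funpow.simps image_comp[symmetric] by (simp add: surj_T)
qed simp

lemma cont_funpow: "continuous_on X (T ^^ n)"
proof (induction n)
  case (Suc n)
  have "continuous_on ((T ^^ n) ` X) T" using cont_T by (simp add: funpow_image)
  then show ?case unfolding funpow.simps by (rule continuous_on_compose[OF Suc])
qed (auto simp: id_def)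

lemma inj_funpow: "inj_on (T ^^ n) X"
proof (induction n)
  case (Suc n)
  have "inj_on T ((T ^^ n) ` X)" using inj_T by (simp add: funpow_image)
  then show ?case unfolding funpow.simps by (rule comp_inj_on[OF Suc])
qed (auto simp: id_def)

lemma funpow_eqD: "(T ^^ n) x = (T ^^ n) y \<Longrightarrow> x \<in> X \<Longrightarrow> y \<in> X \<Longrightarrow> x = y"
  using inj_funpow by (metis inj_onD)

definition cube_fun :: "('a \<Rightarrow> real ^ 'd) \<Rightarrow> bool" where
  "cube_fun f \<longleftrightarrow> continuous_on X f \<and> f ` X \<subseteq> unit_cube"

text \<open>Measured by coordinates rather than in the Euclidean norm, because values are prescribed
  coordinate by coordinate; non-strict, so that successive perturbations simply add up.\<close>

definition near :: "real \<Rightarrow> ('a \<Rightarrow> real ^ 'd) \<Rightarrow> ('a \<Rightarrow> real ^ 'd) \<Rightarrow> bool" where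
  "near \<epsilon> f g \<longleftrightarrow> (\<forall>x\<in>X. \<forall>i. \<bar>g x $ i - f x $ i\<bar> \<le> \<epsilon>)"

lemma near_refl: "\<epsilon> \<ge> 0 \<Longrightarrow> near \<epsilon> f f"
  by (simp add: near_def)

lemma near_trans: "near \<epsilon> f g \<Longrightarrow> near \<delta> g h \<Longrightarrow> \<epsilon> + \<delta> \<le> \<eta> \<Longrightarrow> near \<eta> f h"
  unfolding near_def
proof (intro ballI allI)
  fix x i assume a: "\<forall>x\<in>X. \<forall>i. \<bar>g x $ i - f x $ i\<bar> \<le> \<epsilon>" "\<forall>x\<in>X. \<forall>i. \<bar>h x $ i - g x $ i\<bar> \<le> \<delta>"
    "\<epsilon> + \<delta> \<le> \<eta>" "x \<in> X"
  then have "\<bar>g x $ i - f x $ i\<bar> \<le> \<epsilon>" "\<bar>h x $ i - g x $ i\<bar> \<le> \<delta>" by blast+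
  with a(3) show "\<bar>h x $ i - f x $ i\<bar> \<le> \<eta>" by linarith
qed

lemma cube_fun_in: "cube_fun f \<Longrightarrow> x \<in> X \<Longrightarrow> f x $ i \<in> {0..1}"
  by (auto simp: cube_fun_def unit_cube_def)

lemma cube_fun_uniform:
  assumes "cube_fun f" "\<epsilon> > 0"
  obtains \<delta> where "\<delta> > 0"
    "\<And>x y i. x \<in> X \<Longrightarrow> y \<in> X \<Longrightarrow> dist x y < \<delta> \<Longrightarrow> \<bar>f x $ i - f y $ i\<bar> \<le> \<epsilon>"
proof -
  have "uniformly_continuous_on X f"
    using assms compact_X by (simp add: cube_fun_def compact_uniformly_continuous)
  then obtain \<delta> where d: "\<delta> > 0" "\<And>x y. x \<in> X \<Longrightarrow> y \<in> X \<Longrightarrow> dist y x < \<delta> \<Longrightarrow> dist (f y) (f x) < \<epsilon>"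
    using assms(2) unfolding uniformly_continuous_on_def by metis
  have "\<bar>f x $ i - f y $ i\<bar> \<le> \<epsilon>" if "x \<in> X" "y \<in> X" "dist x y < \<delta>" for x y i
  proof -
    have "\<bar>f x $ i - f y $ i\<bar> \<le> norm (f x - f y)"
      using component_le_norm_cart[of "f x - f y" i] by simp
    also have "\<dots> < \<epsilon>" using d(2)[of y x] that by (simp add: dist_norm)
    finally show ?thesis by simp
  qed
  with d(1) show ?thesis using that by blast
qed

text \<open>The common last step of all perturbations. \<open>compat\<close> says exactly that the
  prescriptions define one function on the union of the images. It is continuous because the images
  are finitely many compact sets, on each of which \<open>T ^^ s p\<close> has a continuous
  inverse.\<close>

lemma extend_pieces:
  fixes f :: "'a \<Rightarrow> real ^ 'd" and s :: "'k \<Rightarrow> nat"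
  assumes f: "cube_fun f" and \<epsilon>: "\<epsilon> \<ge> 0" and fin: "finite P"
    and K: "\<And>p. p \<in> P \<Longrightarrow> compact (K p) \<and> K p \<subseteq> X"
    and h: "\<And>p. p \<in> P \<Longrightarrow> continuous_on (K p) (h p)"
    and cube: "\<And>p x. p \<in> P \<Longrightarrow> x \<in> K p \<Longrightarrow> h p x \<in> unit_cube"
    and close: "\<And>p x i. p \<in> P \<Longrightarrow> x \<in> K p \<Longrightarrow> \<bar>h p x $ i - f ((T ^^ s p) x) $ i\<bar> \<le> \<epsilon>"
    and compat: "\<And>p q x y. p \<in> P \<Longrightarrow> q \<in> P \<Longrightarrow> x \<in> K p \<Longrightarrow> y \<in> K q \<Longrightarrow>
        (T ^^ s p) x = (T ^^ s q) y \<Longrightarrow> h p x = h q y"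
  obtains g where "cube_fun g" "near \<epsilon> f g"
    "\<And>p x. p \<in> P \<Longrightarrow> x \<in> K p \<Longrightarrow> g ((T ^^ s p) x) = h p x"
proof -
  define L where "L = (\<Union>p\<in>P. (T ^^ s p) ` K p)"
  have cp: "compact ((T ^^ s p) ` K p)" if "p \<in> P" for p
    using K[OF that] cont_funpow by (meson compact_continuous_image continuous_on_subset)
  then have L: "compact L" unfolding L_def using fin by (intro compact_UN) auto
  have LX: "L \<subseteq> X" unfolding L_def using K funpow_in by blast
  have "\<forall>z\<in>L. \<exists>v. \<forall>p\<in>P. \<forall>x\<in>K p. z = (T ^^ s p) x \<longrightarrow> v = h p x"
  proof
    fix z assume "z \<in> L"
    then obtain p x where "p \<in> P" "x \<in> K p" "z = (T ^^ s p) x" by (auto simp: L_def)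
    then show "\<exists>v. \<forall>p\<in>P. \<forall>x\<in>K p. z = (T ^^ s p) x \<longrightarrow> v = h p x"
      by (intro exI[of _ "h p x"]) (auto intro: compat)
  qed
  from bchoice[OF this] obtain G where G0: "\<forall>z\<in>L. \<forall>p\<in>P. \<forall>x\<in>K p. z = (T ^^ s p) x \<longrightarrow> G z = h p x" ..
  have G: "G ((T ^^ s p) x) = h p x" if "p \<in> P" "x \<in> K p" for p x
    using G0 that by (auto simp: L_def)
  have Gcube: "G z \<in> unit_cube" if "z \<in> L" for z using that cube G by (auto simp: L_def)
  have Gclose: "\<bar>G z $ i - f z $ i\<bar> \<le> \<epsilon>" if "z \<in> L" for z i using that close G by (auto simp: L_def)
  have contG: "continuous_on L G" unfolding L_def
  proof (rule continuous_on_closed_Union[OF fin])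
    fix p assume p: "p \<in> P"
    show "closed ((T ^^ s p) ` K p)" using cp[OF p] by (rule compact_imp_closed)
    define r where "r = inv_into (K p) (T ^^ s p)"
    have inj: "inj_on (T ^^ s p) (K p)" using K[OF p] inj_funpow inj_on_subset by blast
    have r: "r ((T ^^ s p) x) = x" if "x \<in> K p" for x
      using inj that by (simp add: r_def)
    have "continuous_on ((T ^^ s p) ` K p) r"
      using K[OF p] cont_funpow r
      by (intro continuous_on_inv) (auto intro: continuous_on_subset)
    moreover have "continuous_on (r ` (T ^^ s p) ` K p) (h p)"
      using h[OF p] r by (simp add: image_image)
    ultimately have "continuous_on ((T ^^ s p) ` K p) (h p \<circ> r)"
      by (rule continuous_on_compose)
    then show "continuous_on ((T ^^ s p) ` K p) G"
      by (rule continuous_on_eq) (auto simp: r G[OF p])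
  qed
  have contf: "continuous_on X f" using f by (simp add: cube_fun_def)
  \<comment> \<open>Extending the difference from \<open>f\<close>, and not the prescribed function
    itself, preserves the bound \<open>\<epsilon>\<close>. Clipping to the cube afterwards cannot
    increase the distance, as \<open>f\<close> takes values in the cube.\<close>
  have "\<exists>u. continuous_on X u \<and> u ` X \<subseteq> {-\<epsilon>..\<epsilon>} \<and> (\<forall>x\<in>L. u x = G x $ i - f x $ i)" for i
  proof -
    have "continuous_on L (\<lambda>x. G x $ i - f x $ i)"
      using contG contf LX by (intro continuous_intros) (auto intro: continuous_on_subset)
    moreover have "(\<lambda>x. G x $ i - f x $ i) ` L \<subseteq> {-\<epsilon>..\<epsilon>}"
    proof
      fix v assume "v \<in> (\<lambda>x. G x $ i - f x $ i) ` L"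
      then obtain x where "x \<in> L" "v = G x $ i - f x $ i" by blast
      with Gclose[of x i] show "v \<in> {-\<epsilon>..\<epsilon>}" by (auto simp: abs_le_iff)
    qed
    ultimately show ?thesis
      using tietze_interval[OF compact_X L LX, of "\<lambda>x. G x $ i - f x $ i" "-\<epsilon>" \<epsilon>] \<epsilon> by (metis neg_le_0_iff_le order_trans)
  qed
  then obtain u where u: "\<And>i. continuous_on X (u i)" "\<And>i. u i ` X \<subseteq> {-\<epsilon>..\<epsilon>}"
    "\<And>i x. x \<in> L \<Longrightarrow> u i x = G x $ i - f x $ i" by metis
  define g where "g x = (\<chi> i. max 0 (min 1 (f x $ i + u i x)))" for x
  have "continuous_on X g" unfolding g_def
    using u(1) contf by (intro continuous_intros)
  then have "cube_fun g" by (auto simp: cube_fun_def unit_cube_def g_def)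
  moreover have "near \<epsilon> f g" unfolding near_def
  proof (intro ballI allI)
    fix x i assume x: "x \<in> X"
    then have "u i x \<in> {-\<epsilon>..\<epsilon>}" using u(2) by blast
    then show "\<bar>g x $ i - f x $ i\<bar> \<le> \<epsilon>"
      using cube_fun_in[OF f x, of i] \<epsilon> by (auto simp: g_def max_def min_def abs_le_iff)
  qed
  moreover have "g ((T ^^ s p) x) = h p x" if px: "p \<in> P" "x \<in> K p" for p x
  proof -
    have z: "(T ^^ s p) x \<in> L" using px by (auto simp: L_def)
    have "g ((T ^^ s p) x) $ i = h p x $ i" for i
      using u(3)[OF z] G[OF px] cube[OF px] by (simp add: g_def unit_cube_def)
    then show ?thesis by (simp add: vec_eq_iff)
  qed
  ultimately show ?thesis using that by blast
qed

subsection \<open>Partitions of unity of bounded order\<close>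

lemma funpow_uniform:
  assumes "finite S" "\<delta> > 0"
  obtains \<rho> where "\<rho> > 0"
    "\<And>x y s. x \<in> X \<Longrightarrow> y \<in> X \<Longrightarrow> dist x y < \<rho> \<Longrightarrow> s \<in> S \<Longrightarrow> dist ((T ^^ s) x) ((T ^^ s) y) < \<delta>"
proof -
  have "\<exists>\<rho>>0. \<forall>x\<in>X. \<forall>y\<in>X. dist x y < \<rho> \<longrightarrow> (\<forall>s\<in>S. dist ((T ^^ s) x) ((T ^^ s) y) < \<delta>)"
    using assms(1)
  proof (induction S rule: finite_induct)
    case empty
    then show ?case by (intro exI[of _ 1]) auto
  next
    case (insert s S)
    then obtain r where r: "r > 0" "\<forall>x\<in>X. \<forall>y\<in>X. dist x y < r \<longrightarrow> (\<forall>s\<in>S. dist ((T ^^ s) x) ((T ^^ s) y) < \<delta>)"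
      by blast
    have "uniformly_continuous_on X (T ^^ s)"
      using compact_X cont_funpow by (simp add: compact_uniformly_continuous)
    then obtain q where q: "q > 0" "\<forall>x\<in>X. \<forall>y\<in>X. dist y x < q \<longrightarrow> dist ((T ^^ s) y) ((T ^^ s) x) < \<delta>"
      using assms(2) unfolding uniformly_continuous_on_def by metis
    show ?case
      using r q by (intro exI[of _ "min r q"]) (auto simp: dist_commute)
  qed
  then show ?thesis using that by blast
qed

text \<open>A map of \<open>L\<close> into a simplicial complex of dimension at most
  \<open>D\<close> such that the preimage of every open star is small at all times in
  \<open>S\<close>.\<close>

definition fine_pou :: "'a set \<Rightarrow> nat \<Rightarrow> nat set \<Rightarrow> real \<Rightarrow> 'k set \<Rightarrow> ('k \<Rightarrow> 'a \<Rightarrow> real) \<Rightarrow> bool" where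
  "fine_pou L D S \<delta> I \<phi> \<longleftrightarrow> finite I \<and> (\<forall>i\<in>I. continuous_on L (\<phi> i)) \<and>
    (\<forall>x\<in>L. (\<forall>i\<in>I. \<phi> i x \<ge> 0) \<and> (\<Sum>i\<in>I. \<phi> i x) = 1 \<and> card {i\<in>I. \<phi> i x \<noteq> 0} \<le> Suc D) \<and>
    (\<forall>i\<in>I. \<forall>x\<in>L. \<forall>y\<in>L. \<phi> i x \<noteq> 0 \<longrightarrow> \<phi> i y \<noteq> 0 \<longrightarrow>
       (\<forall>s\<in>S. dist ((T ^^ s) x) ((T ^^ s) y) < \<delta>))"

text \<open>The vertices are points of \<open>L\<close> themselves, so that a function can be
  sampled at their iterates and interpolated with the coefficients
  \<open>\<phi> c x\<close>.\<close>

definition pointed_pou :: "'a set \<Rightarrow> nat \<Rightarrow> nat set \<Rightarrow> real \<Rightarrow> 'a set \<Rightarrow> ('a \<Rightarrow> 'a \<Rightarrow> real) \<Rightarrow> bool" where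
  "pointed_pou L D S \<delta> J \<phi> \<longleftrightarrow> finite J \<and> J \<subseteq> L \<and> (\<forall>c\<in>J. continuous_on L (\<phi> c)) \<and>
    (\<forall>x\<in>L. (\<forall>c\<in>J. \<phi> c x \<ge> 0) \<and> (\<Sum>c\<in>J. \<phi> c x) = 1 \<and> card {c\<in>J. \<phi> c x \<noteq> 0} \<le> Suc D) \<and>
    (\<forall>c\<in>J. \<forall>x\<in>L. \<phi> c x \<noteq> 0 \<longrightarrow> (\<forall>s\<in>S. dist ((T ^^ s) x) ((T ^^ s) c) < \<delta>))"

lemma fine_pou_subset: "fine_pou L D S \<delta> I \<phi> \<Longrightarrow> L' \<subseteq> L \<Longrightarrow> fine_pou L' D S \<delta> I \<phi>"
  unfolding fine_pou_def by (meson continuous_on_subset subsetD)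

text \<open>Functions vanishing on \<open>L\<close> have no point to sample and are dropped. Those
  that happen to receive the same point are added up, which cannot increase the number of nonzero
  terms.\<close>

lemma pointed_pou_of_fine_pou:
  assumes "fine_pou L D S \<delta> I \<phi>"
  obtains J \<psi> where "pointed_pou L D S \<delta> J \<psi>"
proof -
  define I' where "I' = {i\<in>I. \<exists>x\<in>L. \<phi> i x \<noteq> 0}"
  have finI: "finite I" using assms by (simp add: fine_pou_def)
  then have finI': "finite I'" by (simp add: I'_def)
  have "\<forall>i\<in>I'. \<exists>x. x \<in> L \<and> \<phi> i x \<noteq> 0" by (auto simp: I'_def)
  from bchoice[OF this] obtain p where p: "\<And>i. i \<in> I' \<Longrightarrow> p i \<in> L \<and> \<phi> i (p i) \<noteq> 0" by blast
  define \<psi> where "\<psi> c x = (\<Sum>i\<in>{i\<in>I'. p i = c}. \<phi> i x)" for c x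
  have ex: "\<exists>i\<in>I'. p i = c \<and> \<phi> i x \<noteq> 0" if "\<psi> c x \<noteq> 0" for c x
  proof (rule ccontr)
    assume "\<not> ?thesis"
    then have "\<psi> c x = 0" unfolding \<psi>_def by (intro sum.neutral) auto
    with that show False by simp
  qed
  have "pointed_pou L D S \<delta> (p ` I') \<psi>" unfolding pointed_pou_def
  proof (intro conjI ballI impI)
    show "finite (p ` I')" using finI' by simp
    show "p ` I' \<subseteq> L" using p by auto
    show "continuous_on L (\<psi> c)" for c unfolding \<psi>_def
      by (rule continuous_on_sum) (use assms in \<open>auto simp: fine_pou_def I'_def\<close>)
  next
    fix x assume x: "x \<in> L"
    show "\<psi> c x \<ge> 0" for c unfolding \<psi>_def
      by (rule sum_nonneg) (use assms x in \<open>auto simp: fine_pou_def I'_def\<close>)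
    have "(\<Sum>c\<in>p ` I'. \<psi> c x) = (\<Sum>i\<in>I'. \<phi> i x)"
      unfolding \<psi>_def by (rule sum.group) (use finI' in auto)
    also have "\<dots> = (\<Sum>i\<in>I. \<phi> i x)"
      by (rule sum.mono_neutral_left) (use finI x in \<open>auto simp: I'_def\<close>)
    finally show "(\<Sum>c\<in>p ` I'. \<psi> c x) = 1" using assms x by (simp add: fine_pou_def)
    have "{c\<in>p ` I'. \<psi> c x \<noteq> 0} \<subseteq> p ` {i\<in>I. \<phi> i x \<noteq> 0}"
    proof
      fix c assume "c \<in> {c\<in>p ` I'. \<psi> c x \<noteq> 0}"
      then obtain i where "i \<in> I'" "p i = c" "\<phi> i x \<noteq> 0" using ex by blast
      then show "c \<in> p ` {i \<in> I. \<phi> i x \<noteq> 0}" by (auto simp: I'_def)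
    qed
    then have "card {c\<in>p ` I'. \<psi> c x \<noteq> 0} \<le> card {i\<in>I. \<phi> i x \<noteq> 0}"
      by (intro surj_card_le) (use finI in auto)
    then show "card {c\<in>p ` I'. \<psi> c x \<noteq> 0} \<le> Suc D"
      using assms x by (auto simp: fine_pou_def intro: order_trans)
  next
    fix c x s assume cx: "c \<in> p ` I'" "x \<in> L" "\<psi> c x \<noteq> 0" and s: "s \<in> S"
    from ex[OF cx(3)] obtain i where i: "i \<in> I'" "p i = c" "\<phi> i x \<noteq> 0" by blast
    then show "dist ((T ^^ s) x) ((T ^^ s) c) < \<delta>"
      using assms p[OF i(1)] cx s unfolding fine_pou_def I'_def by blast
  qed
  then show ?thesis using that by blast
qed

text \<open>The dimension is applied to a cover by balls so small that points of one ball stay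
  \<open>\<delta>\<close>-close under all iterates in \<open>S\<close>; the order of the refinement
  bounds the order of a partition of unity subordinate to it.\<close>

lemma fine_pou_exists:
  assumes Y: "compact Y" "Y \<subseteq> X" and D: "covering_dim_le (top_of_set Y) (int D)"
    and S: "finite S" "\<delta> > 0"
  obtains I :: "'a set set" and \<phi> where "fine_pou Y D S \<delta> I \<phi>"
proof -
  obtain \<rho> where \<rho>: "\<rho> > 0" "\<And>x y s. x \<in> X \<Longrightarrow> y \<in> X \<Longrightarrow> dist x y < \<rho> \<Longrightarrow> s \<in> S
      \<Longrightarrow> dist ((T ^^ s) x) ((T ^^ s) y) < \<delta>"
    using funpow_uniform[OF S] by metis
  have "Y \<subseteq> (\<Union>c\<in>Y. ball c (\<rho>/2))" using \<rho>(1) by auto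
  then obtain C where C: "C \<subseteq> Y" "finite C" "Y \<subseteq> (\<Union>c\<in>C. ball c (\<rho>/2))"
    using compactE_image[OF Y(1), of Y "\<lambda>c. ball c (\<rho>/2)"] by blast
  define \<U> where "\<U> = (\<lambda>c. Y \<inter> ball c (\<rho>/2)) ` C"
  have "finite_open_cover (top_of_set Y) \<U>"
    unfolding finite_open_cover_def \<U>_def using C by (auto simp: openin_open)
  then obtain \<V> where V: "finite_open_cover (top_of_set Y) \<V>" "refines \<V> \<U>"
    "\<And>x. x \<in> Y \<Longrightarrow> card {V \<in> \<V>. x \<in> V} \<le> Suc D"
    using D unfolding covering_dim_le_def by fastforce
  have fV: "finite \<V>" "\<Union>\<V> = Y" using V(1) by (auto simp: finite_open_cover_def)
  \<comment> \<open>The partition of unity is taken for sets open in the ambient space, so each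
    relatively open member is the trace of some \<open>U V\<close>.\<close>
  have "\<forall>V\<in>\<V>. \<exists>U. open U \<and> V = Y \<inter> U"
    using V(1) by (auto simp: finite_open_cover_def openin_open)
  from bchoice[OF this] obtain U where U: "\<And>V. V \<in> \<V> \<Longrightarrow> open (U V) \<and> V = Y \<inter> U V" by blast
  define \<C> where "\<C> = U ` \<V>"
  have finC: "finite \<C>" using fV by (simp add: \<C>_def)
  have "Y \<subseteq> \<Union>\<C>" using fV U by (auto simp: \<C>_def)
  moreover have "open W" if "W \<in> \<C>" for W using that U by (auto simp: \<C>_def)
  moreover have "\<exists>V. open V \<and> x \<in> V \<and> finite {U \<in> \<C>. U \<inter> V \<noteq> {}}" for x
    using finC by (intro exI[of _ UNIV]) auto
  ultimately obtain F :: "'a set \<Rightarrow> 'a \<Rightarrow> real"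
    where F: "\<And>W. W \<in> \<C> \<Longrightarrow> continuous_on Y (F W) \<and> (\<forall>x \<in> Y. 0 \<le> F W x)"
      "\<And>x W. W \<in> \<C> \<Longrightarrow> x \<in> Y \<Longrightarrow> x \<notin> W \<Longrightarrow> F W x = 0"
      "\<And>x. x \<in> Y \<Longrightarrow> supp_sum (\<lambda>W. F W x) \<C> = 1"
    by (rule subordinate_partition_of_unity[of Y \<C>]) blast+
  have "fine_pou Y D S \<delta> \<C> F" unfolding fine_pou_def
  proof (intro conjI ballI impI)
    show "finite \<C>" by fact
    show "continuous_on Y (F W)" if "W \<in> \<C>" for W using F(1) that by blast
  next
    fix x assume x: "x \<in> Y"
    show "F W x \<ge> 0" if "W \<in> \<C>" for W using F(1) that x by blast
    have "supp_sum (\<lambda>W. F W x) \<C> = (\<Sum>W\<in>\<C>. F W x)"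
      unfolding supp_sum_def support_on_def by (rule sum.mono_neutral_left) (use finC in auto)
    then show "(\<Sum>W\<in>\<C>. F W x) = 1" using F(3)[OF x] by simp
    have "{W\<in>\<C>. F W x \<noteq> 0} \<subseteq> U ` {V\<in>\<V>. x \<in> V}"
      using F(2)[OF _ x] U x unfolding \<C>_def by blast
    moreover have "finite {V\<in>\<V>. x \<in> V}" using fV by simp
    ultimately have "card {W\<in>\<C>. F W x \<noteq> 0} \<le> card {V\<in>\<V>. x \<in> V}"
      by (rule surj_card_le[rotated])
    then show "card {W\<in>\<C>. F W x \<noteq> 0} \<le> Suc D" using V(3)[OF x] by linarith
  next
    fix W x y s assume W: "W \<in> \<C>" "x \<in> Y" "y \<in> Y" "F W x \<noteq> 0" "F W y \<noteq> 0" and s: "s \<in> S"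
    then obtain V where "V \<in> \<V>" "x \<in> V" "y \<in> V" using F(2) U unfolding \<C>_def by blast
    then obtain c where "c \<in> C" "x \<in> ball c (\<rho>/2)" "y \<in> ball c (\<rho>/2)"
      using V(2) unfolding refines_def \<U>_def by blast
    then have "dist x y < \<rho>" using dist_triangle_half_r[of c x \<rho> y] by simp
    then show "dist ((T ^^ s) x) ((T ^^ s) y) < \<delta>" using \<rho>(2) W Y s by blast
  qed
  then show ?thesis using that by blast
qed

text \<open>The functions of a partition of unity on \<open>Y\<close> are extended to \<open>X\<close> and cut off from below;
  since few of them are nonzero on \<open>Y\<close>, few survive the cut near \<open>Y\<close>.\<close>

lemma fine_pou_neighbourhood:
  assumes Y: "compact Y" "Y \<subseteq> X" and D: "covering_dim_le (top_of_set Y) (int D)"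
    and S: "finite S" "\<delta> > 0"
  obtains \<eta> and I :: "'a set set" and \<phi> where "\<eta> > 0" "fine_pou {x\<in>X. \<exists>w\<in>Y. dist x w \<le> \<eta>} D S \<delta> I \<phi>"
proof -
  \<comment> \<open>Points near \<open>Y\<close> are compared through nearby points \<open>w\<close>
    and \<open>v\<close> of \<open>Y\<close>, with one third for each leg.\<close>
  have "\<delta> / 3 > 0" using S by simp
  from fine_pou_exists[OF Y D S(1) this] obtain I :: "'a set set" and \<phi> where \<phi>: "fine_pou Y D S (\<delta>/3) I \<phi>" by blast
  have finI: "finite I" using \<phi> by (simp add: fine_pou_def)
  have "\<exists>h. continuous_on X h \<and> (\<forall>x\<in>Y. h x = \<phi> i x)" if i: "i \<in> I" for i
  proof -
    have "\<phi> i x \<in> {0..1}" if x: "x \<in> Y" for x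
    proof -
      have "\<phi> i x \<le> (\<Sum>i\<in>I. \<phi> i x)"
        by (rule member_le_sum) (use \<phi> i x in \<open>auto simp: fine_pou_def\<close>)
      then show ?thesis using \<phi> i x by (auto simp: fine_pou_def)
    qed
    then have "\<phi> i ` Y \<subseteq> {0..1}" by blast
    moreover have "continuous_on Y (\<phi> i)" using \<phi> i by (simp add: fine_pou_def)
    ultimately show ?thesis
      using tietze_interval[OF compact_X Y, of "\<phi> i" 0 1] by (metis zero_le_one)
  qed
  then have "\<forall>i\<in>I. \<exists>h. continuous_on X h \<and> (\<forall>x\<in>Y. h x = \<phi> i x)" by blast
  from bchoice[OF this] obtain h where h: "\<And>i. i \<in> I \<Longrightarrow> continuous_on X (h i)"
    "\<And>i x. i \<in> I \<Longrightarrow> x \<in> Y \<Longrightarrow> h i x = \<phi> i x" by blast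
  \<comment> \<open>At a point \<open>w\<close> of \<open>Y\<close> some function is at least
    \<open>3 * \<theta>\<close>, since otherwise the sum would be below 1. It remains positive after
    an oscillation of \<open>\<theta>\<close> and a cut at \<open>\<theta>\<close>, whereas a
    function vanishing at \<open>w\<close> is cut to zero. The added 1 keeps the denominator
    positive for empty \<open>I\<close>.\<close>
  define \<theta> where "\<theta> = 1 / (3 * (real (card I) + 1))"
  have \<theta>: "\<theta> > 0" by (simp add: \<theta>_def)
  have "\<forall>i\<in>I. \<exists>q>0. \<forall>x\<in>X. \<forall>y\<in>X. dist x y < q \<longrightarrow> \<bar>h i x - h i y\<bar> < \<theta>"
  proof
    fix i assume "i \<in> I"
    then have "uniformly_continuous_on X (h i)"
      using compact_X h by (simp add: compact_uniformly_continuous)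
    then show "\<exists>q>0. \<forall>x\<in>X. \<forall>y\<in>X. dist x y < q \<longrightarrow> \<bar>h i x - h i y\<bar> < \<theta>"
      using \<theta> unfolding uniformly_continuous_on_def by (metis dist_commute dist_real_def)
  qed
  from bchoice[OF this] obtain q where q: "\<And>i. i \<in> I \<Longrightarrow> q i > 0"
    "\<And>i x y. i \<in> I \<Longrightarrow> x \<in> X \<Longrightarrow> y \<in> X \<Longrightarrow> dist x y < q i \<Longrightarrow> \<bar>h i x - h i y\<bar> < \<theta>" by blast
  obtain \<rho> where \<rho>: "\<rho> > 0" "\<And>x y s. x \<in> X \<Longrightarrow> y \<in> X \<Longrightarrow> dist x y < \<rho> \<Longrightarrow> s \<in> S
      \<Longrightarrow> dist ((T ^^ s) x) ((T ^^ s) y) < \<delta> / 3"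
    using funpow_uniform[OF S(1) \<open>\<delta> / 3 > 0\<close>] by metis
  define m where "m = Min (insert \<rho> (q ` I))"
  have m: "m > 0" "m \<le> \<rho>" "\<And>i. i \<in> I \<Longrightarrow> m \<le> q i"
    unfolding m_def using finI \<rho>(1) q(1) by (auto intro: Min_le)
  define \<eta> where "\<eta> = m / 2"
  have \<eta>: "\<eta> > 0" using m by (simp add: \<eta>_def)
  let ?W = "{x\<in>X. \<exists>w\<in>Y. dist x w \<le> \<eta>}"
  have W: "\<exists>w\<in>Y. (\<forall>i\<in>I. \<bar>h i x - \<phi> i w\<bar> < \<theta>) \<and> (\<forall>s\<in>S. dist ((T ^^ s) x) ((T ^^ s) w) < \<delta> / 3)"
    if x: "x \<in> ?W" for x
  proof -
    from x obtain w where w: "w \<in> Y" "dist x w \<le> \<eta>" by blast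
    have "dist x w < m" using w m by (simp add: \<eta>_def)
    then show ?thesis using w x m q(2)[of _ x w] \<rho>(2)[of x w] h(2) Y(2)
      by (intro bexI[of _ w]) fastforce+
  qed
  define \<psi>0 where "\<psi>0 i x = max 0 (h i x - \<theta>)" for i x
  define \<sigma> where "\<sigma> x = (\<Sum>i\<in>I. \<psi>0 i x)" for x
  define \<psi> where "\<psi> i x = \<psi>0 i x / \<sigma> x" for i x
  have c\<psi>0: "continuous_on X (\<psi>0 i)" if "i \<in> I" for i
    unfolding \<psi>0_def using h(1)[OF that] by (intro continuous_intros)
  have c\<sigma>: "continuous_on X \<sigma>" unfolding \<sigma>_def using c\<psi>0 by (intro continuous_intros)
  have \<sigma>: "\<sigma> x > 0" if x: "x \<in> ?W" for x
  proof -
    from W[OF x] obtain w where w: "w \<in> Y" "\<forall>i\<in>I. \<bar>h i x - \<phi> i w\<bar> < \<theta>" by blast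
    have "\<exists>i\<in>I. \<phi> i w \<ge> 3 * \<theta>"
    proof (rule ccontr)
      assume "\<not> ?thesis"
      then have "(\<Sum>i\<in>I. \<phi> i w) \<le> (\<Sum>i\<in>I. 3 * \<theta>)" by (intro sum_mono) force
      also have "\<dots> < 1" by (simp add: \<theta>_def)
      finally show False using \<phi> w by (simp add: fine_pou_def)
    qed
    then obtain i where i: "i \<in> I" "\<phi> i w \<ge> 3 * \<theta>" by blast
    have "\<psi>0 i x > 0" using i w(2)[rule_format, OF i(1)] \<theta> by (auto simp: \<psi>0_def)
    moreover have "\<psi>0 i x \<le> \<sigma> x"
      unfolding \<sigma>_def by (rule member_le_sum) (use i finI in \<open>auto simp: \<psi>0_def\<close>)
    ultimately show ?thesis by simp
  qed
  have "fine_pou ?W D S \<delta> I \<psi>" unfolding fine_pou_def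
  proof (intro conjI ballI impI)
    show "finite I" by fact
    show "continuous_on ?W (\<psi> i)" if "i \<in> I" for i
      unfolding \<psi>_def
      by (intro continuous_on_divide continuous_on_subset[OF c\<psi>0[OF that]] continuous_on_subset[OF c\<sigma>])
         (use \<sigma> in fastforce)+
  next
    fix x assume x: "x \<in> ?W"
    show "\<psi> i x \<ge> 0" for i using \<sigma>[OF x] by (simp add: \<psi>_def \<psi>0_def)
    show "(\<Sum>i\<in>I. \<psi> i x) = 1" using \<sigma>[OF x]
      by (simp add: \<psi>_def sum_divide_distrib[symmetric] \<sigma>_def)
    from W[OF x] obtain w where w: "w \<in> Y" "\<forall>i\<in>I. \<bar>h i x - \<phi> i w\<bar> < \<theta>" by blast
    have "{i\<in>I. \<psi> i x \<noteq> 0} \<subseteq> {i\<in>I. \<phi> i w \<noteq> 0}"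
    proof safe
      fix i assume i: "i \<in> I" "\<psi> i x \<noteq> 0" "\<phi> i w = 0"
      then show False using w(2)[rule_format, OF i(1)] by (auto simp: \<psi>_def \<psi>0_def)
    qed
    then have "card {i\<in>I. \<psi> i x \<noteq> 0} \<le> card {i\<in>I. \<phi> i w \<noteq> 0}"
      using finI by (intro card_mono) auto
    also have "\<dots> \<le> Suc D" using \<phi> w by (simp add: fine_pou_def)
    finally show "card {i\<in>I. \<psi> i x \<noteq> 0} \<le> Suc D" .
  next
    fix i x y s assume i: "i \<in> I" and x: "x \<in> ?W" "y \<in> ?W" and nz: "\<psi> i x \<noteq> 0" "\<psi> i y \<noteq> 0" and s: "s \<in> S"
    from W[OF x(1)] obtain w where w: "w \<in> Y" "\<forall>i\<in>I. \<bar>h i x - \<phi> i w\<bar> < \<theta>"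
      "dist ((T ^^ s) x) ((T ^^ s) w) < \<delta> / 3" using s by blast
    from W[OF x(2)] obtain v where v: "v \<in> Y" "\<forall>i\<in>I. \<bar>h i y - \<phi> i v\<bar> < \<theta>"
      "dist ((T ^^ s) y) ((T ^^ s) v) < \<delta> / 3" using s by blast
    have "\<phi> i w \<noteq> 0" using nz(1) w(2)[rule_format, OF i(1)] by (auto simp: \<psi>_def \<psi>0_def)
    moreover have "\<phi> i v \<noteq> 0" using nz(2) v(2)[rule_format, OF i(1)] by (auto simp: \<psi>_def \<psi>0_def)
    ultimately have "dist ((T ^^ s) w) ((T ^^ s) v) < \<delta> / 3"
      using \<phi> i w(1) v(1) s unfolding fine_pou_def by blast
    then show "dist ((T ^^ s) x) ((T ^^ s) y) < \<delta>"
      using w(3) v(3) by (metis dist_commute dist_triangle_third)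
  qed
  then show ?thesis using that \<eta> by blast
qed

end

subsection \<open>Generic values at finitely many points\<close>

lemma abs_convex_combination_diff:
  fixes v w :: "'j \<Rightarrow> real ^ 'd"
  assumes "\<And>c. c \<in> J \<Longrightarrow> \<phi> c \<ge> 0" "sum \<phi> J = 1"
    and "\<And>c. c \<in> J \<Longrightarrow> \<phi> c \<noteq> 0 \<Longrightarrow> \<bar>v c $ i - w c $ i\<bar> \<le> \<epsilon>"
  shows "\<bar>(\<Sum>c\<in>J. \<phi> c *\<^sub>R v c) $ i - (\<Sum>c\<in>J. \<phi> c *\<^sub>R w c) $ i\<bar> \<le> \<epsilon>"
proof -
  have "(\<Sum>c\<in>J. \<phi> c *\<^sub>R v c) $ i - (\<Sum>c\<in>J. \<phi> c *\<^sub>R w c) $ i = (\<Sum>c\<in>J. \<phi> c * (v c $ i - w c $ i))"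
    by (simp add: right_diff_distrib sum_subtractf)
  also have "\<bar>\<dots>\<bar> \<le> (\<Sum>c\<in>J. \<bar>\<phi> c * (v c $ i - w c $ i)\<bar>)" by (rule sum_abs)
  also have "\<dots> \<le> (\<Sum>c\<in>J. \<phi> c * \<epsilon>)"
  proof (rule sum_mono)
    fix c assume c: "c \<in> J"
    show "\<bar>\<phi> c * (v c $ i - w c $ i)\<bar> \<le> \<phi> c * \<epsilon>"
      using assms(1,3)[OF c] by (cases "\<phi> c = 0") (auto simp: abs_mult intro: mult_left_mono)
  qed
  also have "\<dots> = \<epsilon>" using assms(2) by (simp flip: sum_distrib_right)
  finally show ?thesis .
qed

lemma abs_convex_combination_diff_const:
  fixes v :: "'j \<Rightarrow> real ^ 'd"
  assumes "\<And>c. c \<in> J \<Longrightarrow> \<phi> c \<ge> 0" "sum \<phi> J = 1"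
    and "\<And>c. c \<in> J \<Longrightarrow> \<phi> c \<noteq> 0 \<Longrightarrow> \<bar>v c $ i - w $ i\<bar> \<le> \<epsilon>"
  shows "\<bar>(\<Sum>c\<in>J. \<phi> c *\<^sub>R v c) $ i - w $ i\<bar> \<le> \<epsilon>"
  using abs_convex_combination_diff[of J \<phi> v i "\<lambda>_. w" \<epsilon>] assms
  by (simp flip: scaleR_left.sum)

lemma convex_combination_unit_cube:
  fixes v :: "'j \<Rightarrow> real ^ 'd"
  assumes "\<And>c. c \<in> J \<Longrightarrow> \<phi> c \<ge> 0" "sum \<phi> J = 1" "\<And>c. c \<in> J \<Longrightarrow> v c \<in> unit_cube"
  shows "(\<Sum>c\<in>J. \<phi> c *\<^sub>R v c) \<in> unit_cube"
proof -
  have "(\<Sum>c\<in>J. \<phi> c * v c $ i) \<in> {0..1}" for i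
  proof -
    have "(\<Sum>c\<in>J. \<phi> c * v c $ i) \<le> (\<Sum>c\<in>J. \<phi> c * 1)"
      using assms by (intro sum_mono mult_left_mono) (auto simp: unit_cube_def)
    moreover have "0 \<le> (\<Sum>c\<in>J. \<phi> c * v c $ i)"
      using assms by (intro sum_nonneg mult_nonneg_nonneg) (auto simp: unit_cube_def)
    ultimately show ?thesis using assms(2) by simp
  qed
  then show ?thesis by (simp add: unit_cube_def)
qed

text \<open>Continuity gives a local margin at each point and compactness leaves finitely many of
  them. \<open>S\<close> may be infinite; \<open>robust_sep\<close> takes all times.\<close>

lemma nonvanishing_margin:
  fixes F :: "'k \<Rightarrow> 'z::metric_space \<Rightarrow> real ^ 'd"
  assumes "compact Z" "\<And>k. k \<in> S \<Longrightarrow> continuous_on Z (F k)"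
    and "\<And>z. z \<in> Z \<Longrightarrow> \<exists>k\<in>S. F k z \<noteq> 0"
  obtains \<eta> where "\<eta> > 0" "\<And>z. z \<in> Z \<Longrightarrow> \<exists>k\<in>S. \<exists>i. \<bar>F k z $ i\<bar> > \<eta>"
proof -
  have "\<forall>z\<in>Z. \<exists>\<eta>>0. \<exists>r>0. \<forall>y\<in>Z. dist y z < r \<longrightarrow> (\<exists>k\<in>S. \<exists>i. \<bar>F k y $ i\<bar> > \<eta>)"
  proof
    fix z assume z: "z \<in> Z"
    then obtain k i where k: "k \<in> S" "F k z $ i \<noteq> 0"
      using assms(3) by (metis vec_eq_iff zero_index)
    define \<eta> where "\<eta> = \<bar>F k z $ i\<bar> / 2"
    have \<eta>: "\<eta> > 0" using k by (simp add: \<eta>_def)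
    have "continuous_on Z (\<lambda>z. F k z $ i)" using assms(2)[OF k(1)] by (intro continuous_intros)
    then obtain r where r: "r > 0" "\<forall>y\<in>Z. dist y z < r \<longrightarrow> dist (F k y $ i) (F k z $ i) < \<eta>"
      using z \<eta> unfolding continuous_on_iff by metis
    have "\<bar>F k y $ i\<bar> > \<eta>" if "y \<in> Z" "dist y z < r" for y
    proof -
      have "\<bar>F k y $ i - F k z $ i\<bar> < \<eta>" using r(2) that by (simp add: dist_real_def)
      then show ?thesis unfolding \<eta>_def by linarith
    qed
    then show "\<exists>\<eta>>0. \<exists>r>0. \<forall>y\<in>Z. dist y z < r \<longrightarrow> (\<exists>k\<in>S. \<exists>i. \<bar>F k y $ i\<bar> > \<eta>)"
      using \<eta> r(1) k(1) by blast
  qed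
  from bchoice[OF this] obtain \<eta> where
    "\<forall>z\<in>Z. \<eta> z>0 \<and> (\<exists>r>0. \<forall>y\<in>Z. dist y z < r \<longrightarrow> (\<exists>k\<in>S. \<exists>i. \<bar>F k y $ i\<bar> > \<eta> z))" ..
  then have \<eta>: "\<And>z. z \<in> Z \<Longrightarrow> \<eta> z > 0"
    and "\<forall>z\<in>Z. \<exists>r>0. \<forall>y\<in>Z. dist y z < r \<longrightarrow> (\<exists>k\<in>S. \<exists>i. \<bar>F k y $ i\<bar> > \<eta> z)" by blast+
  from bchoice[OF this(2)] obtain r where r: "\<And>z. z \<in> Z \<Longrightarrow> r z > 0"
    "\<And>z y. z \<in> Z \<Longrightarrow> y \<in> Z \<Longrightarrow> dist y z < r z \<Longrightarrow> \<exists>k\<in>S. \<exists>i. \<bar>F k y $ i\<bar> > \<eta> z" by blast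
  have "Z \<subseteq> (\<Union>z\<in>Z. ball z (r z))" using r(1) by auto
  then obtain C where C: "C \<subseteq> Z" "finite C" "Z \<subseteq> (\<Union>z\<in>C. ball z (r z))"
    using compactE_image[OF assms(1), of Z "\<lambda>z. ball z (r z)"] by blast
  define m where "m = Min (insert 1 (\<eta> ` C))"
  have m: "m > 0" "\<And>z. z \<in> C \<Longrightarrow> m \<le> \<eta> z" unfolding m_def using C \<eta> by (auto intro: Min_le)
  have "\<exists>k\<in>S. \<exists>i. \<bar>F k y $ i\<bar> > m" if y: "y \<in> Z" for y
  proof -
    from y C obtain z where z: "z \<in> C" "dist y z < r z" by (force simp: dist_commute)
    then obtain k i where "k \<in> S" "\<bar>F k y $ i\<bar> > \<eta> z" using r(2)[of z y] y C(1) by blast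
    then show ?thesis using m(2)[OF z(1)] by (meson le_less_trans)
  qed
  with m(1) show ?thesis using that by blast
qed

section \<open>Open and dense conditions, and generic vertex values\<close>

context compact_system
begin

text \<open>Openness in the supremum norm, as \<open>approximable\<close> is density, both stated
  for total functions so that values outside \<open>X\<close> need no normalization. Functions equal
  on \<open>X\<close> are arbitrarily near, hence robust conditions see the values on
  \<open>X\<close> only.\<close>

definition robust :: "(('a \<Rightarrow> real ^ 'd) \<Rightarrow> bool) \<Rightarrow> bool" where
  "robust \<Phi> \<longleftrightarrow> (\<forall>f. cube_fun f \<longrightarrow> \<Phi> f \<longrightarrow> (\<exists>\<eta>>0. \<forall>g. cube_fun g \<longrightarrow> near \<eta> f g \<longrightarrow> \<Phi> g))"

definition approximable :: "(('a \<Rightarrow> real ^ 'd) \<Rightarrow> bool) \<Rightarrow> bool" where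
  "approximable \<Phi> \<longleftrightarrow> (\<forall>f \<epsilon>. cube_fun f \<longrightarrow> \<epsilon> > 0 \<longrightarrow> (\<exists>g. cube_fun g \<and> near \<epsilon> f g \<and> \<Phi> g))"

text \<open>The factor 2 arises because \<open>G\<close> will be a difference of two expressions,
  each of which moves by at most \<open>\<eta>\<close> with the function.\<close>

lemma robust_nonvanishing:
  fixes G :: "'k \<Rightarrow> ('a \<Rightarrow> real ^ 'd) \<Rightarrow> 'z::metric_space \<Rightarrow> real ^ 'd"
  assumes Z: "compact Z" and c: "\<And>k f. k \<in> S \<Longrightarrow> cube_fun f \<Longrightarrow> continuous_on Z (G k f)"
    and G: "\<And>k f g z i \<eta>. k \<in> S \<Longrightarrow> z \<in> Z \<Longrightarrow> near \<eta> f g \<Longrightarrow> \<bar>G k g z $ i - G k f z $ i\<bar> \<le> 2 * \<eta>"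
  shows "robust (\<lambda>f. \<forall>z\<in>Z. \<exists>k\<in>S. G k f z \<noteq> 0)"
  unfolding robust_def
proof (intro allI impI)
  fix f :: "'a \<Rightarrow> real ^ 'd" assume f: "cube_fun f" "\<forall>z\<in>Z. \<exists>k\<in>S. G k f z \<noteq> 0"
  obtain \<eta> where \<eta>: "\<eta> > 0" "\<And>z. z \<in> Z \<Longrightarrow> \<exists>k\<in>S. \<exists>i. \<bar>G k f z $ i\<bar> > \<eta>"
    using nonvanishing_margin[OF Z, of S "\<lambda>k. G k f"] c f by (metis (no_types, lifting))
  have "\<exists>k\<in>S. G k g z \<noteq> 0" if g: "near (\<eta>/2) f g" and z: "z \<in> Z" for g z
  proof -
    obtain k i where k: "k \<in> S" "\<bar>G k f z $ i\<bar> > \<eta>" using \<eta>(2)[OF z] by blast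
    then have "\<bar>G k g z $ i - G k f z $ i\<bar> \<le> \<eta>" using G[OF k(1) z g, of i] by simp
    with k have "G k g z $ i \<noteq> 0" by linarith
    with k(1) show ?thesis by (metis zero_index)
  qed
  then show "\<exists>\<eta>>0. \<forall>g. cube_fun g \<longrightarrow> near \<eta> f g \<longrightarrow> (\<forall>z\<in>Z. \<exists>k\<in>S. G k g z \<noteq> 0)"
    using \<eta>(1) by (intro exI[of _ "\<eta>/2"]) auto
qed

text \<open>\<open>Q\<close> collects the points whose present values are the data for general
  position and must therefore stay frozen while the vertex values move.\<close>

lemma prescribe_values:
  fixes f :: "'a \<Rightarrow> real ^ 'd"
  assumes f: "cube_fun f" "\<epsilon> \<ge> 0" and J: "finite J" "J \<subseteq> X" "finite S" and Q: "finite Q" "Q \<subseteq> X"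
    and inj: "\<And>s s' c c'. s \<in> S \<Longrightarrow> s' \<in> S \<Longrightarrow> c \<in> J \<Longrightarrow> c' \<in> J \<Longrightarrow> (T ^^ s) c = (T ^^ s') c' \<Longrightarrow> s = s' \<and> c = c'"
    and disj: "\<And>s c. s \<in> S \<Longrightarrow> c \<in> J \<Longrightarrow> (T ^^ s) c \<notin> Q"
    and a: "\<And>s c i. s \<in> S \<Longrightarrow> c \<in> J \<Longrightarrow> a c s i \<in> {0..1} \<and> \<bar>a c s i - f ((T ^^ s) c) $ i\<bar> \<le> \<epsilon>"
  obtains g where "cube_fun g" "near \<epsilon> f g" "\<And>z. z \<in> Q \<Longrightarrow> g z = f z"
    "\<And>s c i. s \<in> S \<Longrightarrow> c \<in> J \<Longrightarrow> g ((T ^^ s) c) $ i = a c s i"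
proof -
  define P :: "('a \<times> nat + 'a) set" where "P = Inl ` (J \<times> S) \<union> Inr ` Q"
  define K :: "'a \<times> nat + 'a \<Rightarrow> 'a set" where "K = case_sum (\<lambda>(c, s). {c}) (\<lambda>z. {z})"
  define t :: "'a \<times> nat + 'a \<Rightarrow> nat" where "t = case_sum (\<lambda>(c, s). s) (\<lambda>z. 0)"
  define h :: "'a \<times> nat + 'a \<Rightarrow> 'a \<Rightarrow> real ^ 'd"
    where "h = case_sum (\<lambda>(c, s) _. \<chi> i. a c s i) (\<lambda>z _. f z)"
  obtain g where "cube_fun g" "near \<epsilon> f g" "\<And>p x. p \<in> P \<Longrightarrow> x \<in> K p \<Longrightarrow> g ((T ^^ t p) x) = h p x"
  proof (rule extend_pieces[OF f])
    show "finite P" using J Q by (simp add: P_def)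
    show "compact (K p) \<and> K p \<subseteq> X" if "p \<in> P" for p
      using that J Q by (auto simp: P_def K_def)
    show "continuous_on (K p) (h p)" if "p \<in> P" for p
      using that by (auto simp: P_def K_def)
    show "h p x \<in> unit_cube" if "p \<in> P" "x \<in> K p" for p x
      using that a cube_fun_in[OF f(1)] Q by (auto simp: P_def K_def h_def unit_cube_def)
    show "\<bar>h p x $ i - f ((T ^^ t p) x) $ i\<bar> \<le> \<epsilon>" if "p \<in> P" "x \<in> K p" for p x i
      using that a f by (auto simp: P_def K_def h_def t_def)
    show "h p x = h q y" if "p \<in> P" "q \<in> P" "x \<in> K p" "y \<in> K q" "(T ^^ t p) x = (T ^^ t q) y" for p q x y
    proof (cases p; cases q)
      fix u v assume [simp]: "p = Inl u" "q = Inl v"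
      obtain c s c' s' where [simp]: "u = (c, s)" "v = (c', s')" by force
      have "s = s' \<and> c = c'" using that by (intro inj) (auto simp: P_def K_def t_def)
      then show ?thesis by (simp add: h_def)
    next
      fix u v assume [simp]: "p = Inl u" "q = Inr v"
      obtain c s where [simp]: "u = (c, s)" by force
      show ?thesis using that disj[of s c] by (auto simp: P_def K_def t_def)
    next
      fix u v assume [simp]: "p = Inr u" "q = Inl v"
      obtain c s where [simp]: "v = (c, s)" by force
      show ?thesis using that disj[of s c] by (auto simp: P_def K_def t_def)
    next
      fix u v assume [simp]: "p = Inr u" "q = Inr v"
      show ?thesis using that by (auto simp: P_def K_def t_def h_def)
    qed
  qed blast
  note g = this
  have 1: "g z = f z" if "z \<in> Q" for z
    using g(3)[of "Inr z" z] that by (simp add: P_def K_def h_def t_def)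
  have 2: "g ((T ^^ s) c) $ i = a c s i" if "s \<in> S" "c \<in> J" for s c i
    using g(3)[of "Inl (c, s)" c] that by (simp add: P_def K_def h_def t_def)
  show ?thesis using that[OF g(1,2) 1 2] .
qed

text \<open>General position is applied in the coordinates \<open>S \<times> UNIV\<close>. Only the
  values over \<open>J\<close> move, those over \<open>K\<close> are frozen; so the iterates of
  \<open>J\<close> must be distinct and off those of \<open>K\<close>, while the iterates of
  \<open>K\<close> may coincide among themselves. The count
  \<open>Suc D + Suc D' \<le> Suc (card S * CARD('d))\<close> is the hypothesis
  \<open>D\<close>.\<close>

lemma generic_values:
  fixes f :: "'a \<Rightarrow> real ^ 'd"
  assumes f: "cube_fun f" "\<epsilon> > 0" and J: "finite J" "J \<subseteq> X" "finite S" and K: "finite K" "K \<subseteq> X"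
    and inj: "\<And>s s' c c'. s \<in> S \<Longrightarrow> s' \<in> S \<Longrightarrow> c \<in> J \<Longrightarrow> c' \<in> J \<Longrightarrow> (T ^^ s) c = (T ^^ s') c' \<Longrightarrow> s = s' \<and> c = c'"
    and disj: "\<And>s s' c c'. s \<in> S \<Longrightarrow> s' \<in> S \<Longrightarrow> c \<in> J \<Longrightarrow> c' \<in> K \<Longrightarrow> (T ^^ s) c \<noteq> (T ^^ s') c'"
    and D: "D + D' < card S * CARD('d)"
  obtains g where "cube_fun g" "near \<epsilon> f g"
    "\<And>\<xi> \<mu>. sum \<xi> J = 1 \<Longrightarrow> sum \<mu> K = 1 \<Longrightarrow> card {c\<in>J. \<xi> c \<noteq> 0} \<le> Suc D \<Longrightarrow>
       card {c\<in>K. \<mu> c \<noteq> 0} \<le> Suc D' \<Longrightarrow>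
       \<exists>s\<in>S. (\<Sum>c\<in>J. \<xi> c *\<^sub>R g ((T ^^ s) c)) \<noteq> (\<Sum>c\<in>K. \<mu> c *\<^sub>R g ((T ^^ s) c))"
proof -
  define I where "I = S \<times> (UNIV :: 'd set)"
  have I: "finite I" "card I = card S * CARD('d)" using J by (auto simp: I_def card_cartesian_product)
  define a0 where "a0 c = (\<lambda>(s, i). f ((T ^^ s) c) $ i)" for c
  have "a0 c p \<in> {0..1}" if "c \<in> J" "p \<in> I" for c p
    using that J cube_fun_in[OF f(1)] funpow_in by (auto simp: a0_def I_def)
  with general_position[OF J(1) K(1) I(1) f(2), where ?a0.0 = a0 and o' = "\<lambda>_ _. 0" and b = a0]
  obtain a where a: "\<And>c p. c \<in> J \<Longrightarrow> p \<in> I \<Longrightarrow> a c p \<in> {0..1} \<and> \<bar>a c p - a0 c p\<bar> \<le> \<epsilon>"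
    and gen: "\<And>\<xi> \<mu>. sum \<xi> J = 1 \<Longrightarrow> sum \<mu> K = 1 \<Longrightarrow>
       card {j\<in>J. \<xi> j \<noteq> 0} + card {k\<in>K. \<mu> k \<noteq> 0} \<le> Suc (card I) \<Longrightarrow>
       (\<exists>p\<in>I. (\<Sum>j\<in>J. \<xi> j * (a j p + 0)) \<noteq> (\<Sum>k\<in>K. \<mu> k * a0 k p))"
    by blast
  have \<epsilon>: "\<epsilon> \<ge> 0" using f(2) by simp
  define Q where "Q = (\<lambda>(c, s). (T ^^ s) c) ` (K \<times> S)"
  have Q: "finite Q" "Q \<subseteq> X" using K J funpow_in by (auto simp: Q_def)
  have disjQ: "(T ^^ s) c \<notin> Q" if "s \<in> S" "c \<in> J" for s c using that disj by (auto simp: Q_def)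
  obtain g where g: "cube_fun g" "near \<epsilon> f g" "\<And>z. z \<in> Q \<Longrightarrow> g z = f z"
    "\<And>s c i. s \<in> S \<Longrightarrow> c \<in> J \<Longrightarrow> g ((T ^^ s) c) $ i = a c (s, i)"
  proof (rule prescribe_values[OF f(1) \<epsilon> J Q inj disjQ])
    show "a c (s, i) \<in> {0..1} \<and> \<bar>a c (s, i) - f ((T ^^ s) c) $ i\<bar> \<le> \<epsilon>"
      if "s \<in> S" "c \<in> J" for s c i
      using a[of c "(s, i)"] that by (simp add: I_def a0_def)
  qed blast+
  have "\<exists>s\<in>S. (\<Sum>c\<in>J. \<xi> c *\<^sub>R g ((T ^^ s) c)) \<noteq> (\<Sum>c\<in>K. \<mu> c *\<^sub>R g ((T ^^ s) c))"
    if s: "sum \<xi> J = 1" "sum \<mu> K = 1" "card {c\<in>J. \<xi> c \<noteq> 0} \<le> Suc D" "card {c\<in>K. \<mu> c \<noteq> 0} \<le> Suc D'"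
    for \<xi> \<mu>
  proof -
    have "card {j\<in>J. \<xi> j \<noteq> 0} + card {k\<in>K. \<mu> k \<noteq> 0} \<le> Suc (card I)" using s D I by linarith
    from gen[OF s(1,2) this] obtain s' i where si: "s' \<in> S"
      "(\<Sum>j\<in>J. \<xi> j * a j (s', i)) \<noteq> (\<Sum>k\<in>K. \<mu> k * a0 k (s', i))"
      by (auto simp: I_def)
    have "(\<Sum>c\<in>J. \<xi> c *\<^sub>R g ((T ^^ s') c)) $ i = (\<Sum>j\<in>J. \<xi> j * a j (s', i))"
      using g(4) si(1) by simp
    moreover have "(\<Sum>c\<in>K. \<mu> c *\<^sub>R g ((T ^^ s') c)) $ i = (\<Sum>k\<in>K. \<mu> k * a0 k (s', i))"
    proof -
      have "g ((T ^^ s') c) = f ((T ^^ s') c)" if "c \<in> K" for c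
        using g(3) that si(1) by (auto simp: Q_def)
      then show ?thesis by (simp add: a0_def)
    qed
    ultimately show ?thesis using si by metis
  qed
  then show ?thesis using that g(1,2) by blast
qed

lemma generic_values_diagonal:
  fixes f :: "'a \<Rightarrow> real ^ 'd"
  assumes f: "cube_fun f" "\<epsilon> > 0" and J: "finite J" "J \<subseteq> X" "finite S"
    and inj: "\<And>s s' c c'. s \<in> S \<Longrightarrow> s' \<in> S \<Longrightarrow> c \<in> J \<Longrightarrow> c' \<in> J \<Longrightarrow> (T ^^ s) c = (T ^^ s') c' \<Longrightarrow> s = s' \<and> c = c'"
    and disj: "\<And>s s' c c'. s \<in> S \<Longrightarrow> s' \<in> S \<Longrightarrow> c \<in> J \<Longrightarrow> c' \<in> J \<Longrightarrow> (T ^^ s) c \<noteq> (T ^^ r s') c'"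
    and D: "D < card S * CARD('d)"
  obtains g where "cube_fun g" "near \<epsilon> f g"
    "\<And>\<xi>. sum \<xi> J = 1 \<Longrightarrow> card {c\<in>J. \<xi> c \<noteq> 0} \<le> Suc D \<Longrightarrow>
       \<exists>s\<in>S. (\<Sum>c\<in>J. \<xi> c *\<^sub>R g ((T ^^ s) c)) \<noteq> (\<Sum>c\<in>J. \<xi> c *\<^sub>R g ((T ^^ r s) c))"
proof -
  define I where "I = S \<times> (UNIV :: 'd set)"
  have I: "finite I" "card I = card S * CARD('d)" using J by (auto simp: I_def card_cartesian_product)
  define a0 where "a0 c = (\<lambda>(s, i). f ((T ^^ s) c) $ i)" for c
  define o' where "o' c = (\<lambda>(s, i). - f ((T ^^ r s) c) $ i)" for c
  have "a0 c p \<in> {0..1}" if "c \<in> J" "p \<in> I" for c p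
    using that J cube_fun_in[OF f(1)] funpow_in by (auto simp: a0_def I_def)
  with general_position[OF J(1) _ I(1) f(2), where ?a0.0 = a0 and o' = o' and K = "{()}" and b = "\<lambda>_ _. 0"]
  obtain a where a: "\<And>c p. c \<in> J \<Longrightarrow> p \<in> I \<Longrightarrow> a c p \<in> {0..1} \<and> \<bar>a c p - a0 c p\<bar> \<le> \<epsilon>"
    and gen: "\<And>\<xi> \<mu>. sum \<xi> J = 1 \<Longrightarrow> sum \<mu> {()} = 1 \<Longrightarrow>
       card {j\<in>J. \<xi> j \<noteq> 0} + card {k\<in>{()}. \<mu> k \<noteq> (0::real)} \<le> Suc (card I) \<Longrightarrow>
       (\<exists>p\<in>I. (\<Sum>j\<in>J. \<xi> j * (a j p + o' j p)) \<noteq> (\<Sum>k\<in>{()}. \<mu> k * 0))"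
    by blast
  have \<epsilon>: "\<epsilon> \<ge> 0" using f(2) by simp
  define Q where "Q = (\<lambda>(c, s). (T ^^ r s) c) ` (J \<times> S)"
  have Q: "finite Q" "Q \<subseteq> X" using J funpow_in by (auto simp: Q_def)
  have disjQ: "(T ^^ s) c \<notin> Q" if "s \<in> S" "c \<in> J" for s c using that disj by (auto simp: Q_def)
  obtain g where g: "cube_fun g" "near \<epsilon> f g" "\<And>z. z \<in> Q \<Longrightarrow> g z = f z"
    "\<And>s c i. s \<in> S \<Longrightarrow> c \<in> J \<Longrightarrow> g ((T ^^ s) c) $ i = a c (s, i)"
  proof (rule prescribe_values[OF f(1) \<epsilon> J Q inj disjQ])
    show "a c (s, i) \<in> {0..1} \<and> \<bar>a c (s, i) - f ((T ^^ s) c) $ i\<bar> \<le> \<epsilon>"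
      if "s \<in> S" "c \<in> J" for s c i
      using a[of c "(s, i)"] that by (simp add: I_def a0_def)
  qed blast+
  have "\<exists>s\<in>S. (\<Sum>c\<in>J. \<xi> c *\<^sub>R g ((T ^^ s) c)) \<noteq> (\<Sum>c\<in>J. \<xi> c *\<^sub>R g ((T ^^ r s) c))"
    if s: "sum \<xi> J = 1" "card {c\<in>J. \<xi> c \<noteq> 0} \<le> Suc D" for \<xi>
  proof -
    have "\<exists>p\<in>I. (\<Sum>j\<in>J. \<xi> j * (a j p + o' j p)) \<noteq> 0"
      using gen[OF s(1), of "\<lambda>_. 1"] s(2) D I by auto
    then obtain s' i where si: "s' \<in> S"
      "(\<Sum>j\<in>J. \<xi> j * (a j (s', i) + o' j (s', i))) \<noteq> 0"
      by (auto simp: I_def)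
    have "g ((T ^^ r s') c) = f ((T ^^ r s') c)" if "c \<in> J" for c
      using g(3) that si(1) by (auto simp: Q_def)
    then have "(\<Sum>c\<in>J. \<xi> c *\<^sub>R g ((T ^^ s') c)) $ i - (\<Sum>c\<in>J. \<xi> c *\<^sub>R g ((T ^^ r s') c)) $ i
       = (\<Sum>j\<in>J. \<xi> j * (a j (s', i) + o' j (s', i)))"
      using g(4) si(1) by (simp add: o'_def right_diff_distrib sum_subtractf)
    note eq = this
    have "(\<Sum>c\<in>J. \<xi> c *\<^sub>R g ((T ^^ s') c)) \<noteq> (\<Sum>c\<in>J. \<xi> c *\<^sub>R g ((T ^^ r s') c))"
    proof
      assume "(\<Sum>c\<in>J. \<xi> c *\<^sub>R g ((T ^^ s') c)) = (\<Sum>c\<in>J. \<xi> c *\<^sub>R g ((T ^^ r s') c))"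
      then have "(\<Sum>c\<in>J. \<xi> c *\<^sub>R g ((T ^^ s') c)) $ i - (\<Sum>c\<in>J. \<xi> c *\<^sub>R g ((T ^^ r s') c)) $ i = 0"
        by (simp only: diff_self)
      then show False using eq si(2) by (simp only: simp_thms)
    qed
    with si(1) show ?thesis by blast
  qed
  then show ?thesis using that g(1,2) by blast
qed

subsection \<open>The function space and Baire approximation\<close>

lemma near_imp_dist_le:
  fixes f g :: "'a \<Rightarrow> real ^ 'd" and \<epsilon> :: real
  assumes "near \<epsilon> f g" "x \<in> X"
  shows "dist (f x) (g x) \<le> real CARD('d) * \<epsilon>"
proof -
  have "dist (f x) (g x) = norm (g x - f x)" by (simp add: dist_norm norm_minus_commute)
  also have "\<dots> \<le> (\<Sum>i\<in>UNIV. \<bar>(g x - f x) $ i\<bar>)" by (rule norm_le_l1_cart)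
  also have "\<dots> \<le> (\<Sum>i\<in>(UNIV::'d set). \<epsilon>)"
    using assms by (intro sum_mono) (simp add: near_def)
  finally show ?thesis by simp
qed

lemma near_if_dist_le:
  fixes f g :: "'a \<Rightarrow> real ^ 'd"
  assumes "\<And>x. x \<in> X \<Longrightarrow> dist (f x) (g x) \<le> \<epsilon>"
  shows "near \<epsilon> f g"
  unfolding near_def
proof (intro ballI allI)
  fix x i assume "x \<in> X"
  have "\<bar>g x $ i - f x $ i\<bar> \<le> norm (g x - f x)"
    using component_le_norm_cart[of "g x - f x" i] by simp
  also have "\<dots> \<le> \<epsilon>" using assms[OF \<open>x \<in> X\<close>] by (simp add: dist_norm norm_minus_commute)
  finally show "\<bar>g x $ i - f x $ i\<bar> \<le> \<epsilon>" .
qed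

lemma mspace_cube_funspace_iff:
  "f \<in> mspace (cube_funspace X) \<longleftrightarrow> f \<in> extensional X \<and> cube_fun f"
proof -
  have "compactin (top_of_set X) (topspace (top_of_set X))"
    using compact_X by (simp add: compactin_subtopology)
  then show ?thesis
    unfolding cube_funspace_def
    by (subst compactin_mspace_cfunspace)
       (auto simp: cube_fun_def mtopology_of_submetric continuous_map_in_subtopology image_subset_iff)
qed

lemma mdist_cube_funspace_le:
  assumes "X \<noteq> {}" "f \<in> mspace (cube_funspace X)" "g \<in> mspace (cube_funspace X)"
  shows "mdist (cube_funspace X) f g \<le> a \<longleftrightarrow> (\<forall>x\<in>X. dist (f x) (g x) \<le> a)"
  using assms unfolding cube_funspace_def by (subst cfunspace_mdist_le) auto

lemma cube_fun_restrict: "cube_fun f \<Longrightarrow> restrict f X \<in> mspace (cube_funspace X)"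
  unfolding mspace_cube_funspace_iff cube_fun_def
  by (auto cong: continuous_on_cong)

lemma robust_cong:
  assumes "robust \<Phi>" "cube_fun f" "cube_fun g" "\<And>x. x \<in> X \<Longrightarrow> f x = g x" "\<Phi> f"
  shows "\<Phi> g"
proof -
  from assms(1,2,5) obtain \<eta> where "\<eta> > 0" "\<And>g. cube_fun g \<Longrightarrow> near \<eta> f g \<Longrightarrow> \<Phi> g"
    unfolding robust_def by blast
  then show ?thesis using assms by (simp add: near_def)
qed

lemma robust_open:
  fixes \<Phi> :: "('a \<Rightarrow> real ^ 'd) \<Rightarrow> bool"
  assumes "robust \<Phi>" "X \<noteq> {}"
  shows "openin (mtopology_of (cube_funspace X)) {f \<in> mspace (cube_funspace X). \<Phi> f}"
proof -
  interpret M: Metric_space "mspace (cube_funspace X :: ('a \<Rightarrow> real ^ 'd) metric)" "mdist (cube_funspace X)"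
    by (rule Metric_space_mspace_mdist)
  have "\<exists>r>0. M.mball f r \<subseteq> {f \<in> mspace (cube_funspace X). \<Phi> f}"
    if f: "f \<in> mspace (cube_funspace X)" "\<Phi> f" for f
  proof -
    have "cube_fun f" using f mspace_cube_funspace_iff by blast
    then obtain \<eta> where \<eta>: "\<eta> > 0" "\<And>g. cube_fun g \<Longrightarrow> near \<eta> f g \<Longrightarrow> \<Phi> g"
      using assms(1) f(2) unfolding robust_def by blast
    have "\<Phi> g" if g: "g \<in> M.mball f \<eta>" for g
    proof (rule \<eta>(2))
      have gm: "g \<in> mspace (cube_funspace X)" "mdist (cube_funspace X) f g \<le> \<eta>" using g by auto
      then show "cube_fun g" using mspace_cube_funspace_iff by blast
      show "near \<eta> f g" using gm mdist_cube_funspace_le[OF assms(2) f(1) gm(1)] near_if_dist_le by blast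
    qed
    then show ?thesis using \<eta>(1) by (intro exI[of _ \<eta>]) auto
  qed
  then show ?thesis unfolding mtopology_of_def M.openin_mtopology by blast
qed

lemma approximable_dense:
  fixes \<Phi> :: "('a \<Rightarrow> real ^ 'd) \<Rightarrow> bool"
  assumes "robust \<Phi>" "approximable \<Phi>" "X \<noteq> {}"
  shows "mtopology_of (cube_funspace X) closure_of {f \<in> mspace (cube_funspace X). \<Phi> f} = mspace (cube_funspace X)"
proof -
  interpret M: Metric_space "mspace (cube_funspace X :: ('a \<Rightarrow> real ^ 'd) metric)" "mdist (cube_funspace X)"
    by (rule Metric_space_mspace_mdist)
  have "\<exists>g\<in>{f \<in> mspace (cube_funspace X). \<Phi> f}. g \<in> M.mball f r"
    if f: "f \<in> mspace (cube_funspace X)" and r: "r > 0" for f r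
  proof -
    have cf: "cube_fun f" using f mspace_cube_funspace_iff by blast
    \<comment> \<open>A coordinatewise bound costs a factor \<open>CARD('d)\<close> in the Euclidean
      norm; the factor 2 yields the strict inequality of the open ball.\<close>
    define \<epsilon> where "\<epsilon> = r / (2 * CARD('d))"
    have \<epsilon>: "\<epsilon> > 0" using r by (simp add: \<epsilon>_def)
    obtain g where g: "cube_fun g" "near \<epsilon> f g" "\<Phi> g"
      using assms(2) cf \<epsilon> unfolding approximable_def by blast
    define g' where "g' = restrict g X"
    have g': "g' \<in> mspace (cube_funspace X)" using cube_fun_restrict[OF g(1)] by (simp add: g'_def)
    then have "cube_fun g'" using mspace_cube_funspace_iff by blast
    with g have "\<Phi> g'" by (rule_tac robust_cong[OF assms(1) g(1)]) (auto simp: g'_def)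
    have "near \<epsilon> f g'" using g(2) by (simp add: near_def g'_def)
    then have "dist (f x) (g' x) \<le> r / 2" if "x \<in> X" for x
      using near_imp_dist_le[of \<epsilon> f g' x] that by (simp add: \<epsilon>_def)
    then have "mdist (cube_funspace X) f g' \<le> r / 2"
      using mdist_cube_funspace_le[OF assms(3) f g'] by blast
    then have "mdist (cube_funspace X) f g' < r" using r by simp
    with g' \<open>\<Phi> g'\<close> f show ?thesis by (intro bexI[of _ g']) auto
  qed
  then show ?thesis unfolding mtopology_of_def M.metric_closure_of by blast
qed

lemma mcomplete_cube_funspace: "mcomplete_of (cube_funspace X :: ('a \<Rightarrow> real ^ 'd) metric)"
proof -
  interpret U: Metric_space "unit_cube :: (real ^ 'd) set" dist
    by unfold_locales (auto simp: dist_commute dist_triangle)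
  have self: "submetric euclidean_metric (unit_cube :: (real ^ 'd) set) = U.Self"
    by (simp add: submetric_def U.Self_def)
  have "(unit_cube :: (real ^ 'd) set) = cbox 0 1"
    by (auto simp: unit_cube_def mem_box_cart)
  then have "compact (unit_cube :: (real ^ 'd) set)" by (metis compact_cbox)
  then have "compact_space (mtopology_of (submetric euclidean_metric (unit_cube :: (real ^ 'd) set)))"
    by (simp add: mtopology_of_submetric compact_space_subtopology)
  then have "compact_space U.mtopology"
    by (simp add: self mtopology_of_def)
  then have "U.mcomplete" by (rule U.compact_space_imp_mcomplete)
  then show ?thesis unfolding cube_funspace_def self by (rule U.mcomplete_cfunspace)
qed

text \<open>Used inside the perturbations, where a single function has to meet several, possibly
  countably many, generic conditions while the partitions of unity stay fixed.\<close>

lemma baire_approximation: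
  fixes \<Phi> :: "'k \<Rightarrow> ('a \<Rightarrow> real ^ 'd) \<Rightarrow> bool"
  assumes K: "countable K" "\<And>k. k \<in> K \<Longrightarrow> robust (\<Phi> k)" "\<And>k. k \<in> K \<Longrightarrow> approximable (\<Phi> k)"
  shows "approximable (\<lambda>f. \<forall>k\<in>K. \<Phi> k f)"
proof (cases "X = {}")
  \<comment> \<open>On the empty space all functions agree, so robustness carries the property from
    one function to all. The comparison of \<open>mdist\<close> with pointwise distances, used in
    the other case, requires a point.\<close>
  case True
  have "\<Phi> k f" if k: "k \<in> K" and f: "cube_fun f" for k f
  proof -
    obtain g where "cube_fun g" "\<Phi> k g"
      using K(3)[OF k] f unfolding approximable_def by (meson zero_less_one)
    then show ?thesis using robust_cong[OF K(2)[OF k], of g f] f True by auto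
  qed
  then show ?thesis unfolding approximable_def by (meson near_refl order_less_imp_le)
next
  case False
  interpret M: Metric_space "mspace (cube_funspace X :: ('a \<Rightarrow> real ^ 'd) metric)" "mdist (cube_funspace X)"
    by (rule Metric_space_mspace_mdist)
  define G where "G k = {f \<in> mspace (cube_funspace X). \<Phi> k f}" for k
  \<comment> \<open>The whole space is inserted to keep the family nonempty.\<close>
  have "M.mtopology closure_of \<Inter> (insert (mspace (cube_funspace X)) (G ` K)) = mspace (cube_funspace X)"
  proof (rule M.metric_Baire_category)
    show "M.mcomplete" using mcomplete_cube_funspace by (simp add: mcomplete_of_def)
    show "countable (insert (mspace (cube_funspace X)) (G ` K))" using K(1) by simp
    fix U assume "U \<in> insert (mspace (cube_funspace X)) (G ` K)"
    then show "openin M.mtopology U \<and> M.mtopology closure_of U = mspace (cube_funspace X)"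
    proof
      assume "U = mspace (cube_funspace X)"
      then show ?thesis by (metis M.topspace_mtopology closure_of_topspace openin_topspace)
    next
      assume "U \<in> G ` K"
      then show ?thesis
        using robust_open[OF K(2) False] approximable_dense[OF K(2,3) False]
        unfolding mtopology_of_def G_def by blast
    qed
  qed
  note closure = this
  have dense: "\<exists>g. g \<in> M.mball f r \<and> (\<forall>k\<in>K. g \<in> G k)" if f: "f \<in> mspace (cube_funspace X)" and r: "r > 0" for f r
  proof -
    have "f \<in> M.mtopology closure_of \<Inter> (insert (mspace (cube_funspace X)) (G ` K))"
      unfolding closure by (rule f)
    then have "\<exists>g\<in>\<Inter> (insert (mspace (cube_funspace X)) (G ` K)). g \<in> M.mball f r"
      using r unfolding M.metric_closure_of by (simp only: mem_Collect_eq)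
    then show ?thesis by (meson InterE image_eqI insertCI)
  qed
  show ?thesis unfolding approximable_def
  proof (intro allI impI)
    fix f :: "'a \<Rightarrow> real ^ 'd" and \<epsilon> :: real assume f: "cube_fun f" "\<epsilon> > 0"
    have f': "restrict f X \<in> mspace (cube_funspace X)" using f cube_fun_restrict by blast
    from dense[OF this f(2)] obtain g where g: "g \<in> M.mball (restrict f X) \<epsilon>" "\<forall>k\<in>K. g \<in> G k" by blast
    then have gm: "g \<in> mspace (cube_funspace X)" and le: "mdist (cube_funspace X) (restrict f X) g \<le> \<epsilon>" by auto
    have "near \<epsilon> (restrict f X) g"
      using le mdist_cube_funspace_le[OF False f' gm] near_if_dist_le by blast
    then have "near \<epsilon> f g" by (simp add: near_def)
    moreover have "cube_fun g" using gm mspace_cube_funspace_iff by blast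
    ultimately show "\<exists>g. cube_fun g \<and> near \<epsilon> f g \<and> (\<forall>k\<in>K. \<Phi> k g)"
      using g(2) by (auto simp: G_def)
  qed
qed

subsection \<open>Piecewise linear perturbations\<close>

lemma pl_in_cube:
  fixes h :: "'a \<Rightarrow> real ^ 'd"
  assumes "pointed_pou L D S \<delta> J \<phi>" "L \<subseteq> X" "cube_fun h" "x \<in> L"
  shows "(\<Sum>c\<in>J. \<phi> c x *\<^sub>R h ((T ^^ s) c)) \<in> unit_cube"
proof (rule convex_combination_unit_cube)
  show "\<phi> c x \<ge> 0" if "c \<in> J" for c using assms that by (auto simp: pointed_pou_def)
  show "(\<Sum>c\<in>J. \<phi> c x) = 1" using assms by (auto simp: pointed_pou_def)
  show "h ((T ^^ s) c) \<in> unit_cube" if "c \<in> J" for c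
  proof -
    have "(T ^^ s) c \<in> X" using assms that funpow_in by (auto simp: pointed_pou_def)
    then show ?thesis using assms(3) by (auto simp: cube_fun_def)
  qed
qed

lemma pl_continuous:
  fixes h :: "'a \<Rightarrow> real ^ 'd"
  assumes "pointed_pou L D S \<delta> J \<phi>"
  shows "continuous_on L (\<lambda>x. \<Sum>c\<in>J. \<phi> c x *\<^sub>R h ((T ^^ s) c))"
  using assms by (intro continuous_intros) (auto simp: pointed_pou_def)

text \<open>The mesh \<open>\<delta>\<close> is fixed for \<open>f\<close> before the perturbed
  \<open>h\<close> is known. The oscillation of \<open>h\<close> is therefore estimated through
  \<open>f\<close>: one \<open>e\<close> for the oscillation of \<open>f\<close> and two for passing
  between \<open>f\<close> and \<open>h\<close>.\<close>

lemma pl_close: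
  fixes f h :: "'a \<Rightarrow> real ^ 'd"
  assumes \<phi>: "pointed_pou L D S \<delta> J \<phi>" and L: "L \<subseteq> X" "x \<in> L" "s \<in> S"
    and f: "\<And>x y i. x \<in> X \<Longrightarrow> y \<in> X \<Longrightarrow> dist x y < \<delta> \<Longrightarrow> \<bar>f x $ i - f y $ i\<bar> \<le> e"
    and h: "near e f h"
  shows "\<bar>(\<Sum>c\<in>J. \<phi> c x *\<^sub>R h ((T ^^ s) c)) $ i - h ((T ^^ s) x) $ i\<bar> \<le> 3 * e"
proof (rule abs_convex_combination_diff_const)
  show "\<phi> c x \<ge> 0" if "c \<in> J" for c using \<phi> L that by (auto simp: pointed_pou_def)
  show "(\<Sum>c\<in>J. \<phi> c x) = 1" using \<phi> L by (auto simp: pointed_pou_def)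
  fix c assume c: "c \<in> J" "\<phi> c x \<noteq> 0"
  have X: "(T ^^ s) c \<in> X" "(T ^^ s) x \<in> X" using \<phi> c L funpow_in by (auto simp: pointed_pou_def)
  have "dist ((T ^^ s) x) ((T ^^ s) c) < \<delta>" using \<phi> c L by (auto simp: pointed_pou_def)
  from f[OF X(2,1) this, of i]
  have "\<bar>f ((T ^^ s) x) $ i - f ((T ^^ s) c) $ i\<bar> \<le> e" .
  moreover have "\<bar>h ((T ^^ s) x) $ i - f ((T ^^ s) x) $ i\<bar> \<le> e"
    "\<bar>h ((T ^^ s) c) $ i - f ((T ^^ s) c) $ i\<bar> \<le> e"
    using h X by (auto simp: near_def)
  ultimately show "\<bar>h ((T ^^ s) c) $ i - h ((T ^^ s) x) $ i\<bar> \<le> 3 * e" by linarith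
qed

lemma pl_near:
  fixes f g :: "'a \<Rightarrow> real ^ 'd"
  assumes "pointed_pou L D S \<delta> J \<phi>" "L \<subseteq> X" "x \<in> L" "near \<eta> f g"
  shows "\<bar>(\<Sum>c\<in>J. \<phi> c x *\<^sub>R g ((T ^^ s) c)) $ i - (\<Sum>c\<in>J. \<phi> c x *\<^sub>R f ((T ^^ s) c)) $ i\<bar> \<le> \<eta>"
proof (rule abs_convex_combination_diff)
  show "\<phi> c x \<ge> 0" if "c \<in> J" for c using assms that by (auto simp: pointed_pou_def)
  show "(\<Sum>c\<in>J. \<phi> c x) = 1" using assms by (auto simp: pointed_pou_def)
  fix c assume c: "c \<in> J"
  then have "(T ^^ s) c \<in> X" using assms funpow_in by (auto simp: pointed_pou_def)
  then show "\<bar>g ((T ^^ s) c) $ i - f ((T ^^ s) c) $ i\<bar> \<le> \<eta>" using assms(4) by (simp add: near_def)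
qed

text \<open>The function is first changed at the iterates of the vertices, to make the interpolated
  images of every pair in \<open>R\<close> disjoint, and then replaced by its interpolation on all
  iterates of the pieces. \<open>compat\<close> makes this consistent: if two iterates meet, then
  they are iterates of one point under maps that agree on the whole piece, in particular at the
  vertices. Distinctness of the iterates is demanded only of the first piece of each pair, the one
  whose vertices move.\<close>

lemma separating_pieces:
  fixes f :: "'a \<Rightarrow> real ^ 'd" and L :: "'p \<Rightarrow> 'a set" and I :: "'p \<Rightarrow> 'k set"
  assumes f: "cube_fun f" "\<epsilon> > 0" and fin: "finite P" "finite S"
    and \<delta>: "\<And>x y i. x \<in> X \<Longrightarrow> y \<in> X \<Longrightarrow> dist x y < \<delta> \<Longrightarrow> \<bar>f x $ i - f y $ i\<bar> \<le> \<epsilon> / 4"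
    and L: "\<And>p. p \<in> P \<Longrightarrow> compact (L p) \<and> L p \<subseteq> X"
    and I: "\<And>p. p \<in> P \<Longrightarrow> fine_pou (L p) (D p) S \<delta> (I p) (\<psi>' p)"
    and compat: "\<And>p q s t x y. p \<in> P \<Longrightarrow> q \<in> P \<Longrightarrow> s \<in> S \<Longrightarrow> t \<in> S \<Longrightarrow> x \<in> L p \<Longrightarrow> y \<in> L q \<Longrightarrow>
        (T ^^ s) x = (T ^^ t) y \<Longrightarrow> p = q \<and> x = y \<and> (\<forall>z\<in>L p. (T ^^ s) z = (T ^^ t) z)"
    and R: "R \<subseteq> P \<times> P" "\<And>p q. (p, q) \<in> R \<Longrightarrow> p \<noteq> q \<and> D p + D q < card S * CARD('d)"
    and inj: "\<And>p q s t x. (p, q) \<in> R \<Longrightarrow> s \<in> S \<Longrightarrow> t \<in> S \<Longrightarrow> x \<in> L p \<Longrightarrow> (T ^^ s) x = (T ^^ t) x \<Longrightarrow> s = t"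
  obtains g where "cube_fun g" "near \<epsilon> f g"
    "\<And>p q x y. (p, q) \<in> R \<Longrightarrow> x \<in> L p \<Longrightarrow> y \<in> L q \<Longrightarrow> \<exists>s\<in>S. g ((T ^^ s) x) \<noteq> g ((T ^^ s) y)"
proof -
  have "\<forall>p\<in>P. \<exists>J\<phi>. pointed_pou (L p) (D p) S \<delta> (fst J\<phi>) (snd J\<phi>)"
    using pointed_pou_of_fine_pou[OF I] by (metis fst_conv snd_conv)
  from bchoice[OF this] obtain J\<phi> where J\<phi>: "\<forall>p\<in>P. pointed_pou (L p) (D p) S \<delta> (fst (J\<phi> p)) (snd (J\<phi> p))" ..
  define J where "J p = fst (J\<phi> p)" for p
  define \<phi> where "\<phi> p = snd (J\<phi> p)" for p
  have \<phi>: "\<And>p. p \<in> P \<Longrightarrow> pointed_pou (L p) (D p) S \<delta> (J p) (\<phi> p)"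
    using J\<phi> by (simp add: J_def \<phi>_def)
  define pl where "pl p s h x = (\<Sum>c\<in>J p. \<phi> p c x *\<^sub>R h ((T ^^ s) c))" for p s x and h :: "'a \<Rightarrow> real ^ 'd"
  define G where "G r s h z = pl (fst r) s h (fst z) - pl (snd r) s h (snd z)"
    for r s z and h :: "'a \<Rightarrow> real ^ 'd"
  define \<Phi> where "\<Phi> r h = (\<forall>z\<in>L (fst r) \<times> L (snd r). \<exists>s\<in>S. G r s h z \<noteq> 0)" for r and h :: "'a \<Rightarrow> real ^ 'd"
  have PR: "fst r \<in> P" "snd r \<in> P" if "r \<in> R" for r using that R(1) by auto
  have rob: "robust (\<Phi> r)" if r: "r \<in> R" for r
    unfolding \<Phi>_def
  proof (rule robust_nonvanishing)
    show "compact (L (fst r) \<times> L (snd r))" using L PR[OF r] by (simp add: compact_Times)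
    show "continuous_on (L (fst r) \<times> L (snd r)) (G r s h)" for s and h :: "'a \<Rightarrow> real ^ 'd"
      unfolding G_def pl_def
      by (intro continuous_on_diff continuous_on_compose2[OF pl_continuous[OF \<phi>[OF PR(1)[OF r]]] continuous_on_fst]
            continuous_on_compose2[OF pl_continuous[OF \<phi>[OF PR(2)[OF r]]] continuous_on_snd])
         (auto intro: continuous_on_id)
    fix s z i \<eta> and h g :: "'a \<Rightarrow> real ^ 'd"
    assume z: "z \<in> L (fst r) \<times> L (snd r)" and n: "near \<eta> h g"
    have "\<bar>pl (fst r) s g (fst z) $ i - pl (fst r) s h (fst z) $ i\<bar> \<le> \<eta>"
      unfolding pl_def using L PR[OF r] z by (intro pl_near[OF \<phi>[OF PR(1)[OF r]] _ _ n]) auto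
    moreover have "\<bar>pl (snd r) s g (snd z) $ i - pl (snd r) s h (snd z) $ i\<bar> \<le> \<eta>"
      unfolding pl_def using L PR[OF r] z by (intro pl_near[OF \<phi>[OF PR(2)[OF r]] _ _ n]) auto
    ultimately show "\<bar>G r s g z $ i - G r s h z $ i\<bar> \<le> 2 * \<eta>" by (simp add: G_def)
  qed
  have app: "approximable (\<Phi> r)" if r: "r \<in> R" for r
    unfolding approximable_def
  proof (intro allI impI)
    fix h :: "'a \<Rightarrow> real ^ 'd" and e :: real assume h: "cube_fun h" "e > 0"
    obtain p q where pq: "r = (p, q)" by force
    have P: "p \<in> P" "q \<in> P" "p \<noteq> q" "D p + D q < card S * CARD('d)" using r pq R by auto
    have J: "finite (J p)" "J p \<subseteq> X" "finite (J q)" "J q \<subseteq> X" "J p \<subseteq> L p" "J q \<subseteq> L q"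
      using \<phi>[OF P(1)] \<phi>[OF P(2)] L[OF P(1)] L[OF P(2)] by (auto simp: pointed_pou_def)
    obtain g where g: "cube_fun g" "near e h g" and gen:
     "\<And>\<xi> \<mu>. sum \<xi> (J p) = 1 \<Longrightarrow> sum \<mu> (J q) = 1 \<Longrightarrow> card {c\<in>J p. \<xi> c \<noteq> 0} \<le> Suc (D p) \<Longrightarrow>
       card {c\<in>J q. \<mu> c \<noteq> 0} \<le> Suc (D q) \<Longrightarrow>
       \<exists>s\<in>S. (\<Sum>c\<in>J p. \<xi> c *\<^sub>R g ((T ^^ s) c)) \<noteq> (\<Sum>c\<in>J q. \<mu> c *\<^sub>R g ((T ^^ s) c))"
    proof (rule generic_values[OF h J(1,2) fin(2) J(3,4) _ _ P(4)])
      show "s = t \<and> c = c'" if "s \<in> S" "t \<in> S" "c \<in> J p" "c' \<in> J p" "(T ^^ s) c = (T ^^ t) c'" for s t c c'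
        using that compat[OF P(1,1), of s t c c'] inj[of p q s t c] r pq J(5) by blast
      show "(T ^^ s) c \<noteq> (T ^^ t) c'" if "s \<in> S" "t \<in> S" "c \<in> J p" "c' \<in> J q" for s t c c'
        using that compat[OF P(1,2), of s t c c'] P(3) J(5,6) by blast
    qed blast
    have "\<Phi> r g" unfolding \<Phi>_def
    proof
      fix z assume z: "z \<in> L (fst r) \<times> L (snd r)"
      then have "fst z \<in> L p" "snd z \<in> L q" using pq by auto
      then have "\<exists>s\<in>S. (\<Sum>c\<in>J p. \<phi> p c (fst z) *\<^sub>R g ((T ^^ s) c)) \<noteq> (\<Sum>c\<in>J q. \<phi> q c (snd z) *\<^sub>R g ((T ^^ s) c))"
        using \<phi>[OF P(1)] \<phi>[OF P(2)] by (intro gen) (auto simp: pointed_pou_def)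
      then show "\<exists>s\<in>S. G r s g z \<noteq> 0" by (simp add: G_def pl_def pq)
    qed
    with g show "\<exists>g. cube_fun g \<and> near e h g \<and> \<Phi> r g" by blast
  qed
  \<comment> \<open>A single \<open>h\<close> must serve all pairs at once, and moving vertices for
    one pair could spoil another; hence Baire even for finite \<open>R\<close>. The tolerance splits
    into one quarter for this step and three quarters for the interpolation, by
    \<open>pl_close\<close>.\<close>
  have "countable R" using fin R(1) by (meson countable_finite finite_SigmaI finite_subset)
  from baire_approximation[OF this rob app] have "approximable (\<lambda>h. \<forall>r\<in>R. \<Phi> r h)" .
  moreover have "\<epsilon>/4 > 0" using f by simp
  ultimately obtain h where h: "cube_fun h" "near (\<epsilon>/4) f h" "\<And>r. r \<in> R \<Longrightarrow> \<Phi> r h"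
    using f(1) unfolding approximable_def by blast
  obtain g where g: "cube_fun g" "near (3 * (\<epsilon>/4)) h g"
    "\<And>ps x. ps \<in> P \<times> S \<Longrightarrow> x \<in> L (fst ps) \<Longrightarrow> g ((T ^^ snd ps) x) = pl (fst ps) (snd ps) h x"
  proof (rule extend_pieces[OF h(1), of "3 * (\<epsilon>/4)" "P \<times> S" "\<lambda>ps. L (fst ps)" "\<lambda>ps. pl (fst ps) (snd ps) h" snd])
    show "3 * (\<epsilon>/4) \<ge> 0" "finite (P \<times> S)" using f fin by auto
    fix ps assume "ps \<in> P \<times> S"
    then have P: "fst ps \<in> P" "snd ps \<in> S" by auto
    show "compact (L (fst ps)) \<and> L (fst ps) \<subseteq> X" using L[OF P(1)] .
    show "continuous_on (L (fst ps)) (pl (fst ps) (snd ps) h)"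
      unfolding pl_def by (rule pl_continuous[OF \<phi>[OF P(1)]])
    fix x assume x: "x \<in> L (fst ps)"
    show "pl (fst ps) (snd ps) h x \<in> unit_cube"
      unfolding pl_def using L[OF P(1)] x h by (intro pl_in_cube[OF \<phi>[OF P(1)]]) auto
    show "\<bar>pl (fst ps) (snd ps) h x $ i - h ((T ^^ snd ps) x) $ i\<bar> \<le> 3 * (\<epsilon>/4)" for i
      unfolding pl_def using L[OF P(1)] x
      by (intro pl_close[OF \<phi>[OF P(1)] _ _ P(2) \<delta> h(2)]) auto
    fix qt y assume qt: "qt \<in> P \<times> S" "y \<in> L (fst qt)" "(T ^^ snd ps) x = (T ^^ snd qt) y"
    then have *: "fst ps = fst qt" "x = y" "\<forall>z\<in>L (fst ps). (T ^^ snd ps) z = (T ^^ snd qt) z"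
      using compat[OF P(1) _ P(2) _ x] by (metis mem_Times_iff)+
    have "J (fst ps) \<subseteq> L (fst ps)" using \<phi>[OF P(1)] by (simp add: pointed_pou_def)
    then show "pl (fst ps) (snd ps) h x = pl (fst qt) (snd qt) h y"
      unfolding pl_def using * by (intro sum.cong) auto
  qed blast
  have "near \<epsilon> f g" by (rule near_trans[OF h(2) g(2)]) simp
  moreover have "\<exists>s\<in>S. g ((T ^^ s) x) \<noteq> g ((T ^^ s) y)" if r: "(p, q) \<in> R" and x: "x \<in> L p" "y \<in> L q" for p q x y
  proof -
    obtain s where s: "s \<in> S" "pl p s h x \<noteq> pl q s h y"
      using h(3)[OF r] x unfolding \<Phi>_def G_def by fastforce
    have "p \<in> P" "q \<in> P" using R(1) r by auto
    then show ?thesis using s g(3)[of "(p, s)" x] g(3)[of "(q, s)" y] x by (intro bexI[of _ s]) auto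
  qed
  ultimately show ?thesis using that g(1) by blast
qed

text \<open>The vertices \<open>J\<close> stay fixed while the tolerance shrinks, so the partition
  of unity on \<open>C\<close> has to be chosen anew for each tolerance, whence the family
  \<open>I \<delta>\<close>. Interpolation over \<open>C\<close> is an auxiliary means to bring the
  image of \<open>C\<close> into general position with the given simplices.\<close>

lemma approximable_pl_off_image:
  fixes I :: "real \<Rightarrow> 'k set"
  assumes S: "finite S" and J: "finite J" "J \<subseteq> X" and C: "compact C" "C \<subseteq> X"
    and \<phi>: "\<And>x. x \<in> L \<Longrightarrow> (\<Sum>c\<in>J. \<phi> c x) = 1 \<and> card {c\<in>J. \<phi> c x \<noteq> 0} \<le> Suc D"
    and I: "\<And>\<delta>. \<delta> > 0 \<Longrightarrow> fine_pou C D' S \<delta> (I \<delta>) (\<psi>' \<delta>)"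
    and inj: "\<And>s s' c c'. s \<in> S \<Longrightarrow> s' \<in> S \<Longrightarrow> c \<in> J \<Longrightarrow> c' \<in> J \<Longrightarrow> (T ^^ s) c = (T ^^ s') c' \<Longrightarrow> s = s' \<and> c = c'"
    and disj: "\<And>s s' c c'. s \<in> S \<Longrightarrow> s' \<in> S \<Longrightarrow> c \<in> J \<Longrightarrow> c' \<in> C \<Longrightarrow> (T ^^ s) c \<noteq> (T ^^ s') c'"
    and tame: "\<And>s t x y. s \<in> S \<Longrightarrow> t \<in> S \<Longrightarrow> x \<in> C \<Longrightarrow> y \<in> C \<Longrightarrow>
        (T ^^ s) x = (T ^^ t) y \<Longrightarrow> x = y \<and> (\<forall>z\<in>C. (T ^^ s) z = (T ^^ t) z)"
    and D: "D + D' < card S * CARD('d)"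
  shows "approximable (\<lambda>f :: 'a \<Rightarrow> real ^ 'd. \<forall>x\<in>L. \<forall>y\<in>C. \<exists>s\<in>S.
     (\<Sum>c\<in>J. \<phi> c x *\<^sub>R f ((T ^^ s) c)) \<noteq> f ((T ^^ s) y))"
  unfolding approximable_def
proof (intro allI impI)
  fix f :: "'a \<Rightarrow> real ^ 'd" and \<epsilon> :: real assume f: "cube_fun f" "\<epsilon> > 0"
  then have \<epsilon>4: "\<epsilon>/4 > 0" by simp
  obtain \<delta> where \<delta>: "\<delta> > 0" "\<And>x y i. x \<in> X \<Longrightarrow> y \<in> X \<Longrightarrow> dist x y < \<delta> \<Longrightarrow> \<bar>f x $ i - f y $ i\<bar> \<le> \<epsilon>/4"
    using cube_fun_uniform[OF f(1) \<epsilon>4] by metis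
  obtain K \<psi> where \<psi>: "pointed_pou C D' S \<delta> K \<psi>" using pointed_pou_of_fine_pou[OF I[OF \<delta>(1)]] by blast
  have K: "finite K" "K \<subseteq> X" "K \<subseteq> C" using \<psi> C by (auto simp: pointed_pou_def)
  have disjK: "(T ^^ s) c \<noteq> (T ^^ s') c'" if "s \<in> S" "s' \<in> S" "c \<in> J" "c' \<in> K" for s s' c c'
    using disj that K by blast
  from generic_values[OF f(1) \<epsilon>4 J S K(1,2) inj disjK D]
  obtain h where h: "cube_fun h" "near (\<epsilon>/4) f h" and gen:
     "\<And>\<xi> \<mu>. sum \<xi> J = 1 \<Longrightarrow> sum \<mu> K = 1 \<Longrightarrow> card {c\<in>J. \<xi> c \<noteq> 0} \<le> Suc D \<Longrightarrow>
       card {c\<in>K. \<mu> c \<noteq> 0} \<le> Suc D' \<Longrightarrow>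
       \<exists>s\<in>S. (\<Sum>c\<in>J. \<xi> c *\<^sub>R h ((T ^^ s) c)) \<noteq> (\<Sum>c\<in>K. \<mu> c *\<^sub>R h ((T ^^ s) c))"
    by blast
  define pl where "pl s x = (\<Sum>c\<in>K. \<psi> c x *\<^sub>R h ((T ^^ s) c))" for s x
  \<comment> \<open>Left summands replace the function by its interpolation on the iterates of
    \<open>C\<close>; right summands hold the values at the iterates of \<open>J\<close>.\<close>
  define P :: "(nat + nat) set" where "P = Inl ` S \<union> Inr ` S"
  define L' :: "nat + nat \<Rightarrow> 'a set" where "L' = case_sum (\<lambda>s. C) (\<lambda>s. J)"
  define t :: "nat + nat \<Rightarrow> nat" where "t = case_sum (\<lambda>s. s) (\<lambda>s. s)"
  define H where "H = case_sum pl (\<lambda>s x. h ((T ^^ s) x))"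
  obtain g where g: "cube_fun g" "near (3 * (\<epsilon>/4)) h g"
    "\<And>p x. p \<in> P \<Longrightarrow> x \<in> L' p \<Longrightarrow> g ((T ^^ t p) x) = H p x"
  proof (rule extend_pieces[OF h(1), of "3 * (\<epsilon>/4)" P L' H t])
    show "3 * (\<epsilon>/4) \<ge> 0" "finite P" using f S by (auto simp: P_def)
    fix p assume p: "p \<in> P"
    show "compact (L' p) \<and> L' p \<subseteq> X" using p C J by (auto simp: P_def L'_def finite_imp_compact)
    show "continuous_on (L' p) (H p)"
      using p pl_continuous[OF \<psi>] J by (auto simp: P_def L'_def H_def pl_def[abs_def] continuous_on_finite)
    fix x assume x: "x \<in> L' p"
    show "H p x \<in> unit_cube"
    proof (cases p)
      case (Inl s)
      then show ?thesis using x pl_in_cube[OF \<psi> C(2) h(1), of x s] by (simp add: L'_def H_def pl_def)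
    next
      case (Inr s)
      then have "(T ^^ s) x \<in> X" using x J funpow_in by (auto simp: L'_def)
      then show ?thesis using Inr h(1) by (auto simp: H_def cube_fun_def)
    qed
    show "\<bar>H p x $ i - h ((T ^^ t p) x) $ i\<bar> \<le> 3 * (\<epsilon>/4)" for i
    proof (cases p)
      case (Inl s)
      then have "x \<in> C" "s \<in> S" using x p by (auto simp: L'_def P_def)
      from pl_close[OF \<psi> C(2) this \<delta>(2) h(2)] show ?thesis
        by (simp add: H_def t_def pl_def Inl)
    next
      case (Inr s)
      then show ?thesis using f by (simp add: H_def t_def)
    qed
    fix q y assume q: "q \<in> P" and y: "y \<in> L' q" and eq: "(T ^^ t p) x = (T ^^ t q) y"
    show "H p x = H q y"
    proof (cases p; cases q)
      fix s s' assume [simp]: "p = Inl s" "q = Inl s'"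
      have *: "x = y \<and> (\<forall>z\<in>C. (T ^^ s) z = (T ^^ s') z)"
        by (rule tame) (use p q x y eq in \<open>auto simp: P_def L'_def t_def\<close>)
      then have "pl s x = pl s' y" unfolding pl_def using K(3) by (intro sum.cong) auto
      then show ?thesis by (simp add: H_def)
    next
      fix s s' assume [simp]: "p = Inl s" "q = Inr s'"
      show ?thesis using p q x y eq disj[of s' s y x] by (auto simp: P_def L'_def t_def)
    next
      fix s s' assume [simp]: "p = Inr s" "q = Inl s'"
      show ?thesis using p q x y eq disj[of s s' x y] by (auto simp: P_def L'_def t_def)
    next
      fix s s' assume [simp]: "p = Inr s" "q = Inr s'"
      show ?thesis using eq by (auto simp: H_def t_def)
    qed
  qed blast
  have "near \<epsilon> f g" by (rule near_trans[OF h(2) g(2)]) simp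
  moreover have "\<exists>s\<in>S. (\<Sum>c\<in>J. \<phi> c x *\<^sub>R g ((T ^^ s) c)) \<noteq> g ((T ^^ s) y)" if x: "x \<in> L" and y: "y \<in> C" for x y
  proof -
    obtain s where s: "s \<in> S" "(\<Sum>c\<in>J. \<phi> c x *\<^sub>R h ((T ^^ s) c)) \<noteq> pl s y"
      using gen[of "\<lambda>c. \<phi> c x" "\<lambda>c. \<psi> c y"] \<phi>[OF x] \<psi> y by (auto simp: pointed_pou_def pl_def)
    have "g ((T ^^ s) y) = pl s y" using g(3)[of "Inl s" y] s y by (simp add: P_def L'_def t_def H_def)
    moreover have "g ((T ^^ s) c) = h ((T ^^ s) c)" if "c \<in> J" for c
      using g(3)[of "Inr s" c] s that by (simp add: P_def L'_def t_def H_def)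
    ultimately show ?thesis using s by (intro bexI[of _ s]) auto
  qed
  ultimately show "\<exists>g. cube_fun g \<and> near \<epsilon> f g \<and> (\<forall>x\<in>L. \<forall>y\<in>C. \<exists>s\<in>S.
     (\<Sum>c\<in>J. \<phi> c x *\<^sub>R g ((T ^^ s) c)) \<noteq> g ((T ^^ s) y))" using g(1) by blast
qed

text \<open>The values at the times \<open>s\<close> and \<open>r s\<close> are interpolated with
  the same coefficients, so their difference is an interpolation of vertex differences and needs
  only to miss zero. This is why \<open>D\<close>, and not \<open>2 * D\<close>, is compared with
  \<open>card S * CARD('d)\<close>.\<close>

lemma approximable_diagonal:
  fixes I :: "real \<Rightarrow> 'k set"
  assumes S: "finite S" "S \<subseteq> U" "finite U" and r: "\<And>s. s \<in> S \<Longrightarrow> r s \<in> U - S" and K: "compact K" "K \<subseteq> X"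
    and I: "\<And>\<delta>. \<delta> > 0 \<Longrightarrow> fine_pou K D U \<delta> (I \<delta>) (\<psi>' \<delta>)"
    and inj: "\<And>s t x y. s \<in> U \<Longrightarrow> t \<in> U \<Longrightarrow> x \<in> K \<Longrightarrow> y \<in> K \<Longrightarrow> (T ^^ s) x = (T ^^ t) y \<Longrightarrow> s = t \<and> x = y"
    and D: "D < card S * CARD('d)"
  shows "approximable (\<lambda>f :: 'a \<Rightarrow> real ^ 'd. \<forall>x\<in>K. \<exists>s\<in>S. f ((T ^^ s) x) \<noteq> f ((T ^^ r s) x))"
  unfolding approximable_def
proof (intro allI impI)
  fix f :: "'a \<Rightarrow> real ^ 'd" and \<epsilon> :: real assume f: "cube_fun f" "\<epsilon> > 0"
  then have \<epsilon>4: "\<epsilon>/4 > 0" by simp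
  obtain \<delta> where \<delta>: "\<delta> > 0" "\<And>x y i. x \<in> X \<Longrightarrow> y \<in> X \<Longrightarrow> dist x y < \<delta> \<Longrightarrow> \<bar>f x $ i - f y $ i\<bar> \<le> \<epsilon>/4"
    using cube_fun_uniform[OF f(1) \<epsilon>4] by metis
  obtain J \<phi> where \<phi>: "pointed_pou K D U \<delta> J \<phi>" using pointed_pou_of_fine_pou[OF I[OF \<delta>(1)]] by blast
  have J: "finite J" "J \<subseteq> X" "J \<subseteq> K" using \<phi> K by (auto simp: pointed_pou_def)
  obtain h where h: "cube_fun h" "near (\<epsilon>/4) f h" and gen:
    "\<And>\<xi>. sum \<xi> J = 1 \<Longrightarrow> card {c\<in>J. \<xi> c \<noteq> 0} \<le> Suc D \<Longrightarrow>
       \<exists>s\<in>S. (\<Sum>c\<in>J. \<xi> c *\<^sub>R h ((T ^^ s) c)) \<noteq> (\<Sum>c\<in>J. \<xi> c *\<^sub>R h ((T ^^ r s) c))"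
  proof (rule generic_values_diagonal[OF f(1) \<epsilon>4 J(1,2) S(1) _ _ D, where r = r])
    show "s = s' \<and> c = c'" if "s \<in> S" "s' \<in> S" "c \<in> J" "c' \<in> J" "(T ^^ s) c = (T ^^ s') c'" for s s' c c'
      using inj[of s s' c c'] that S J by blast
    show "(T ^^ s) c \<noteq> (T ^^ r s') c'" if "s \<in> S" "s' \<in> S" "c \<in> J" "c' \<in> J" for s s' c c'
      using inj[of s "r s'" c c'] that S J r[of s'] by auto
  qed blast
  define pl where "pl s x = (\<Sum>c\<in>J. \<phi> c x *\<^sub>R h ((T ^^ s) c))" for s x
  obtain g where g: "cube_fun g" "near (3 * (\<epsilon>/4)) h g"
    "\<And>s x. s \<in> U \<Longrightarrow> x \<in> K \<Longrightarrow> g ((T ^^ s) x) = pl s x"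
  proof (rule extend_pieces[OF h(1), of "3 * (\<epsilon>/4)" U "\<lambda>_. K" pl "\<lambda>s. s"])
    show "3 * (\<epsilon>/4) \<ge> 0" "finite U" using f S by auto
    fix s assume s: "s \<in> U"
    show "compact K \<and> K \<subseteq> X" using K by blast
    show "continuous_on K (pl s)" using pl_continuous[OF \<phi>] by (simp add: pl_def[abs_def])
    fix x assume x: "x \<in> K"
    show "pl s x \<in> unit_cube" unfolding pl_def by (rule pl_in_cube[OF \<phi> K(2) h(1) x])
    show "\<bar>pl s x $ i - h ((T ^^ s) x) $ i\<bar> \<le> 3 * (\<epsilon>/4)" for i
      unfolding pl_def by (rule pl_close[OF \<phi> K(2) x s \<delta>(2) h(2)])
    fix t y assume "t \<in> U" "y \<in> K" "(T ^^ s) x = (T ^^ t) y"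
    then show "pl s x = pl t y" using inj[of s t x y] s x by blast
  qed blast
  have "near \<epsilon> f g" by (rule near_trans[OF h(2) g(2)]) simp
  moreover have "\<exists>s\<in>S. g ((T ^^ s) x) \<noteq> g ((T ^^ r s) x)" if x: "x \<in> K" for x
  proof -
    obtain s where s: "s \<in> S" "pl s x \<noteq> pl (r s) x"
      using gen[of "\<lambda>c. \<phi> c x"] \<phi> x by (auto simp: pointed_pou_def pl_def)
    then show ?thesis using g(3)[of s x] g(3)[of "r s" x] x S r[of s] by (intro bexI[of _ s]) auto
  qed
  ultimately show "\<exists>g. cube_fun g \<and> near \<epsilon> f g \<and> (\<forall>x\<in>K. \<exists>s\<in>S. g ((T ^^ s) x) \<noteq> g ((T ^^ r s) x))"
    using g(1) by blast
qed

subsection \<open>The nonwandering set\<close>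

lemma inv_funpow_in:
  "x \<in> X \<Longrightarrow> (inv_into X T ^^ n) x \<in> X \<and> (T ^^ n) ((inv_into X T ^^ n) x) = x"
proof (induction n arbitrary: x)
  case (Suc n)
  define y where "y = inv_into X T x"
  have y: "y \<in> X" "T y = x" using Suc.prems surj_T by (auto simp: y_def inv_into_into f_inv_into_f)
  have "(inv_into X T ^^ Suc n) x = (inv_into X T ^^ n) y"
    by (simp only: funpow_Suc_right o_apply y_def)
  moreover have "(T ^^ Suc n) z = T ((T ^^ n) z)" for z by simp
  ultimately show ?case using Suc.IH[OF y(1)] y(2) by metis
qed simp

text \<open>A return at a negative time, read from its end point, is a return at a positive time;
  hence forward iterates suffice.\<close>

lemma nonwandering_iff:
  "x \<in> nonwandering X T \<longleftrightarrow>
    x \<in> X \<and> (\<forall>U. open U \<longrightarrow> x \<in> U \<longrightarrow> (\<exists>n\<ge>1. \<exists>y\<in>X \<inter> U. (T ^^ n) y \<in> U))"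
proof
  assume x: "x \<in> nonwandering X T"
  have "\<exists>n\<ge>1. \<exists>y\<in>X \<inter> U. (T ^^ n) y \<in> U" if U: "open U" "x \<in> U" for U
  proof -
    have "openin (top_of_set X) (X \<inter> U)" "x \<in> X \<inter> U"
      using U x by (auto simp: openin_open nonwandering_def)
    then obtain k :: int where k: "k \<noteq> 0" "(X \<inter> U) \<inter> iterate X T k ` (X \<inter> U) \<noteq> {}"
      using x unfolding nonwandering_def by blast
    then obtain y where y: "y \<in> X \<inter> U" "iterate X T k y \<in> X \<inter> U" by blast
    show ?thesis
    proof (cases "k \<ge> 0")
      case True
      then show ?thesis using k(1) y by (intro exI[of _ "nat k"]) (auto simp: iterate_def)
    next
      case False
      then have "iterate X T k y = (inv_into X T ^^ nat (- k)) y" by (simp add: iterate_def)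
      then show ?thesis using False y inv_funpow_in[of y "nat (- k)"]
        by (intro exI[of _ "nat (- k)"] conjI bexI[of _ "iterate X T k y"]) auto
    qed
  qed
  then show "x \<in> X \<and> (\<forall>U. open U \<longrightarrow> x \<in> U \<longrightarrow> (\<exists>n\<ge>1. \<exists>y\<in>X \<inter> U. (T ^^ n) y \<in> U))"
    using x by (auto simp: nonwandering_def)
next
  assume x: "x \<in> X \<and> (\<forall>U. open U \<longrightarrow> x \<in> U \<longrightarrow> (\<exists>n\<ge>1. \<exists>y\<in>X \<inter> U. (T ^^ n) y \<in> U))"
  have "\<exists>k::int. k \<noteq> 0 \<and> V \<inter> iterate X T k ` V \<noteq> {}"
    if V: "openin (top_of_set X) V" "x \<in> V" for V
  proof -
    obtain U where U: "open U" "V = X \<inter> U" using V by (auto simp: openin_open)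
    then obtain n y where ny: "n \<ge> 1" "y \<in> X \<inter> U" "(T ^^ n) y \<in> U" using x V by blast
    then have "(T ^^ n) y \<in> X" using funpow_in by blast
    then show ?thesis using ny U
      by (intro exI[of _ "int n"]) (auto simp: iterate_def intro!: exI[of _ "(T ^^ n) y"])
  qed
  then show "x \<in> nonwandering X T" using x unfolding nonwandering_def by blast
qed

lemma nonwandering_subset: "nonwandering X T \<subseteq> X"
  by (auto simp: nonwandering_def)

lemma wandering_nbhd:
  assumes "x \<in> X" "x \<notin> nonwandering X T"
  obtains U where "open U" "x \<in> U" "\<And>n y. n \<ge> 1 \<Longrightarrow> y \<in> X \<Longrightarrow> y \<in> U \<Longrightarrow> (T ^^ n) y \<notin> U"
  using assms nonwandering_iff[of x] by blast

lemma compact_nonwandering: "compact (nonwandering X T)"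
proof -
  have "open (\<Union>{U. open U \<and> (\<forall>n\<ge>1. \<forall>y\<in>X \<inter> U. (T ^^ n) y \<notin> U)})" by (rule open_Union) auto
  moreover have "nonwandering X T = X - \<Union>{U. open U \<and> (\<forall>n\<ge>1. \<forall>y\<in>X \<inter> U. (T ^^ n) y \<notin> U)}"
    unfolding set_eq_iff nonwandering_iff by blast
  ultimately show ?thesis using compact_X by (simp add: compact_diff)
qed

text \<open>By injectivity and surjectivity the complement of the image is the image of the
  complement, which is compact.\<close>

lemma open_funpow_image:
  assumes "open U"
  obtains W where "open W" "X \<inter> W = (T ^^ n) ` (X \<inter> U)"
proof -
  have "compact ((T ^^ n) ` (X - U))"
    using compact_X assms cont_funpow
    by (intro compact_continuous_image compact_diff) (auto intro: continuous_on_subset)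
  then have "open (- (T ^^ n) ` (X - U))" by (simp add: compact_imp_closed open_Compl)
  moreover have "X \<inter> (- (T ^^ n) ` (X - U)) = (T ^^ n) ` (X \<inter> U)"
  proof -
    have "(T ^^ n) ` (X - (X - U)) = (T ^^ n) ` X - (T ^^ n) ` (X - U)"
      by (rule inj_on_image_set_diff[OF inj_funpow]) auto
    then show ?thesis using funpow_image by (auto simp: Diff_Diff_Int Diff_eq)
  qed
  ultimately show ?thesis using that by blast
qed

lemma nonwandering_funpow: "x \<in> nonwandering X T \<Longrightarrow> (T ^^ n) x \<in> nonwandering X T"
proof -
  assume x: "x \<in> nonwandering X T"
  have xX: "x \<in> X" using x nonwandering_subset by blast
  show "(T ^^ n) x \<in> nonwandering X T" unfolding nonwandering_iff
  proof (intro conjI allI impI)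
    show "(T ^^ n) x \<in> X" using funpow_in xX .
    fix U assume U: "open U" "(T ^^ n) x \<in> U"
    obtain W where W: "open W" "W \<inter> X = (T ^^ n) -` U \<inter> X"
      using cont_funpow U(1) unfolding continuous_on_open_invariant by blast
    then have "x \<in> W" using xX U by blast
    then obtain m y where my: "m \<ge> 1" "y \<in> X \<inter> W" "(T ^^ m) y \<in> W"
      using x W(1) unfolding nonwandering_iff by blast
    have "(T ^^ n) y \<in> X \<inter> U" using my W funpow_in by blast
    moreover have "(T ^^ n) ((T ^^ m) y) \<in> U" using my W funpow_in by blast
    then have "(T ^^ m) ((T ^^ n) y) \<in> U" by (metis add.commute comp_apply funpow_add)
    ultimately show "\<exists>n\<ge>1. \<exists>y\<in>X \<inter> U. (T ^^ n) y \<in> U" using my(1) by blast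
  qed
qed

text \<open>This keeps the forward orbit of a wandering point off the nonwandering set forever, so
  that the function can be changed along the orbit and held fixed on that set.\<close>

lemma nonwandering_funpowD:
  assumes "x \<in> X" "(T ^^ n) x \<in> nonwandering X T"
  shows "x \<in> nonwandering X T"
proof (rule ccontr)
  assume "x \<notin> nonwandering X T"
  then obtain U where U: "open U" "x \<in> U" "\<And>n y. n \<ge> 1 \<Longrightarrow> y \<in> X \<Longrightarrow> y \<in> U \<Longrightarrow> (T ^^ n) y \<notin> U"
    using wandering_nbhd[OF assms(1)] by metis
  obtain W where W: "open W" "X \<inter> W = (T ^^ n) ` (X \<inter> U)" using open_funpow_image[OF U(1)] .
  have "(T ^^ n) x \<in> W" using W U(2) assms(1) by blast
  then obtain m y where my: "m \<ge> 1" "y \<in> X \<inter> W" "(T ^^ m) y \<in> W"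
    using assms(2) W(1) unfolding nonwandering_iff by blast
  obtain u where u: "u \<in> X \<inter> U" "y = (T ^^ n) u" using my W by blast
  have "(T ^^ m) y \<in> X \<inter> W" using my funpow_in by blast
  then obtain v where v: "v \<in> X \<inter> U" "(T ^^ m) y = (T ^^ n) v" using W by blast
  have "(T ^^ n) ((T ^^ m) u) = (T ^^ n) v" using u v by (metis add.commute comp_apply funpow_add)
  then have "(T ^^ m) u = v" using funpow_eqD funpow_in u v by blast
  then show False using U(3)[OF my(1)] u v by blast
qed

text \<open>Finitely many wandering neighbourhoods cover \<open>K\<close>, and an orbit visits each
  of them at most once.\<close>

lemma finite_visits:
  assumes K: "compact K" "K \<subseteq> X" "K \<inter> nonwandering X T = {}"
  obtains r where "\<And>x. x \<in> X \<Longrightarrow> finite {n. (T ^^ n) x \<in> K} \<and> card {n. (T ^^ n) x \<in> K} \<le> r"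
proof -
  have "\<forall>z\<in>K. \<exists>U. open U \<and> z \<in> U \<and> (\<forall>n\<ge>1. \<forall>y\<in>X \<inter> U. (T ^^ n) y \<notin> U)"
  proof
    fix z assume z: "z \<in> K"
    then have "z \<in> X" "z \<notin> nonwandering X T" using K by auto
    from wandering_nbhd[OF this] show "\<exists>U. open U \<and> z \<in> U \<and> (\<forall>n\<ge>1. \<forall>y\<in>X \<inter> U. (T ^^ n) y \<notin> U)"
      by (metis IntE)
  qed
  from bchoice[OF this] obtain U where U: "\<forall>z\<in>K. open (U z) \<and> z \<in> U z \<and> (\<forall>n\<ge>1. \<forall>y\<in>X \<inter> U z. (T ^^ n) y \<notin> U z)" ..
  then have "K \<subseteq> (\<Union>z\<in>K. U z)" by blast
  then obtain C where C: "C \<subseteq> K" "finite C" "K \<subseteq> (\<Union>z\<in>C. U z)"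
    using compactE_image[OF K(1), of K U] U by blast
  have "finite {n. (T ^^ n) x \<in> K} \<and> card {n. (T ^^ n) x \<in> K} \<le> card C" if x: "x \<in> X" for x
  proof -
    have one: "m = n" if z: "z \<in> C" "(T ^^ m) x \<in> U z" "(T ^^ n) x \<in> U z" "m \<le> n" for m n z
    proof (rule ccontr)
      assume "m \<noteq> n"
      then have "n - m \<ge> 1" using z by simp
      moreover have "(T ^^ (n - m)) ((T ^^ m) x) = (T ^^ n) x"
        using z(4) by (metis comp_apply funpow_add le_add_diff_inverse2)
      moreover have "(T ^^ m) x \<in> X \<inter> U z" using z funpow_in x by blast
      ultimately show False using U C(1) z by (metis subsetD)
    qed
    have "\<forall>n\<in>{n. (T ^^ n) x \<in> K}. \<exists>z. z \<in> C \<and> (T ^^ n) x \<in> U z" using C(3) by blast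
    from bchoice[OF this] obtain z where z: "\<And>n. (T ^^ n) x \<in> K \<Longrightarrow> z n \<in> C \<and> (T ^^ n) x \<in> U (z n)" by blast
    have "inj_on z {n. (T ^^ n) x \<in> K}"
    proof (rule inj_onI)
      fix m n assume "m \<in> {n. (T ^^ n) x \<in> K}" "n \<in> {n. (T ^^ n) x \<in> K}" "z m = z n"
      then have "z m \<in> C" "(T ^^ m) x \<in> U (z m)" "(T ^^ n) x \<in> U (z m)" using z[of m] z[of n] by auto
      then show "m = n" using one[of "z m" m n] one[of "z m" n m] by (metis nat_le_linear)
    qed
    moreover have "z ` {n. (T ^^ n) x \<in> K} \<subseteq> C" using z by auto
    ultimately show ?thesis using C(2) by (meson card_inj_on_le inj_on_finite)
  qed
  then show ?thesis using that by blast
qed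

lemma tail_cover:
  assumes N: "covering_dim_le (top_of_set (nonwandering X T)) (int N)" and S: "finite S" "\<delta> > 0"
  obtains V r and I :: "'a set set" and \<phi> where "compact V" "V \<subseteq> X" "fine_pou V N S \<delta> I \<phi>"
    "\<And>x. x \<in> X \<Longrightarrow> finite {n. (T ^^ n) x \<notin> V} \<and> card {n. (T ^^ n) x \<notin> V} \<le> r"
proof -
  let ?O = "nonwandering X T"
  obtain \<eta> and I :: "'a set set" and \<phi> where \<eta>: "\<eta> > 0"
    and \<phi>: "fine_pou {x\<in>X. \<exists>w\<in>?O. dist x w \<le> \<eta>} N S \<delta> I \<phi>"
    by (rule fine_pou_neighbourhood[OF compact_nonwandering nonwandering_subset N S])
  \<comment> \<open>The distance \<open>infdist\<close> to the empty set is 0 by convention, so an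
    empty nonwandering set is treated apart. \<open>V\<close> and \<open>K\<close> are closed and
    cover \<open>X\<close> together.\<close>
  define V where "V = (if ?O = {} then {} else {x\<in>X. infdist x ?O \<le> \<eta> / 2})"
  define K where "K = (if ?O = {} then X else {x\<in>X. \<eta> / 2 \<le> infdist x ?O})"
  have V: "compact V" "V \<subseteq> X"
  proof -
    have "compact (X \<inter> {x. infdist x ?O \<le> \<eta> / 2})"
      using compact_X by (intro compact_Int_closed closed_Collect_le continuous_intros)
    then show "compact V" by (auto simp: V_def Collect_conj_eq)
  qed (auto simp: V_def)
  have K: "compact K" "K \<subseteq> X"
  proof -
    have "compact (X \<inter> {x. \<eta> / 2 \<le> infdist x ?O})"
      using compact_X by (intro compact_Int_closed closed_Collect_le continuous_intros)
    then show "compact K" using compact_X by (auto simp: K_def Collect_conj_eq)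
  qed (auto simp: K_def)
  have "K \<inter> ?O = {}" using \<eta> by (auto simp: K_def)
  from finite_visits[OF K this] obtain r
    where r: "\<And>x. x \<in> X \<Longrightarrow> finite {n. (T ^^ n) x \<in> K} \<and> card {n. (T ^^ n) x \<in> K} \<le> r" by blast
  have VK: "{n. (T ^^ n) x \<notin> V} \<subseteq> {n. (T ^^ n) x \<in> K}" if "x \<in> X" for x
    using funpow_in[OF that] by (auto simp: V_def K_def)
  have "finite {n. (T ^^ n) x \<notin> V} \<and> card {n. (T ^^ n) x \<notin> V} \<le> r" if "x \<in> X" for x
    using r[OF that] VK[OF that] by (meson card_mono finite_subset le_trans)
  moreover have "V \<subseteq> {x\<in>X. \<exists>w\<in>?O. dist x w \<le> \<eta>}"
  proof
    fix x assume x: "x \<in> V"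
    then have ne: "?O \<noteq> {}" and "x \<in> X" "infdist x ?O < \<eta>" using \<eta> by (auto simp: V_def split: if_splits)
    moreover obtain w where "w \<in> ?O" "dist x w < \<eta>"
    proof -
      have "(INF a\<in>?O. dist x a) < \<eta>" using \<open>infdist x ?O < \<eta>\<close> ne by (simp add: infdist_def)
      then show ?thesis using that ne by (subst (asm) cInf_less_iff) auto
    qed
    ultimately show "x \<in> {x\<in>X. \<exists>w\<in>?O. dist x w \<le> \<eta>}" by force
  qed
  then have "fine_pou V N S \<delta> I \<phi>" by (rule fine_pou_subset[OF \<phi>])
  ultimately show ?thesis using that V by blast
qed

text \<open>Each of the two points is outside \<open>V\<close> at no more than \<open>r\<close> of
  the \<open>2 * r + 1\<close> distinct times, so some time is good for both.\<close>

lemma good_time: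
  assumes "\<And>x. x \<in> X \<Longrightarrow> finite {n. (T ^^ n) x \<notin> V} \<and> card {n. (T ^^ n) x \<notin> V} \<le> r"
    and t: "inj t" and "x \<in> X" "y \<in> X"
  obtains k where "k \<le> 2 * r" "(T ^^ t k) x \<in> V" "(T ^^ t k) y \<in> V"
proof -
  have bad: "card {k\<in>{..2 * r}. (T ^^ t k) z \<notin> V} \<le> r" if "z \<in> X" for z
  proof -
    have "card {k\<in>{..2 * r}. (T ^^ t k) z \<notin> V} \<le> card {n. (T ^^ n) z \<notin> V}"
      by (rule card_inj_on_le[of t]) (use t assms(1)[OF that] in \<open>auto intro: inj_on_subset\<close>)
    then show ?thesis using assms(1)[OF that] by linarith
  qed
  show ?thesis
  proof (rule ccontr)
    assume "\<not> thesis"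
    then have "{..2 * r} \<subseteq> {k\<in>{..2 * r}. (T ^^ t k) x \<notin> V} \<union> {k\<in>{..2 * r}. (T ^^ t k) y \<notin> V}"
      using that by blast
    then have "card {..2 * r} \<le> card ({k\<in>{..2 * r}. (T ^^ t k) x \<notin> V} \<union> {k\<in>{..2 * r}. (T ^^ t k) y \<notin> V})"
      by (intro card_mono) auto
    also have "\<dots> \<le> r + r"
      using bad[OF assms(3)] bad[OF assms(4)] by (meson add_mono card_Un_le le_trans)
    finally show False by simp
  qed
qed

subsection \<open>Separating compact sets of pairs\<close>

text \<open>Only nonnegative times are inspected; a difference there already distinguishes the two
  orbit maps over all integers.\<close>

definition sep :: "('a \<times> 'a) set \<Rightarrow> ('a \<Rightarrow> real ^ 'd) \<Rightarrow> bool" where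
  "sep Z f \<longleftrightarrow> (\<forall>(x, y)\<in>Z. \<exists>n. f ((T ^^ n) x) \<noteq> f ((T ^^ n) y))"

lemma funpow_funpow: "(T ^^ m) ((T ^^ n) x) = (T ^^ (m + n)) x"
  by (simp add: funpow_add)

text \<open>\<open>K1\<close> and \<open>K2\<close> need not be near the nonwandering set; the work
  is done on their images at a time when both points have arrived in \<open>V\<close>. Sampling at
  multiples of \<open>q\<close> allows for neighbourhoods whose orbits do meet, as long as they
  never meet at two such multiples.\<close>

lemma approximable_sep_wandering_wandering:
  assumes N: "covering_dim_le (top_of_set (nonwandering X T)) (int N)"
    and M: "N + N < M * CARD('d)" and q: "q \<ge> 1"
    and K: "compact K1" "K1 \<subseteq> X" "compact K2" "K2 \<subseteq> X"
    and K1: "\<And>u v x y. x \<in> K1 \<Longrightarrow> y \<in> K1 \<Longrightarrow> (T ^^ (q * u)) x = (T ^^ (q * v)) y \<Longrightarrow> u = v"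
    and K2: "\<And>u v x y. x \<in> K2 \<Longrightarrow> y \<in> K2 \<Longrightarrow> (T ^^ (q * u)) x = (T ^^ (q * v)) y \<Longrightarrow> u = v"
    and K12: "\<And>u v x y. x \<in> K1 \<Longrightarrow> y \<in> K2 \<Longrightarrow> (T ^^ (q * u)) x \<noteq> (T ^^ (q * v)) y"
  shows "approximable (sep (K1 \<times> K2) :: ('a \<Rightarrow> real ^ 'd) \<Rightarrow> bool)"
  unfolding approximable_def
proof (intro allI impI)
  fix f :: "'a \<Rightarrow> real ^ 'd" and \<epsilon> :: real assume f: "cube_fun f" "\<epsilon> > 0"
  then have \<epsilon>4: "\<epsilon>/4 > 0" by simp
  obtain \<delta> where \<delta>: "\<delta> > 0" "\<And>x y i. x \<in> X \<Longrightarrow> y \<in> X \<Longrightarrow> dist x y < \<delta> \<Longrightarrow> \<bar>f x $ i - f y $ i\<bar> \<le> \<epsilon>/4"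
    using cube_fun_uniform[OF f(1) \<epsilon>4] by metis
  define S where "S = (\<lambda>s. q * s) ` {..<M}"
  have S: "finite S" "card S = M" using q by (auto simp: S_def card_image inj_on_def)
  have M0: "M > 0" using M by (cases M) auto
  obtain V r and I :: "'a set set" and \<phi> where V: "compact V" "V \<subseteq> X" and \<phi>: "fine_pou V N S \<delta> I \<phi>"
    and visits: "\<And>x. x \<in> X \<Longrightarrow> finite {n. (T ^^ n) x \<notin> V} \<and> card {n. (T ^^ n) x \<notin> V} \<le> r"
    by (rule tail_cover[OF N S(1) \<delta>(1)]) blast
  \<comment> \<open>Window \<open>k\<close> consists of the times \<open>t k + s\<close> with
    \<open>s\<close> in \<open>S\<close>. Distinct windows use disjoint times. Their number depends
    on \<open>r\<close>, hence on the tolerance, but only pieces of the same window are compared in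
    \<open>R\<close>.\<close>
  define t where "t k = q * (M * k)" for k
  have t: "inj t" using q M0 by (auto simp: t_def inj_on_def)
  define K where "K b = (if b then K1 else K2)" for b
  have Kc: "compact (K b)" "K b \<subseteq> X" for b using K by (auto simp: K_def)
  define L where "L p = (T ^^ t (fst p)) ` K (snd p) \<inter> V" for p
  define P where "P = {..2 * r} \<times> (UNIV :: bool set)"
  define R where "R = (\<lambda>k. ((k, True), (k, False))) ` {..2 * r}"
  have same: "b = b' \<and> u = v" if "x \<in> K b" "y \<in> K b'" "(T ^^ (q * u)) x = (T ^^ (q * v)) y" for b b' x y u v
    using that K1[of x y u v] K2[of x y u v] K12[of x y u v] K12[of y x v u]
    by (cases b; cases b') (auto simp: K_def)
  have key: "fst p = fst p' \<and> snd p = snd p' \<and> s = s' \<and> x = y"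
    if s: "s \<in> S" "s' \<in> S" and x: "x \<in> L p" "y \<in> L p'" and eq: "(T ^^ s) x = (T ^^ s') y" for s s' p p' x y
  proof -
    obtain s0 s0' where s0: "s = q * s0" "s0 < M" "s' = q * s0'" "s0' < M" using s by (auto simp: S_def)
    obtain x0 y0 where x0: "x0 \<in> K (snd p)" "x = (T ^^ t (fst p)) x0" "y0 \<in> K (snd p')" "y = (T ^^ t (fst p')) y0"
      using x by (auto simp: L_def)
    have "(T ^^ (q * (s0 + M * fst p))) x0 = (T ^^ (q * (s0' + M * fst p'))) y0"
      using eq s0 x0 by (simp add: funpow_funpow t_def distrib_left)
    from same[OF x0(1,3) this] have b: "snd p = snd p'" and u: "s0 + M * fst p = s0' + M * fst p'" by auto
    \<comment> \<open>Quotient and remainder by \<open>M\<close> recover the window and the time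
      within it.\<close>
    have "fst p = (s0 + M * fst p) div M" "s0 = (s0 + M * fst p) mod M" using s0 by auto
    moreover have "fst p' = (s0' + M * fst p') div M" "s0' = (s0' + M * fst p') mod M" using s0 by auto
    ultimately have 1: "fst p = fst p'" "s0 = s0'" using u by metis+
    then have "(T ^^ s) x = (T ^^ s) y" using eq s0 by simp
    moreover have "x \<in> X" "y \<in> X" using x V by (auto simp: L_def)
    ultimately have "x = y" using funpow_eqD by blast
    then show ?thesis using b 1 s0 by simp
  qed
  obtain g where g: "cube_fun g" "near \<epsilon> f g" and sg:
    "\<And>p p' x y. (p, p') \<in> R \<Longrightarrow> x \<in> L p \<Longrightarrow> y \<in> L p' \<Longrightarrow> \<exists>s\<in>S. g ((T ^^ s) x) \<noteq> g ((T ^^ s) y)"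
  proof (rule separating_pieces[OF f, of P S \<delta> L "\<lambda>_. N" "\<lambda>_. I" "\<lambda>_. \<phi>" R])
    show "finite P" "finite S" using S by (auto simp: P_def)
    show "\<bar>f x $ i - f y $ i\<bar> \<le> \<epsilon> / 4" if "x \<in> X" "y \<in> X" "dist x y < \<delta>" for x y i using \<delta>(2) that .
    show "compact (L p) \<and> L p \<subseteq> X" for p
      using V Kc cont_funpow unfolding L_def
      by (meson compact_Int compact_continuous_image continuous_on_subset inf.coboundedI2)
    show "fine_pou (L p) N S \<delta> I \<phi>" for p by (rule fine_pou_subset[OF \<phi>]) (auto simp: L_def)
    show "R \<subseteq> P \<times> P" by (auto simp: R_def P_def)
    show "p \<noteq> p' \<and> N + N < card S * CARD('d)" if "(p, p') \<in> R" for p p'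
      using that M S(2) by (auto simp: R_def)
    show "s = s'" if "s \<in> S" "s' \<in> S" "x \<in> L p" "(T ^^ s) x = (T ^^ s') x" for p s s' x
      using key[OF that(1,2,3,3,4)] by blast
    show "p = p' \<and> x = y \<and> (\<forall>z\<in>L p. (T ^^ s) z = (T ^^ s') z)"
      if "s \<in> S" "s' \<in> S" "x \<in> L p" "y \<in> L p'" "(T ^^ s) x = (T ^^ s') y" for p p' s s' x y
      using key[OF that] by (simp add: prod_eq_iff)
  qed blast
  have "sep (K1 \<times> K2) g" unfolding sep_def
  proof safe
    fix x y assume x: "x \<in> K1" "y \<in> K2"
    then have "x \<in> X" "y \<in> X" using K by auto
    then obtain k where k: "k \<le> 2 * r" "(T ^^ t k) x \<in> V" "(T ^^ t k) y \<in> V"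
      using good_time[OF visits t] by metis
    then have "(T ^^ t k) x \<in> L (k, True)" "(T ^^ t k) y \<in> L (k, False)"
      using x by (auto simp: L_def K_def)
    moreover have "((k, True), (k, False)) \<in> R" using k by (auto simp: R_def)
    ultimately obtain s where "g ((T ^^ s) ((T ^^ t k) x)) \<noteq> g ((T ^^ s) ((T ^^ t k) y))"
      using sg by blast
    then show "\<exists>n. g ((T ^^ n) x) \<noteq> g ((T ^^ n) y)" unfolding funpow_funpow by blast
  qed
  with g show "\<exists>g. cube_fun g \<and> near \<epsilon> f g \<and> sep (K1 \<times> K2) g" by blast
qed

text \<open>The case of two pieces and a single window. The hypotheses are asymmetric so that
  \<open>K2\<close> may consist of periodic points with fewer than \<open>card S\<close> iterates;
  the vertices that move lie over \<open>K1\<close>.\<close>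

lemma approximable_sep_tame:
  fixes I1 I2 :: "real \<Rightarrow> 'k set"
  assumes K: "compact K1" "K1 \<subseteq> X" "compact K2" "K2 \<subseteq> X" and S: "finite S"
    and I1: "\<And>\<delta>. \<delta> > 0 \<Longrightarrow> fine_pou K1 D1 S \<delta> (I1 \<delta>) (\<phi>1 \<delta>)"
    and I2: "\<And>\<delta>. \<delta> > 0 \<Longrightarrow> fine_pou K2 D2 S \<delta> (I2 \<delta>) (\<phi>2 \<delta>)"
    and K1: "\<And>s t x y. s \<in> S \<Longrightarrow> t \<in> S \<Longrightarrow> x \<in> K1 \<Longrightarrow> y \<in> K1 \<Longrightarrow> (T ^^ s) x = (T ^^ t) y \<Longrightarrow> s = t"
    and K2: "\<And>s t x y. s \<in> S \<Longrightarrow> t \<in> S \<Longrightarrow> x \<in> K2 \<Longrightarrow> y \<in> K2 \<Longrightarrow> (T ^^ s) x = (T ^^ t) y \<Longrightarrow>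
      x = y \<and> (\<forall>z\<in>K2. (T ^^ s) z = (T ^^ t) z)"
    and K12: "\<And>s t x y. s \<in> S \<Longrightarrow> t \<in> S \<Longrightarrow> x \<in> K1 \<Longrightarrow> y \<in> K2 \<Longrightarrow> (T ^^ s) x \<noteq> (T ^^ t) y"
    and D: "D1 + D2 < card S * CARD('d)"
  shows "approximable (sep (K1 \<times> K2) :: ('a \<Rightarrow> real ^ 'd) \<Rightarrow> bool)"
  unfolding approximable_def
proof (intro allI impI)
  fix f :: "'a \<Rightarrow> real ^ 'd" and \<epsilon> :: real assume f: "cube_fun f" "\<epsilon> > 0"
  then have \<epsilon>4: "\<epsilon>/4 > 0" by simp
  obtain \<delta> where \<delta>: "\<delta> > 0" "\<And>x y i. x \<in> X \<Longrightarrow> y \<in> X \<Longrightarrow> dist x y < \<delta> \<Longrightarrow> \<bar>f x $ i - f y $ i\<bar> \<le> \<epsilon>/4"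
    using cube_fun_uniform[OF f(1) \<epsilon>4] by metis
  define L where "L b = (if b then K1 else K2)" for b
  obtain g where g: "cube_fun g" "near \<epsilon> f g" and sg:
    "\<And>p p' x y. (p, p') \<in> {(True, False)} \<Longrightarrow> x \<in> L p \<Longrightarrow> y \<in> L p' \<Longrightarrow> \<exists>s\<in>S. g ((T ^^ s) x) \<noteq> g ((T ^^ s) y)"
  proof (rule separating_pieces[OF f, of UNIV S \<delta> L "\<lambda>b. if b then D1 else D2"
        "\<lambda>b. if b then I1 \<delta> else I2 \<delta>" "\<lambda>b. if b then \<phi>1 \<delta> else \<phi>2 \<delta>" "{(True, False)}"])
    show "\<bar>f x $ i - f y $ i\<bar> \<le> \<epsilon> / 4" if "x \<in> X" "y \<in> X" "dist x y < \<delta>" for x y i using \<delta>(2) that .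
    show "compact (L p) \<and> L p \<subseteq> X" for p using K by (auto simp: L_def)
    show "fine_pou (L p) (if p then D1 else D2) S \<delta> (if p then I1 \<delta> else I2 \<delta>) (if p then \<phi>1 \<delta> else \<phi>2 \<delta>)" for p
      using I1 I2 \<delta>(1) by (auto simp: L_def)
    show "p \<noteq> p' \<and> (if p then D1 else D2) + (if p' then D1 else D2) < card S * CARD('d)"
      if "(p, p') \<in> {(True, False)}" for p p' using that D by auto
    show "s = s'" if "(p, p') \<in> {(True, False)}" "s \<in> S" "s' \<in> S" "x \<in> L p" "(T ^^ s) x = (T ^^ s') x" for p p' s s' x
      using K1 that by (auto simp: L_def)
    show "p = p' \<and> x = y \<and> (\<forall>z\<in>L p. (T ^^ s) z = (T ^^ s') z)"
      if s: "s \<in> S" "s' \<in> S" and x: "x \<in> L p" "y \<in> L p'" and eq: "(T ^^ s) x = (T ^^ s') y" for p p' s s' x y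
    proof (cases p; cases p')
      assume [simp]: "p" "p'"
      have "s = s'" using K1[of s s' x y] s x eq by (simp add: L_def)
      then show ?thesis using funpow_eqD[of s x y] x eq K by (auto simp: L_def)
    next
      assume "p" "\<not> p'"
      then show ?thesis using K12[of s s' x y] s x eq by (simp add: L_def)
    next
      assume "\<not> p" "p'"
      then show ?thesis using K12[of s' s y x] s x eq by (simp add: L_def)
    next
      assume "\<not> p" "\<not> p'"
      then show ?thesis using K2[of s s' x y] s x eq by (simp add: L_def)
    qed
  qed (use S in auto)
  have "sep (K1 \<times> K2) g" unfolding sep_def using sg[of True False] by (fastforce simp: L_def)
  with g show "\<exists>g. cube_fun g \<and> near \<epsilon> f g \<and> sep (K1 \<times> K2) g" by blast
qed

text \<open>Baire's theorem is applied with the piecewise linear structure over \<open>K1\<close> held fixed: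
  only its values at the vertices and the values on the nonwandering set remain free, so the
  conditions for all pieces of the nonwandering set can be met at once.\<close>

lemma approximable_sep_wandering_nonwandering:
  fixes I :: "'a set \<Rightarrow> real \<Rightarrow> 'k set"
  assumes N: "covering_dim_le (top_of_set (nonwandering X T)) (int N)"
    and M: "N + N < M * CARD('d)"
    and K: "compact K1" "K1 \<subseteq> X"
    and K1: "\<And>u v x y. x \<in> K1 \<Longrightarrow> y \<in> K1 \<Longrightarrow> (T ^^ u) x = (T ^^ v) y \<Longrightarrow> u = v"
    and K1w: "K1 \<inter> nonwandering X T = {}"
    and CC: "countable CC" "nonwandering X T \<subseteq> \<Union>CC"
    and C: "\<And>C. C \<in> CC \<Longrightarrow> compact C \<and> C \<subseteq> nonwandering X T"
    and I: "\<And>C \<delta>. C \<in> CC \<Longrightarrow> \<delta> > 0 \<Longrightarrow> fine_pou C N {..<M} \<delta> (I C \<delta>) (\<psi> C \<delta>)"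
    and tame: "\<And>C s t x y. C \<in> CC \<Longrightarrow> s < M \<Longrightarrow> t < M \<Longrightarrow> x \<in> C \<Longrightarrow> y \<in> C \<Longrightarrow>
        (T ^^ s) x = (T ^^ t) y \<Longrightarrow> x = y \<and> (\<forall>z\<in>C. (T ^^ s) z = (T ^^ t) z)"
  shows "approximable (sep (K1 \<times> nonwandering X T) :: ('a \<Rightarrow> real ^ 'd) \<Rightarrow> bool)"
  unfolding approximable_def
proof (intro allI impI)
  let ?O = "nonwandering X T"
  fix f :: "'a \<Rightarrow> real ^ 'd" and \<epsilon> :: real assume f: "cube_fun f" "\<epsilon> > 0"
  then have \<epsilon>4: "\<epsilon>/4 > 0" by simp
  obtain \<delta> where \<delta>: "\<delta> > 0" "\<And>x y i. x \<in> X \<Longrightarrow> y \<in> X \<Longrightarrow> dist x y < \<delta> \<Longrightarrow> \<bar>f x $ i - f y $ i\<bar> \<le> \<epsilon>/4"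
    using cube_fun_uniform[OF f(1) \<epsilon>4] by metis
  define S where "S = {..<M}"
  have S: "finite S" "card S = M" by (auto simp: S_def)
  have M0: "M > 0" using M by (cases M) auto
  obtain V r and I0 :: "'a set set" and \<phi>0 where V: "compact V" "V \<subseteq> X" and \<phi>0: "fine_pou V N S \<delta> I0 \<phi>0"
    and visits: "\<And>x. x \<in> X \<Longrightarrow> finite {n. (T ^^ n) x \<notin> V} \<and> card {n. (T ^^ n) x \<notin> V} \<le> r"
    by (rule tail_cover[OF N S(1) \<delta>(1)]) blast
  define t where "t k = M * k" for k
  have t: "inj t" using M0 by (auto simp: t_def inj_on_def)
  define L where "L k = (T ^^ t k) ` K1 \<inter> V" for k
  have L: "compact (L k)" "L k \<subseteq> X" for k
    using V K cont_funpow unfolding L_def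
    by (meson compact_Int compact_continuous_image continuous_on_subset inf.coboundedI2)+
  \<comment> \<open>This separates the pieces over \<open>K1\<close> from the nonwandering set at
    all times, so the two prescriptions below never compete.\<close>
  have LO: "(T ^^ s) x \<notin> ?O" if x: "x \<in> L k" for s x k
  proof
    assume "(T ^^ s) x \<in> ?O"
    moreover obtain x0 where "x0 \<in> K1" "x = (T ^^ t k) x0" using x by (auto simp: L_def)
    ultimately have "x0 \<in> ?O" using nonwandering_funpowD[of x0 "s + t k"] K by (auto simp: funpow_funpow)
    then show False using K1w \<open>x0 \<in> K1\<close> by blast
  qed
  have key: "k = k' \<and> s = s' \<and> x = y"
    if s: "s \<in> S" "s' \<in> S" and x: "x \<in> L k" "y \<in> L k'" and eq: "(T ^^ s) x = (T ^^ s') y" for s s' k k' x y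
  proof -
    obtain x0 y0 where x0: "x0 \<in> K1" "x = (T ^^ t k) x0" "y0 \<in> K1" "y = (T ^^ t k') y0"
      using x by (auto simp: L_def)
    have "(T ^^ (s + M * k)) x0 = (T ^^ (s' + M * k')) y0"
      using eq x0 by (simp add: funpow_funpow t_def)
    from K1[OF x0(1,3) this] have u: "s + M * k = s' + M * k'" .
    have "k = (s + M * k) div M" "s = (s + M * k) mod M" using s by (auto simp: S_def)
    moreover have "k' = (s' + M * k') div M" "s' = (s' + M * k') mod M" using s by (auto simp: S_def)
    ultimately have 1: "k = k'" "s = s'" using u by metis+
    moreover have "x \<in> X" "y \<in> X" using x V by (auto simp: L_def)
    ultimately have "x = y" using funpow_eqD eq by blast
    then show ?thesis using 1 by simp
  qed
  have "\<forall>k. \<exists>J\<phi>. pointed_pou (L k) N S \<delta> (fst J\<phi>) (snd J\<phi>)"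
  proof
    fix k
    have "fine_pou (L k) N S \<delta> I0 \<phi>0" by (rule fine_pou_subset[OF \<phi>0]) (auto simp: L_def)
    from pointed_pou_of_fine_pou[OF this] show "\<exists>J\<phi>. pointed_pou (L k) N S \<delta> (fst J\<phi>) (snd J\<phi>)" by (metis fst_conv snd_conv)
  qed
  from choice[OF this] obtain J\<phi> where J\<phi>: "\<forall>k. pointed_pou (L k) N S \<delta> (fst (J\<phi> k)) (snd (J\<phi> k))" ..
  define J where "J k = fst (J\<phi> k)" for k
  define \<phi> where "\<phi> k = snd (J\<phi> k)" for k
  have \<phi>: "pointed_pou (L k) N S \<delta> (J k) (\<phi> k)" for k using J\<phi> by (simp add: J_def \<phi>_def)
  have J: "finite (J k)" "J k \<subseteq> L k" "J k \<subseteq> X" for k using \<phi>[of k] L(2)[of k] by (auto simp: pointed_pou_def)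
  define pl where "pl k s h x = (\<Sum>c\<in>J k. \<phi> k c x *\<^sub>R h ((T ^^ s) c))" for k s x and h :: "'a \<Rightarrow> real ^ 'd"
  \<comment> \<open>Interpolated values over \<open>L k\<close> are compared with actual values of
    \<open>h\<close> on \<open>C\<close>. The final function is interpolated along \<open>K1\<close>
    and equal to \<open>h\<close> on the nonwandering set, so these conditions on \<open>h\<close>
    survive the replacement.\<close>
  define \<Phi> where "\<Phi> kC h = (\<forall>x\<in>L (fst kC). \<forall>y\<in>snd kC. \<exists>s\<in>S. pl (fst kC) s h x \<noteq> h ((T ^^ s) y))"
    for kC and h :: "'a \<Rightarrow> real ^ 'd"
  have "approximable (\<lambda>h. \<forall>kC\<in>UNIV \<times> CC. \<Phi> kC h)"
  proof (rule baire_approximation)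
    show "countable ((UNIV :: nat set) \<times> CC)" using CC by simp
    fix kC :: "nat \<times> 'a set" assume kC: "kC \<in> UNIV \<times> CC"
    obtain k C where kC': "kC = (k, C)" by force
    have CCC: "C \<in> CC" using kC kC' by simp
    have C': "compact C" "C \<subseteq> X" "C \<subseteq> ?O" using C[OF CCC] nonwandering_subset by auto
    have "robust (\<lambda>h :: 'a \<Rightarrow> real ^ 'd. \<forall>z\<in>L k \<times> C. \<exists>s\<in>S. pl k s h (fst z) - h ((T ^^ s) (snd z)) \<noteq> 0)"
    proof (rule robust_nonvanishing)
      show "compact (L k \<times> C)" using L C' by (simp add: compact_Times)
      show "continuous_on (L k \<times> C) (\<lambda>z. pl k s h (fst z) - h ((T ^^ s) (snd z)))"
        if h: "cube_fun h" for s and h :: "'a \<Rightarrow> real ^ 'd"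
      proof (intro continuous_on_diff)
        show "continuous_on (L k \<times> C) (\<lambda>z. pl k s h (fst z))"
          unfolding pl_def
          by (rule continuous_on_compose2[OF pl_continuous[OF \<phi>] continuous_on_fst]) (auto intro: continuous_on_id)
        have "continuous_on (L k \<times> C) (\<lambda>z. (T ^^ s) (snd z))"
          by (rule continuous_on_compose2[OF cont_funpow continuous_on_snd]) (use C' in \<open>auto intro: continuous_on_id\<close>)
        moreover have "continuous_on X h" using h by (simp add: cube_fun_def)
        moreover have "(\<lambda>z. (T ^^ s) (snd z)) ` (L k \<times> C) \<subseteq> X" using funpow_in C'(2) by auto
        ultimately show "continuous_on (L k \<times> C) (\<lambda>z. h ((T ^^ s) (snd z)))"
          using continuous_on_compose2 by blast
      qed
      fix s z i \<eta> and h g :: "'a \<Rightarrow> real ^ 'd" assume z: "z \<in> L k \<times> C" and n: "near \<eta> h g"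
      have "\<bar>pl k s g (fst z) $ i - pl k s h (fst z) $ i\<bar> \<le> \<eta>"
        unfolding pl_def using z by (intro pl_near[OF \<phi> L(2) _ n]) auto
      moreover have "(T ^^ s) (snd z) \<in> X" using z C' funpow_in by auto
      then have "\<bar>g ((T ^^ s) (snd z)) $ i - h ((T ^^ s) (snd z)) $ i\<bar> \<le> \<eta>" using n by (simp add: near_def)
      ultimately show "\<bar>(pl k s g (fst z) - g ((T ^^ s) (snd z))) $ i - (pl k s h (fst z) - h ((T ^^ s) (snd z))) $ i\<bar> \<le> 2 * \<eta>"
        unfolding vector_minus_component by linarith
    qed
    moreover have "(\<lambda>h :: 'a \<Rightarrow> real ^ 'd. \<forall>z\<in>L k \<times> C. \<exists>s\<in>S. pl k s h (fst z) - h ((T ^^ s) (snd z)) \<noteq> 0) = \<Phi> kC"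
      by (simp add: \<Phi>_def kC' fun_eq_iff)
    ultimately show "robust (\<Phi> kC)" by simp
    have "approximable (\<lambda>h :: 'a \<Rightarrow> real ^ 'd. \<forall>x\<in>L k. \<forall>y\<in>C. \<exists>s\<in>S.
      (\<Sum>c\<in>J k. \<phi> k c x *\<^sub>R h ((T ^^ s) c)) \<noteq> h ((T ^^ s) y))"
    proof (rule approximable_pl_off_image[OF S(1) J(1,3) C'(1,2), where I = "I C" and \<psi>' = "\<psi> C" and D = N and D' = N])
      show "(\<Sum>c\<in>J k. \<phi> k c x) = 1 \<and> card {c \<in> J k. \<phi> k c x \<noteq> 0} \<le> Suc N" if "x \<in> L k" for x
        using \<phi> that by (auto simp: pointed_pou_def)
      show "fine_pou C N S e (I C e) (\<psi> C e)" if "e > 0" for e using I[OF CCC that] by (simp add: S_def)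
      show "s = s' \<and> c = c'" if "s \<in> S" "s' \<in> S" "c \<in> J k" "c' \<in> J k" "(T ^^ s) c = (T ^^ s') c'" for s s' c c'
        using key[of s s' c k c' k] that J(2) by blast
      show "(T ^^ s) c \<noteq> (T ^^ s') c'" if "s \<in> S" "s' \<in> S" "c \<in> J k" "c' \<in> C" for s s' c c'
        using LO[of c k s] nonwandering_funpow[of c' s'] that J(2) C'(3) by (metis subsetD)
      show "x = y \<and> (\<forall>z\<in>C. (T ^^ s) z = (T ^^ t) z)"
        if "s \<in> S" "t \<in> S" "x \<in> C" "y \<in> C" "(T ^^ s) x = (T ^^ t) y" for s t x y
        using tame[OF CCC, of s t x y] that by (auto simp: S_def)
      show "N + N < card S * CARD('d)" using M S by simp
    qed
    then show "approximable (\<Phi> kC)" by (simp add: \<Phi>_def[abs_def] kC' pl_def)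
  qed
  then obtain h where h: "cube_fun h" "near (\<epsilon>/4) f h" and \<Phi>: "\<And>k C. C \<in> CC \<Longrightarrow> \<Phi> (k, C) h"
    using f(1) \<epsilon>4 unfolding approximable_def by blast
  \<comment> \<open>\<open>None\<close> is the piece on which \<open>h\<close> is retained. Time 0
    is enough for it because the nonwandering set is forward invariant.\<close>
  define P :: "(nat \<times> nat) option set" where "P = insert None (Some ` ({..2 * r} \<times> S))"
  define L' where "L' p = (case p of None \<Rightarrow> ?O | Some ks \<Rightarrow> L (fst ks))" for p :: "(nat \<times> nat) option"
  define t' where "t' p = (case p of None \<Rightarrow> 0 | Some ks \<Rightarrow> snd ks)" for p :: "(nat \<times> nat) option"
  define H where "H p = (case p of None \<Rightarrow> h | Some ks \<Rightarrow> pl (fst ks) (snd ks) h)" for p :: "(nat \<times> nat) option"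
  obtain g where g: "cube_fun g" "near (3 * (\<epsilon>/4)) h g"
    "\<And>p x. p \<in> P \<Longrightarrow> x \<in> L' p \<Longrightarrow> g ((T ^^ t' p) x) = H p x"
  proof (rule extend_pieces[OF h(1), of "3 * (\<epsilon>/4)" P L' H t'])
    show "3 * (\<epsilon>/4) \<ge> 0" "finite P" using f S by (auto simp: P_def)
    fix p assume p: "p \<in> P"
    show "compact (L' p) \<and> L' p \<subseteq> X"
      using L compact_nonwandering nonwandering_subset by (auto simp: L'_def split: option.split)
    show "continuous_on (L' p) (H p)"
    proof (cases p)
      case None
      then show ?thesis using h(1) nonwandering_subset continuous_on_subset by (auto simp: L'_def H_def cube_fun_def)
    next
      case (Some ks)
      then show ?thesis using pl_continuous[OF \<phi>] by (simp add: L'_def H_def pl_def[abs_def])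
    qed
    fix x assume x: "x \<in> L' p"
    show "H p x \<in> unit_cube"
    proof (cases p)
      case None
      then show ?thesis using h(1) x nonwandering_subset by (auto simp: L'_def H_def cube_fun_def)
    next
      case (Some ks)
      then show ?thesis using pl_in_cube[OF \<phi> L(2) h(1)] x by (simp add: L'_def H_def pl_def)
    qed
    show "\<bar>H p x $ i - h ((T ^^ t' p) x) $ i\<bar> \<le> 3 * (\<epsilon>/4)" for i
    proof (cases p)
      case None
      then show ?thesis using f by (simp add: H_def t'_def)
    next
      case (Some ks)
      then have "x \<in> L (fst ks)" "snd ks \<in> S" using x p by (auto simp: L'_def P_def)
      from pl_close[OF \<phi> L(2) this \<delta>(2) h(2)] show ?thesis by (simp add: H_def t'_def pl_def Some)
    qed
    fix q y assume q: "q \<in> P" and y: "y \<in> L' q" and eq: "(T ^^ t' p) x = (T ^^ t' q) y"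
    show "H p x = H q y"
    proof (cases p; cases q)
      assume "p = None" "q = None"
      then show ?thesis using eq by (simp add: H_def t'_def)
    next
      fix ks assume "p = None" "q = Some ks"
      then show ?thesis using eq x y LO[of y "fst ks" "snd ks"] by (auto simp: t'_def L'_def)
    next
      fix ks assume "p = Some ks" "q = None"
      then show ?thesis using eq x y LO[of x "fst ks" "snd ks"] by (auto simp: t'_def L'_def)
    next
      fix ks ks' assume pq: "p = Some ks" "q = Some ks'"
      then have "fst ks = fst ks' \<and> snd ks = snd ks' \<and> x = y"
        using p q x y eq by (intro key) (auto simp: P_def L'_def t'_def)
      then show ?thesis using pq by (simp add: H_def)
    qed
  qed blast
  have "near \<epsilon> f g" by (rule near_trans[OF h(2) g(2)]) simp
  moreover have "sep (K1 \<times> ?O) g" unfolding sep_def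
  proof safe
    fix x y assume x: "x \<in> K1" "y \<in> ?O"
    then have "x \<in> X" "y \<in> X" using K nonwandering_subset by auto
    then obtain k where k: "k \<le> 2 * r" "(T ^^ t k) x \<in> V" using good_time[OF visits t] by metis
    define x' where "x' = (T ^^ t k) x"
    define y' where "y' = (T ^^ t k) y"
    have x': "x' \<in> L k" using k x by (auto simp: L_def x'_def)
    have y': "y' \<in> ?O" using nonwandering_funpow x by (simp add: y'_def)
    then obtain C where C: "C \<in> CC" "y' \<in> C" using CC(2) by blast
    then obtain s where s: "s \<in> S" "pl k s h x' \<noteq> h ((T ^^ s) y')"
      using \<Phi>[OF C(1), of k] x' by (auto simp: \<Phi>_def)
    have "g ((T ^^ s) x') = pl k s h x'"
      using g(3)[of "Some (k, s)" x'] x' s k by (simp add: P_def L'_def t'_def H_def)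
    moreover have "g ((T ^^ s) y') = h ((T ^^ s) y')"
      using g(3)[of None "(T ^^ s) y'"] nonwandering_funpow[OF y'] by (simp add: P_def L'_def t'_def H_def)
    ultimately have "g ((T ^^ s) x') \<noteq> g ((T ^^ s) y')" using s by simp
    then show "\<exists>n. g ((T ^^ n) x) \<noteq> g ((T ^^ n) y)"
      unfolding x'_def y'_def funpow_funpow by blast
  qed
  ultimately show "\<exists>g. cube_fun g \<and> near \<epsilon> f g \<and> sep (K1 \<times> ?O) g" using g(1) by blast
qed

end

subsection \<open>Countable unions of compact sets of pairs\<close>

definition sigma_compact :: "'z::metric_space set \<Rightarrow> bool" where
  "sigma_compact Z \<longleftrightarrow> (\<exists>\<C>. countable \<C> \<and> (\<forall>C\<in>\<C>. compact C) \<and> Z = \<Union>\<C>)"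

lemma sigma_compact_compact: "compact C \<Longrightarrow> sigma_compact C"
  unfolding sigma_compact_def by (intro exI[of _ "{C}"]) auto

lemma sigma_compact_diff:
  assumes "compact C" "closed F"
  shows "sigma_compact (C - F)"
proof (cases "F = {}")
  \<comment> \<open>Separate because \<open>infdist\<close> to the empty set is 0, which would make
    all the sets \<open>K n\<close> below empty.\<close>
  case True
  then show ?thesis using assms(1) sigma_compact_compact by simp
next
  case False
  define K where "K n = C \<inter> {x. 1 / real (Suc n) \<le> infdist x F}" for n
  have "compact (K n)" for n
    unfolding K_def using assms(1) by (intro compact_Int_closed closed_Collect_le continuous_intros)
  moreover have "C - F = \<Union>(range K)"
  proof (intro equalityI subsetI)
    fix x assume x: "x \<in> C - F"
    then have "infdist x F > 0" using False assms(2)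
      by (metis DiffD2 in_closed_iff_infdist_zero infdist_nonneg less_eq_real_def)
    then obtain n where "1 / real (Suc n) < infdist x F" using nat_approx_posE by metis
    then show "x \<in> \<Union>(range K)" using x by (auto simp: K_def intro!: exI[of _ n])
  next
    fix x assume "x \<in> \<Union>(range K)"
    then obtain n where n: "x \<in> C" "1 / real (Suc n) \<le> infdist x F" by (auto simp: K_def)
    have "0 < 1 / real (Suc n)" by simp
    then have "x \<notin> F" using n by (metis infdist_zero not_le)
    with n show "x \<in> C - F" by blast
  qed
  ultimately show ?thesis unfolding sigma_compact_def by (intro exI[of _ "range K"]) auto
qed

lemma sigma_compact_Diff_closed:
  assumes "sigma_compact A" "closed F"
  shows "sigma_compact (A - F)"
proof -
  obtain \<C> where \<C>: "countable \<C>" "\<forall>C\<in>\<C>. compact C" "A = \<Union>\<C>"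
    using assms(1) unfolding sigma_compact_def by blast
  have "\<forall>C\<in>\<C>. \<exists>\<D>. countable \<D> \<and> (\<forall>D\<in>\<D>. compact D) \<and> C - F = \<Union>\<D>"
    using \<C>(2) sigma_compact_diff[OF _ assms(2)] unfolding sigma_compact_def by blast
  from bchoice[OF this] obtain \<D> where \<D>: "\<forall>C\<in>\<C>. countable (\<D> C) \<and> (\<forall>D\<in>\<D> C. compact D) \<and> C - F = \<Union>(\<D> C)" ..
  have "A - F = (\<Union>C\<in>\<C>. C - F)" using \<C>(3) by blast
  also have "\<dots> = (\<Union>C\<in>\<C>. \<Union>(\<D> C))" using \<D> by (intro SUP_cong refl) metis
  also have "\<dots> = \<Union>(\<Union>C\<in>\<C>. \<D> C)" by blast
  finally have "A - F = \<Union>(\<Union>C\<in>\<C>. \<D> C)" .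
  moreover have "countable (\<Union>C\<in>\<C>. \<D> C)" by (rule countable_UN[OF \<C>(1)]) (use \<D> in blast)
  moreover have "\<forall>D\<in>(\<Union>C\<in>\<C>. \<D> C). compact D" using \<D> by blast
  ultimately show ?thesis unfolding sigma_compact_def by blast
qed

lemma sigma_compact_Times:
  assumes "sigma_compact A" "sigma_compact B"
  shows "sigma_compact (A \<times> B)"
proof -
  obtain \<C> where \<C>: "countable \<C>" "\<forall>C\<in>\<C>. compact C" "A = \<Union>\<C>"
    using assms(1) unfolding sigma_compact_def by blast
  obtain \<D> where \<D>: "countable \<D>" "\<forall>C\<in>\<D>. compact C" "B = \<Union>\<D>"
    using assms(2) unfolding sigma_compact_def by blast
  have "A \<times> B = \<Union>((\<lambda>(C, D). C \<times> D) ` (\<C> \<times> \<D>))" using \<C>(3) \<D>(3) by auto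
  moreover have "countable ((\<lambda>(C, D). C \<times> D) ` (\<C> \<times> \<D>))" using \<C>(1) \<D>(1) by simp
  moreover have "\<forall>K\<in>(\<lambda>(C, D). C \<times> D) ` (\<C> \<times> \<D>). compact K"
    using \<C>(2) \<D>(2) by (auto intro: compact_Times)
  ultimately show ?thesis unfolding sigma_compact_def by blast
qed

lemma sigma_compact_image:
  assumes "sigma_compact A" "continuous_on A g"
  shows "sigma_compact (g ` A)"
proof -
  obtain \<C> where \<C>: "countable \<C>" "\<forall>C\<in>\<C>. compact C" "A = \<Union>\<C>"
    using assms(1) unfolding sigma_compact_def by blast
  have "\<forall>C\<in>\<C>. compact (g ` C)"
    using \<C> assms(2) by (meson Union_upper compact_continuous_image continuous_on_subset)
  moreover have "g ` A = \<Union>((`) g ` \<C>)" using \<C>(3) by auto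
  ultimately show ?thesis unfolding sigma_compact_def using \<C>(1)
    by (intro exI[of _ "(`) g ` \<C>"]) auto
qed

lemma sigma_compact_ball_cover:
  fixes r :: "'z::metric_space \<Rightarrow> real"
  assumes "sigma_compact Z" "\<And>z. z \<in> Z \<Longrightarrow> r z > 0"
  obtains C where "C \<subseteq> Z" "countable C" "Z \<subseteq> (\<Union>z\<in>C. cball z (r z))"
proof -
  obtain \<C> where \<C>: "countable \<C>" "\<forall>C\<in>\<C>. compact C" "Z = \<Union>\<C>"
    using assms(1) unfolding sigma_compact_def by blast
  have "\<forall>K\<in>\<C>. \<exists>C. C \<subseteq> K \<and> finite C \<and> K \<subseteq> (\<Union>z\<in>C. ball z (r z))"
  proof
    fix K assume K: "K \<in> \<C>"
    have "z \<in> ball z (r z)" if "z \<in> K" for z using assms(2)[of z] \<C>(3) K that by auto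
    then have "K \<subseteq> (\<Union>z\<in>K. ball z (r z))" by blast
    then show "\<exists>C. C \<subseteq> K \<and> finite C \<and> K \<subseteq> (\<Union>z\<in>C. ball z (r z))"
      by (rule compactE_image[OF \<C>(2)[rule_format, OF K] open_ball]) blast
  qed
  from bchoice[OF this] obtain C where C: "\<forall>K\<in>\<C>. C K \<subseteq> K \<and> finite (C K) \<and> K \<subseteq> (\<Union>z\<in>C K. ball z (r z))" ..
  have "(\<Union>K\<in>\<C>. C K) \<subseteq> Z" using C \<C>(3) by blast
  moreover have "countable (\<Union>K\<in>\<C>. C K)" by (rule countable_UN[OF \<C>(1)]) (use C countable_finite in blast)
  moreover have "Z \<subseteq> (\<Union>z\<in>(\<Union>K\<in>\<C>. C K). cball z (r z))"
  proof
    fix z assume "z \<in> Z"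
    then obtain K where K: "K \<in> \<C>" "z \<in> K" using \<C>(3) by blast
    then obtain w where "w \<in> C K" "z \<in> ball w (r w)" using C by blast
    then show "z \<in> (\<Union>z\<in>(\<Union>K\<in>\<C>. C K). cball z (r z))" using K by (auto simp: mem_ball mem_cball intro: less_imp_le)
  qed
  ultimately show ?thesis using that by blast
qed

lemma cball_Pair_subset: "cball (x, y) r \<subseteq> cball x r \<times> cball y r"
proof
  fix z assume z: "z \<in> cball (x, y) r"
  have "dist x (fst z) \<le> dist (x, y) z" "dist y (snd z) \<le> dist (x, y) z"
    using dist_fst_le[of "(x, y)" z] dist_snd_le[of "(x, y)" z] by auto
  then show "z \<in> cball x r \<times> cball y r" using z by (auto simp: mem_Times_iff)
qed

section \<open>Countable covers by compact sets of separable pairs\<close>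

context compact_system
begin

text \<open>The type token names the dimension, which no other argument mentions. Such a set never
  meets the diagonal, for no function separates a point from itself.\<close>

definition sep_compact :: "'d::finite itself \<Rightarrow> ('a \<times> 'a) set \<Rightarrow> bool" where
  "sep_compact d C \<longleftrightarrow> compact C \<and> C \<subseteq> X \<times> X \<and> approximable (sep C :: ('a \<Rightarrow> real ^ 'd) \<Rightarrow> bool)"

definition sigma_sep :: "'d::finite itself \<Rightarrow> ('a \<times> 'a) set \<Rightarrow> bool" where
  "sigma_sep d Z \<longleftrightarrow> (\<exists>\<C>. countable \<C> \<and> (\<forall>C\<in>\<C>. sep_compact d C) \<and> Z \<subseteq> \<Union>\<C>)"

lemma sigma_sep_subset: "sigma_sep d Z \<Longrightarrow> Z' \<subseteq> Z \<Longrightarrow> sigma_sep d Z'"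
  unfolding sigma_sep_def by (meson subset_trans)

lemma sigma_sep_compact:
  assumes "compact C" "C \<subseteq> X \<times> X" "approximable (sep C :: ('a \<Rightarrow> real ^ 'd) \<Rightarrow> bool)" "Z \<subseteq> C"
  shows "sigma_sep TYPE('d) Z"
  unfolding sigma_sep_def using assms by (intro exI[of _ "{C}"]) (auto simp: sep_compact_def)

lemma sigma_sep_UN:
  assumes "countable I" "\<And>i. i \<in> I \<Longrightarrow> sigma_sep d (Z i)"
  shows "sigma_sep d (\<Union>i\<in>I. Z i)"
proof -
  have "\<forall>i\<in>I. \<exists>\<C>. countable \<C> \<and> (\<forall>C\<in>\<C>. sep_compact d C) \<and> Z i \<subseteq> \<Union>\<C>"
    using assms(2) unfolding sigma_sep_def by blast
  from bchoice[OF this] obtain \<C> where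
    \<C>: "\<forall>i\<in>I. countable (\<C> i) \<and> (\<forall>C\<in>\<C> i. sep_compact d C) \<and> Z i \<subseteq> \<Union>(\<C> i)" ..
  have 1: "countable (\<Union>i\<in>I. \<C> i)" by (rule countable_UN[OF assms(1)]) (use \<C> in blast)
  have 2: "\<forall>C\<in>(\<Union>i\<in>I. \<C> i). sep_compact d C" using \<C> by blast
  have 3: "(\<Union>i\<in>I. Z i) \<subseteq> \<Union>(\<Union>i\<in>I. \<C> i)"
  proof (rule UN_least)
    fix i assume i: "i \<in> I"
    then have "Z i \<subseteq> \<Union>(\<C> i)" using \<C> by blast
    also have "\<dots> \<subseteq> \<Union>(\<Union>i\<in>I. \<C> i)" using i by (intro Union_mono UN_upper)
    finally show "Z i \<subseteq> \<Union>(\<Union>i\<in>I. \<C> i)" .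
  qed
  show ?thesis unfolding sigma_sep_def
    by (rule exI[of _ "\<Union>i\<in>I. \<C> i"]) (rule conjI[OF 1 conjI[OF 2 3]])
qed

lemma sigma_sep_Un:
  assumes "sigma_sep TYPE('d) A" "sigma_sep TYPE('d) B"
  shows "sigma_sep TYPE('d::finite) (A \<union> B)"
proof -
  have "sigma_sep TYPE('d) (\<Union>b\<in>UNIV. if b then A else B)"
    by (rule sigma_sep_UN) (use assms in auto)
  then show ?thesis by (rule sigma_sep_subset) (auto split: if_splits)
qed

lemma sigma_sep_swap:
  assumes "sigma_sep TYPE('d) Z"
  shows "sigma_sep TYPE('d::finite) (prod.swap ` Z)"
proof -
  obtain \<C> where \<C>: "countable \<C>" "\<forall>C\<in>\<C>. sep_compact TYPE('d) C" "Z \<subseteq> \<Union>\<C>"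
    using assms unfolding sigma_sep_def by blast
  have "continuous_on C prod.swap" for C :: "('a \<times> 'a) set"
    unfolding prod.swap_def by (intro continuous_intros)
  then have 1: "compact (prod.swap ` C)" if "C \<in> \<C>" for C
    using \<C>(2) that compact_continuous_image unfolding sep_compact_def by blast
  have 2: "(sep (prod.swap ` C) :: ('a \<Rightarrow> real ^ 'd) \<Rightarrow> bool) = sep C" for C
  proof
    fix f :: "'a \<Rightarrow> real ^ 'd"
    have "sep (prod.swap ` C) f \<longleftrightarrow> (\<forall>p\<in>C. \<exists>n. f ((T ^^ n) (snd p)) \<noteq> f ((T ^^ n) (fst p)))"
      by (simp add: sep_def split_beta)
    also have "\<dots> \<longleftrightarrow> sep C f"
      unfolding sep_def split_beta by (intro ball_cong ex_cong1 refl) auto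
    finally show "sep (prod.swap ` C) f = sep C f" .
  qed
  have "sigma_sep TYPE('d) (\<Union>C\<in>\<C>. prod.swap ` C)"
  proof (rule sigma_sep_UN[OF \<C>(1)])
    fix C assume C: "C \<in> \<C>"
    show "sigma_sep TYPE('d) (prod.swap ` C)"
      by (rule sigma_sep_compact[OF 1[OF C]]) (use bspec[OF \<C>(2) C] in \<open>auto simp: 2 sep_compact_def\<close>)
  qed
  then show ?thesis by (rule sigma_sep_subset) (use \<C>(3) in blast)
qed

text \<open>The Lindelof argument that reduces a class of pairs to neighbourhoods of single pairs.
  It is the reason why every class of pairs below has to be sigma-compact.\<close>

lemma sigma_sep_local:
  assumes "sigma_compact Z" "\<And>z. z \<in> Z \<Longrightarrow> \<exists>r>0. sigma_sep TYPE('d) (Z \<inter> cball z r)"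
  shows "sigma_sep TYPE('d::finite) Z"
proof -
  have "\<forall>z\<in>Z. \<exists>r. r > 0 \<and> sigma_sep TYPE('d) (Z \<inter> cball z r)" using assms(2) by blast
  from bchoice[OF this] obtain r where r: "\<And>z. z \<in> Z \<Longrightarrow> r z > 0 \<and> sigma_sep TYPE('d) (Z \<inter> cball z (r z))" by blast
  have r0: "\<And>z. z \<in> Z \<Longrightarrow> r z > 0" using r by blast
  obtain C where C: "C \<subseteq> Z" "countable C" "Z \<subseteq> (\<Union>z\<in>C. cball z (r z))"
    by (rule sigma_compact_ball_cover[OF assms(1) r0])
  have "sigma_sep TYPE('d) (\<Union>z\<in>C. Z \<inter> cball z (r z))"
    by (rule sigma_sep_UN[OF C(2)]) (use C(1) r in blast)
  then show ?thesis by (rule sigma_sep_subset) (use C(3) in blast)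
qed

lemma approximable_mono: "approximable \<Phi> \<Longrightarrow> (\<And>f. \<Phi> f \<Longrightarrow> \<Psi> f) \<Longrightarrow> approximable \<Psi>"
  unfolding approximable_def by blast

section \<open>Strata with uniform coincidences of iterates\<close>

lemma funpow_separation:
  assumes "finite S" "x \<in> X" "y \<in> X"
  obtains r where "r > 0" "\<And>s t x' y'. s \<in> S \<Longrightarrow> t \<in> S \<Longrightarrow> (T ^^ s) x \<noteq> (T ^^ t) y \<Longrightarrow>
    x' \<in> X \<Longrightarrow> y' \<in> X \<Longrightarrow> dist x x' \<le> r \<Longrightarrow> dist y y' \<le> r \<Longrightarrow> (T ^^ s) x' \<noteq> (T ^^ t) y'"
proof -
  define E where "E = {dist ((T ^^ s) x) ((T ^^ t) y) | s t. s \<in> S \<and> t \<in> S \<and> (T ^^ s) x \<noteq> (T ^^ t) y}"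
  have "E \<subseteq> (\<lambda>(s, t). dist ((T ^^ s) x) ((T ^^ t) y)) ` (S \<times> S)" by (auto simp: E_def)
  then have finE: "finite E" using assms(1) finite_subset by blast
  define \<delta> where "\<delta> = Min (insert 1 E) / 2"
  have "Min (insert 1 E) > 0" using finE by (subst Min_gr_iff) (auto simp: E_def)
  then have \<delta>: "\<delta> > 0" by (simp add: \<delta>_def)
  have E: "2 * \<delta> \<le> e" if "e \<in> E" for e using that finE by (auto simp: \<delta>_def)
  obtain \<rho> where \<rho>: "\<rho> > 0" "\<And>x y s. x \<in> X \<Longrightarrow> y \<in> X \<Longrightarrow> dist x y < \<rho> \<Longrightarrow> s \<in> S
      \<Longrightarrow> dist ((T ^^ s) x) ((T ^^ s) y) < \<delta>"
    using funpow_uniform[OF assms(1) \<delta>] by metis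
  have "(T ^^ s) x' \<noteq> (T ^^ t) y'"
    if s: "s \<in> S" "t \<in> S" "(T ^^ s) x \<noteq> (T ^^ t) y" and X: "x' \<in> X" "y' \<in> X" "dist x x' \<le> \<rho>/2" "dist y y' \<le> \<rho>/2"
    for s t x' y'
  proof
    assume eq: "(T ^^ s) x' = (T ^^ t) y'"
    have "dist ((T ^^ s) x) ((T ^^ s) x') < \<delta>" "dist ((T ^^ t) y) ((T ^^ t) y') < \<delta>"
      using \<rho> s X assms by auto
    then have "dist ((T ^^ s) x) ((T ^^ t) y) < 2 * \<delta>"
      using eq dist_triangle2[of "(T ^^ s) x" "(T ^^ t) y" "(T ^^ s) x'"] by simp
    moreover have "dist ((T ^^ s) x) ((T ^^ t) y) \<in> E" using s by (auto simp: E_def)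
    ultimately show False using E by fastforce
  qed
  note sep = this
  show ?thesis
  proof (rule that[of "\<rho>/2"])
    show "\<rho>/2 > 0" using \<rho>(1) by simp
  qed (rule sep)
qed

text \<open>A stratum: all its points have the same coincidences among their iterates, as holds for
  aperiodic points and for points of one exact period. A difference of a compact and a closed set is
  sigma-compact and has small compact relative neighbourhoods.\<close>

definition nice :: "'a set \<Rightarrow> nat \<Rightarrow> bool" where
  "nice A D \<longleftrightarrow> A \<subseteq> X \<and> (\<exists>C F. compact C \<and> closed F \<and> A = C - F) \<and>
    (\<forall>S \<delta>. finite S \<longrightarrow> \<delta> > 0 \<longrightarrow> (\<exists>(I :: 'a set set) \<phi>. fine_pou A D S \<delta> I \<phi>)) \<and>
    (\<forall>x\<in>A. \<forall>y\<in>A. \<forall>s t. (T ^^ s) x = (T ^^ t) x \<longrightarrow> (T ^^ s) y = (T ^^ t) y)"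

lemma nice_subset: "nice A D \<Longrightarrow> A \<subseteq> X"
  by (simp add: nice_def)

lemma nice_difference: "nice A D \<Longrightarrow> \<exists>C F. compact C \<and> closed F \<and> A = C - F"
  by (simp add: nice_def)

lemma nice_uniform:
  "nice A D \<Longrightarrow> x \<in> A \<Longrightarrow> y \<in> A \<Longrightarrow> (T ^^ s) x = (T ^^ t) x \<Longrightarrow> (T ^^ s) y = (T ^^ t) y"
  unfolding nice_def by blast

lemma nice_fine_pou_ex:
  "nice A D \<Longrightarrow> finite S \<Longrightarrow> \<delta> > 0 \<Longrightarrow> \<exists>(I :: 'a set set) \<phi>. fine_pou A D S \<delta> I \<phi>"
  by (simp add: nice_def)

lemma nice_sigma_compact: "nice A D \<Longrightarrow> sigma_compact A"
  using nice_difference[of A D] sigma_compact_diff by blast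

lemma fine_pou_choice:
  assumes "\<And>\<delta>. \<delta> > 0 \<Longrightarrow> \<exists>(I :: 'a set set) \<phi>. fine_pou A D S \<delta> I \<phi>"
  shows "\<exists>(I :: real \<Rightarrow> 'a set set) \<phi>. \<forall>\<delta>>0. fine_pou A D S \<delta> (I \<delta>) (\<phi> \<delta>)"
proof -
  have "\<forall>\<delta>. \<exists>I\<phi> :: 'a set set \<times> ('a set \<Rightarrow> 'a \<Rightarrow> real). \<delta> > 0 \<longrightarrow> fine_pou A D S \<delta> (fst I\<phi>) (snd I\<phi>)"
    using assms by auto
  from choice[OF this] obtain I\<phi> :: "real \<Rightarrow> 'a set set \<times> ('a set \<Rightarrow> 'a \<Rightarrow> real)"
    where "\<forall>\<delta>. \<delta> > 0 \<longrightarrow> fine_pou A D S \<delta> (fst (I\<phi> \<delta>)) (snd (I\<phi> \<delta>))" ..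
  then show ?thesis
    by (intro exI[of _ "\<lambda>\<delta>. fst (I\<phi> \<delta>)"] exI[of _ "\<lambda>\<delta>. snd (I\<phi> \<delta>)"]) blast
qed

lemma nice_fine_pou:
  assumes "nice A D" "finite S" "K \<subseteq> A"
  shows "\<exists>(I :: real \<Rightarrow> 'a set set) \<phi>. \<forall>\<delta>>0. fine_pou K D S \<delta> (I \<delta>) (\<phi> \<delta>)"
  using nice_fine_pou_ex[OF assms(1,2)] fine_pou_subset[OF _ assms(3)] by (intro fine_pou_choice) blast

text \<open>Near \<open>x\<close>, iterates at different times can meet only if they meet at
  \<open>x\<close> itself. Uniformity spreads that coincidence over the whole stratum, and
  injectivity then gives \<open>y = z\<close>.\<close>

lemma nice_local:
  assumes A: "nice A D" and x: "x \<in> A" and S: "finite S"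
  obtains r0 where "r0 > 0" "\<And>r. r \<le> r0 \<Longrightarrow> compact (A \<inter> cball x r)"
    "\<And>r s t y z. r \<le> r0 \<Longrightarrow> s \<in> S \<Longrightarrow> t \<in> S \<Longrightarrow> y \<in> A \<inter> cball x r \<Longrightarrow> z \<in> A \<inter> cball x r \<Longrightarrow>
      (T ^^ s) y = (T ^^ t) z \<Longrightarrow> (T ^^ s) x = (T ^^ t) x \<and> y = z \<and> (\<forall>w\<in>A. (T ^^ s) w = (T ^^ t) w)"
proof -
  have AX: "A \<subseteq> X" using A by (rule nice_subset)
  obtain C F where CF: "compact C" "closed F" "A = C - F" using nice_difference[OF A] by blast
  then have "open (- F)" "x \<in> - F" using x by auto
  then obtain e where e: "e > 0" "cball x e \<subseteq> - F" using open_contains_cball by blast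
  obtain q where q: "q > 0" "\<And>s t x' y'. s \<in> S \<Longrightarrow> t \<in> S \<Longrightarrow> (T ^^ s) x \<noteq> (T ^^ t) x \<Longrightarrow>
    x' \<in> X \<Longrightarrow> y' \<in> X \<Longrightarrow> dist x x' \<le> q \<Longrightarrow> dist x y' \<le> q \<Longrightarrow> (T ^^ s) x' \<noteq> (T ^^ t) y'"
    by (rule funpow_separation[OF S subsetD[OF AX x] subsetD[OF AX x]]) blast
  show ?thesis
  proof (rule that[of "min e q"])
    show "min e q > 0" using e q by simp
    fix r assume r: "r \<le> min e q"
    then have "cball x r \<subseteq> cball x e" by (intro subset_cball) simp
    then have "A \<inter> cball x r = C \<inter> cball x r" using e(2) CF(3) by blast
    then show "compact (A \<inter> cball x r)" using CF(1) by (simp add: compact_Int_closed)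
    fix s t y z assume s: "s \<in> S" "t \<in> S" and y: "y \<in> A \<inter> cball x r" "z \<in> A \<inter> cball x r" and eq: "(T ^^ s) y = (T ^^ t) z"
    have "(T ^^ s) x = (T ^^ t) x"
      using q(2)[OF s, of y z] y eq r AX by force
    moreover from this have w: "\<forall>w\<in>A. (T ^^ s) w = (T ^^ t) w" using nice_uniform[OF A x] by blast
    moreover have "y = z" using w y eq AX funpow_eqD[of s y z] by auto
    ultimately show "(T ^^ s) x = (T ^^ t) x \<and> y = z \<and> (\<forall>w\<in>A. (T ^^ s) w = (T ^^ t) w)" by blast
  qed
qed

text \<open>Conditions on the single pair \<open>(x, y)\<close> suffice because finitely many
  inequalities between iterates persist nearby. Distinct iterates are required of \<open>x\<close>
  only, so \<open>y\<close> may have a short period.\<close>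

lemma nice_pair_sigma_sep:
  assumes A: "nice A D" and B: "nice B D'" and x: "x \<in> A" "y \<in> B" and S: "finite S"
    and inj: "\<And>s t. s \<in> S \<Longrightarrow> t \<in> S \<Longrightarrow> (T ^^ s) x = (T ^^ t) x \<Longrightarrow> s = t"
    and disj: "\<And>s t. s \<in> S \<Longrightarrow> t \<in> S \<Longrightarrow> (T ^^ s) x \<noteq> (T ^^ t) y"
    and D: "D + D' < card S * CARD('d)"
  shows "\<exists>r>0. sigma_sep TYPE('d::finite) ((A \<times> B) \<inter> cball (x, y) r)"
proof -
  have AX: "A \<subseteq> X" "B \<subseteq> X" using nice_subset[OF A] nice_subset[OF B] by auto
  obtain r1 where r1: "r1 > 0" "\<And>r. r \<le> r1 \<Longrightarrow> compact (A \<inter> cball x r)"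
    "\<And>r s t y z. r \<le> r1 \<Longrightarrow> s \<in> S \<Longrightarrow> t \<in> S \<Longrightarrow> y \<in> A \<inter> cball x r \<Longrightarrow> z \<in> A \<inter> cball x r \<Longrightarrow>
      (T ^^ s) y = (T ^^ t) z \<Longrightarrow> (T ^^ s) x = (T ^^ t) x \<and> y = z \<and> (\<forall>w\<in>A. (T ^^ s) w = (T ^^ t) w)"
    by (rule nice_local[OF A x(1) S]) blast
  obtain r2 where r2: "r2 > 0" "\<And>r. r \<le> r2 \<Longrightarrow> compact (B \<inter> cball y r)"
    "\<And>r s t x z. r \<le> r2 \<Longrightarrow> s \<in> S \<Longrightarrow> t \<in> S \<Longrightarrow> x \<in> B \<inter> cball y r \<Longrightarrow> z \<in> B \<inter> cball y r \<Longrightarrow>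
      (T ^^ s) x = (T ^^ t) z \<Longrightarrow> (T ^^ s) y = (T ^^ t) y \<and> x = z \<and> (\<forall>w\<in>B. (T ^^ s) w = (T ^^ t) w)"
    by (rule nice_local[OF B x(2) S]) blast
  obtain r3 where r3: "r3 > 0" "\<And>s t x' y'. s \<in> S \<Longrightarrow> t \<in> S \<Longrightarrow> (T ^^ s) x \<noteq> (T ^^ t) y \<Longrightarrow>
    x' \<in> X \<Longrightarrow> y' \<in> X \<Longrightarrow> dist x x' \<le> r3 \<Longrightarrow> dist y y' \<le> r3 \<Longrightarrow> (T ^^ s) x' \<noteq> (T ^^ t) y'"
    by (rule funpow_separation[OF S subsetD[OF AX(1) x(1)] subsetD[OF AX(2) x(2)]]) blast
  define r where "r = min r1 (min r2 r3)"
  have r: "r > 0" "r \<le> r1" "r \<le> r2" "r \<le> r3" using r1(1) r2(1) r3(1) by (auto simp: r_def)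
  define K1 where "K1 = A \<inter> cball x r"
  define K2 where "K2 = B \<inter> cball y r"
  have "compact K1" "compact K2"
    using r1(2)[OF r(2)] r2(2)[OF r(3)] by (simp_all add: K1_def K2_def)
  moreover have "K1 \<subseteq> A" "K2 \<subseteq> B" by (auto simp: K1_def K2_def)
  ultimately have K: "compact K1" "K1 \<subseteq> X" "compact K2" "K2 \<subseteq> X" "K1 \<subseteq> A" "K2 \<subseteq> B"
    using AX by auto
  obtain I1 :: "real \<Rightarrow> 'a set set" and \<phi>1 where I1: "\<forall>\<delta>>0. fine_pou K1 D S \<delta> (I1 \<delta>) (\<phi>1 \<delta>)"
    using nice_fine_pou[OF A S K(5)] by blast
  obtain I2 :: "real \<Rightarrow> 'a set set" and \<phi>2 where I2: "\<forall>\<delta>>0. fine_pou K2 D' S \<delta> (I2 \<delta>) (\<phi>2 \<delta>)"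
    using nice_fine_pou[OF B S K(6)] by blast
  have "approximable (sep (K1 \<times> K2) :: ('a \<Rightarrow> real ^ 'd) \<Rightarrow> bool)"
  proof (rule approximable_sep_tame[OF K(1-4) S I1[rule_format] I2[rule_format] _ _ _ D])
    show "s = t" if "s \<in> S" "t \<in> S" "u \<in> K1" "v \<in> K1" "(T ^^ s) u = (T ^^ t) v" for s t u v
      using r1(3)[OF r(2), of s t u v] that inj by (auto simp: K1_def)
    show "u = v \<and> (\<forall>z\<in>K2. (T ^^ s) z = (T ^^ t) z)" if "s \<in> S" "t \<in> S" "u \<in> K2" "v \<in> K2" "(T ^^ s) u = (T ^^ t) v" for s t u v
      using r2(3)[OF r(3), of s t u v] that by (auto simp: K2_def)
    show "(T ^^ s) u \<noteq> (T ^^ t) v" if "s \<in> S" "t \<in> S" "u \<in> K1" "v \<in> K2" for s t u v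
      using r3(2)[OF that(1,2) disj[OF that(1,2)], of u v] that(3,4) r(4) subsetD[OF K(2)] subsetD[OF K(4)]
      by (auto simp: K1_def K2_def)
  qed
  note app = this
  have sub: "(A \<times> B) \<inter> cball (x, y) r \<subseteq> K1 \<times> K2"
    using cball_Pair_subset[of x y r] unfolding K1_def K2_def by blast
  have "K1 \<times> K2 \<subseteq> X \<times> X" using K(2,4) by blast
  from sigma_sep_compact[OF compact_Times[OF K(1,3)] this app sub] show ?thesis using r(1) by blast
qed

lemma nice_tame_cover:
  assumes A: "nice A D" and S: "finite S"
  obtains \<C> where "countable \<C>" "A \<subseteq> \<Union>\<C>" "\<And>C. C \<in> \<C> \<Longrightarrow> compact C \<and> C \<subseteq> A"
    "\<And>C s t x y. C \<in> \<C> \<Longrightarrow> s \<in> S \<Longrightarrow> t \<in> S \<Longrightarrow> x \<in> C \<Longrightarrow> y \<in> C \<Longrightarrow>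
        (T ^^ s) x = (T ^^ t) y \<Longrightarrow> x = y \<and> (\<forall>z\<in>C. (T ^^ s) z = (T ^^ t) z)"
proof -
  have "\<forall>x\<in>A. \<exists>r. r > 0 \<and> compact (A \<inter> cball x r) \<and>
     (\<forall>s\<in>S. \<forall>t\<in>S. \<forall>y\<in>A \<inter> cball x r. \<forall>z\<in>A \<inter> cball x r. (T ^^ s) y = (T ^^ t) z \<longrightarrow>
        y = z \<and> (\<forall>w\<in>A. (T ^^ s) w = (T ^^ t) w))"
  proof
    fix x assume x: "x \<in> A"
    show "\<exists>r. r > 0 \<and> compact (A \<inter> cball x r) \<and>
     (\<forall>s\<in>S. \<forall>t\<in>S. \<forall>y\<in>A \<inter> cball x r. \<forall>z\<in>A \<inter> cball x r. (T ^^ s) y = (T ^^ t) z \<longrightarrow>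
        y = z \<and> (\<forall>w\<in>A. (T ^^ s) w = (T ^^ t) w))"
      by (rule nice_local[OF A x S]) (meson order_refl)
  qed
  from bchoice[OF this] obtain r where r: "\<And>x. x \<in> A \<Longrightarrow> r x > 0" "\<And>x. x \<in> A \<Longrightarrow> compact (A \<inter> cball x (r x))"
    "\<And>x s t y z. x \<in> A \<Longrightarrow> s \<in> S \<Longrightarrow> t \<in> S \<Longrightarrow> y \<in> A \<inter> cball x (r x) \<Longrightarrow> z \<in> A \<inter> cball x (r x) \<Longrightarrow>
      (T ^^ s) y = (T ^^ t) z \<Longrightarrow> y = z \<and> (\<forall>w\<in>A. (T ^^ s) w = (T ^^ t) w)" by blast
  obtain C where C: "C \<subseteq> A" "countable C" "A \<subseteq> (\<Union>z\<in>C. cball z (r z))"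
    by (rule sigma_compact_ball_cover[OF nice_sigma_compact[OF A] r(1)])
  show ?thesis
  proof (rule that[of "(\<lambda>z. A \<inter> cball z (r z)) ` C"])
    show "countable ((\<lambda>z. A \<inter> cball z (r z)) ` C)" using C by simp
    show "A \<subseteq> \<Union>((\<lambda>z. A \<inter> cball z (r z)) ` C)" using C by blast
    fix K assume "K \<in> (\<lambda>z. A \<inter> cball z (r z)) ` C"
    then obtain z where z: "z \<in> A" "K = A \<inter> cball z (r z)" using C by blast
    show "compact K \<and> K \<subseteq> A" using z r(2) by blast
    fix s t x y assume a: "s \<in> S" "t \<in> S" "x \<in> K" "y \<in> K" "(T ^^ s) x = (T ^^ t) y"
    then show "x = y \<and> (\<forall>w\<in>K. (T ^^ s) w = (T ^^ t) w)"
      using r(3)[OF z(1), of s t x y] z(2) by blast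
  qed
qed

subsection \<open>Wandering and aperiodic points\<close>

lemma funpow_cancel:
  assumes "x \<in> X" "y \<in> X" "(T ^^ a) x = (T ^^ b) y" "a \<le> b"
  shows "x = (T ^^ (b - a)) y"
proof -
  have "(T ^^ a) x = (T ^^ a) ((T ^^ (b - a)) y)" using assms(3,4) by (simp add: funpow_funpow)
  then show ?thesis using funpow_eqD assms(1,2) funpow_in by blast
qed

lemma wandering_times:
  assumes U: "\<And>n y. n \<ge> 1 \<Longrightarrow> y \<in> X \<Longrightarrow> y \<in> U \<Longrightarrow> (T ^^ n) y \<notin> U"
    and x: "x \<in> X" "x \<in> U" "y \<in> X" "y \<in> U" and eq: "(T ^^ a) x = (T ^^ b) y"
  shows "a = b"
proof (rule ccontr)
  assume "a \<noteq> b"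
  then consider "a < b" | "b < a" by linarith
  then show False
  proof cases
    case 1
    then have "x = (T ^^ (b - a)) y" using funpow_cancel[OF x(1,3) eq] by simp
    then show False using U[of "b - a" y] x 1 by simp
  next
    case 2
    then have "y = (T ^^ (a - b)) x" using funpow_cancel[OF x(3,1) eq[symmetric]] by simp
    then show False using U[of "a - b" x] x 2 by simp
  qed
qed

text \<open>Nearby points of \<open>y\<close> may or may not lie on the orbit of a given neighbourhood of \<open>x\<close>, and they
  may do so for infinitely many times \<open>m\<close>.  Each \<open>m\<close> is treated separately, and the points that
  never visit form a compact set.\<close>

lemma sigma_sep_wandering_local:
  assumes N: "covering_dim_le (top_of_set (nonwandering X T)) (int N)" and M: "N + N < M * CARD('d)"
    and x: "x \<in> X" "x \<notin> nonwandering X T" and y: "y \<in> X" "y \<notin> nonwandering X T" and "x \<noteq> y"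
  shows "\<exists>r>0. sigma_sep TYPE('d::finite) ((X \<times> X) \<inter> cball (x, y) r)"
proof -
  obtain U1 where U1: "open U1" "x \<in> U1" "\<And>n y. n \<ge> 1 \<Longrightarrow> y \<in> X \<Longrightarrow> y \<in> U1 \<Longrightarrow> (T ^^ n) y \<notin> U1"
    by (rule wandering_nbhd[OF x]) blast
  obtain U2 where U2: "open U2" "y \<in> U2" "\<And>n z. n \<ge> 1 \<Longrightarrow> z \<in> X \<Longrightarrow> z \<in> U2 \<Longrightarrow> (T ^^ n) z \<notin> U2"
    by (rule wandering_nbhd[OF y]) blast
  obtain e1 where e1: "e1 > 0" "cball x e1 \<subseteq> U1" using U1(1,2) open_contains_cball by blast
  obtain e2 where e2: "e2 > 0" "cball y e2 \<subseteq> U2" using U2(1,2) open_contains_cball by blast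
  \<comment> \<open>The bound by a quarter of the distance makes \<open>K\<close> and
    \<open>K2\<close> disjoint, for otherwise the distance would be at most \<open>3 * r\<close>.
    Two radii around \<open>x\<close> are used so that an open set \<open>U\<close> fits between the
    compact sets \<open>V\<close> and \<open>K\<close>.\<close>
  define r where "r = min (e1 / 2) (min e2 (dist x y / 4))"
  have r: "r > 0" "2 * r \<le> e1" "r \<le> e2" "4 * r \<le> dist x y"
    using e1(1) e2(1) \<open>x \<noteq> y\<close> by (auto simp: r_def)
  define U where "U = ball x (2 * r)"
  define K where "K = X \<inter> cball x (2 * r)"
  define V where "V = X \<inter> cball x r"
  define K2 where "K2 = X \<inter> cball y r"
  have cpt: "compact K" "compact V" "compact K2" unfolding K_def V_def K2_def
    using compact_X by (simp_all add: compact_Int_closed)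
  have sub: "K \<subseteq> X" "V \<subseteq> X" "K2 \<subseteq> X" "V \<subseteq> X \<inter> U" "X \<inter> U \<subseteq> K"
    using r(1) by (auto simp: K_def V_def K2_def U_def)
  have KU: "K \<subseteq> U1" using e1(2) r(2) by (force simp: K_def)
  have VU: "V \<subseteq> U1" using sub KU by blast
  have K2U: "K2 \<subseteq> U2" using e2(2) r(3) by (force simp: K2_def)
  have disj: "z \<notin> K2" if "z \<in> K" for z
  proof
    assume "z \<in> K2"
    then have "dist x z \<le> 2 * r" "dist y z \<le> r" using that by (auto simp: K_def K2_def)
    then have "dist x y \<le> 3 * r" using dist_triangle2[of x y z] by linarith
    then show False using r by linarith
  qed
  have Vt: "u = v" if "q \<ge> 1" "z \<in> V" "z' \<in> V" "(T ^^ (q * u)) z = (T ^^ (q * v)) z'" for q u v z z'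
  proof -
    have "q * u = q * v"
      by (rule wandering_times[OF U1(3) _ _ _ _ that(4)]) (use that(2,3) sub VU in auto)
    then show ?thesis using that(1) by simp
  qed
  have K2t: "u = v" if "q \<ge> 1" "z \<in> K2" "z' \<in> K2" "(T ^^ (q * u)) z = (T ^^ (q * v)) z'" for q u v z z'
  proof -
    have "q * u = q * v"
      by (rule wandering_times[OF U2(3) _ _ _ _ that(4)]) (use that(2,3) sub K2U in auto)
    then show ?thesis using that(1) by simp
  qed
  have piece: "sigma_sep TYPE('d) (V \<times> Y)"
    if Y: "compact Y" "Y \<subseteq> K2" and q: "q \<ge> 1"
      and d: "\<And>u v z z'. z \<in> V \<Longrightarrow> z' \<in> Y \<Longrightarrow> (T ^^ (q * u)) z \<noteq> (T ^^ (q * v)) z'" for q Y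
  proof -
    have YX: "Y \<subseteq> X" using Y(2) sub(3) by blast
    have "approximable (sep (V \<times> Y) :: ('a \<Rightarrow> real ^ 'd) \<Rightarrow> bool)"
    proof (rule approximable_sep_wandering_wandering[OF N M q cpt(2) sub(2) Y(1) YX])
      show "u = v" if "z \<in> V" "z' \<in> V" "(T ^^ (q * u)) z = (T ^^ (q * v)) z'" for u v z z'
        using Vt[OF q that] .
      show "u = v" if "z \<in> Y" "z' \<in> Y" "(T ^^ (q * u)) z = (T ^^ (q * v)) z'" for u v z z'
        using K2t[OF q subsetD[OF Y(2) that(1)] subsetD[OF Y(2) that(2)] that(3)] .
    qed (rule d)
    then show ?thesis
      using sigma_sep_compact[OF compact_Times[OF cpt(2) Y(1)]] sub(2) YX by blast
  qed
  \<comment> \<open>\<open>A m\<close> contains the points reached from \<open>K\<close> after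
    \<open>m\<close> steps, \<open>B m\<close> those that reach \<open>K\<close> after
    \<open>m\<close> steps. On either set the meeting times differ by exactly \<open>m\<close>,
    which is never a difference of two multiples of \<open>m + 1\<close> when
    \<open>m \<ge> 1\<close>.\<close>
  define A where "A m = K2 \<inter> (T ^^ m) ` K" for m
  define B where "B m = {z \<in> K2. (T ^^ m) z \<in> K}" for m
  have A: "sigma_sep TYPE('d) (V \<times> A m)" if m: "m \<ge> 1" for m
  proof (rule piece)
    show "compact (A m)" unfolding A_def
      using cpt cont_funpow sub by (intro compact_Int compact_continuous_image) (auto intro: continuous_on_subset)
    show "A m \<subseteq> K2" by (auto simp: A_def)
    show "m + 1 \<ge> 1" by simp
    fix u v z z' assume z: "z \<in> V" "z' \<in> A m"
    show "(T ^^ ((m + 1) * u)) z \<noteq> (T ^^ ((m + 1) * v)) z'"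
    proof
      assume eq: "(T ^^ ((m + 1) * u)) z = (T ^^ ((m + 1) * v)) z'"
      obtain k where k: "k \<in> K" "z' = (T ^^ m) k" using z by (auto simp: A_def)
      have "(T ^^ ((m + 1) * u)) z = (T ^^ ((m + 1) * v + m)) k" using eq k by (simp only: funpow_funpow)
      then have "(m + 1) * u = (m + 1) * v + m"
        by (rule wandering_times[OF U1(3), rotated -1]) (use z k sub VU KU in auto)
      then have "(m + 1) dvd m" by (metis dvd_add_right_iff dvd_triv_left)
      then show False using m by (simp add: nat_dvd_not_less)
    qed
  qed
  have B: "sigma_sep TYPE('d) (V \<times> B m)" if m: "m \<ge> 1" for m
  proof (rule piece)
    have "closed (K2 \<inter> (T ^^ m) -` K)"
      by (rule continuous_closed_preimage[OF continuous_on_subset[OF cont_funpow sub(3)]])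
         (use cpt in \<open>auto intro: compact_imp_closed\<close>)
    moreover have "B m = K2 \<inter> (K2 \<inter> (T ^^ m) -` K)" by (auto simp: B_def)
    ultimately show "compact (B m)" using compact_Int_closed[OF cpt(3)] by (simp only:)
    show "B m \<subseteq> K2" by (auto simp: B_def)
    show "m + 1 \<ge> 1" by simp
    fix u v z z' assume z: "z \<in> V" "z' \<in> B m"
    show "(T ^^ ((m + 1) * u)) z \<noteq> (T ^^ ((m + 1) * v)) z'"
    proof
      assume eq: "(T ^^ ((m + 1) * u)) z = (T ^^ ((m + 1) * v)) z'"
      have k: "(T ^^ m) z' \<in> K" "z' \<in> X" using z sub by (auto simp: B_def)
      have "(T ^^ (m + (m + 1) * u)) z = (T ^^ (m + (m + 1) * v)) z'" using eq by (simp only: funpow_funpow[symmetric])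
      also have "\<dots> = (T ^^ ((m + 1) * v)) ((T ^^ m) z')" by (simp only: funpow_funpow add.commute)
      finally have "m + (m + 1) * u = (m + 1) * v"
        by (rule wandering_times[OF U1(3), rotated -1]) (use z k sub VU KU in auto)
      then have "(m + 1) dvd m" by (metis dvd_add_left_iff dvd_triv_left)
      then show False using m by (simp add: nat_dvd_not_less)
    qed
  qed
  have "\<forall>m. \<exists>W. open W \<and> X \<inter> W = (T ^^ m) ` (X \<inter> U)"
  proof
    fix m
    have "open U" by (simp add: U_def)
    from open_funpow_image[OF this, of m] show "\<exists>W. open W \<and> X \<inter> W = (T ^^ m) ` (X \<inter> U)" by metis
  qed
  from choice[OF this] obtain W where W: "\<And>m. open (W m)" "\<And>m. X \<inter> W m = (T ^^ m) ` (X \<inter> U)" by metis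
  have "\<forall>m. \<exists>G. open G \<and> G \<inter> X = (T ^^ m) -` U \<inter> X"
    using cont_funpow unfolding continuous_on_open_invariant by (simp add: U_def)
  from choice[OF this] obtain G where G: "\<And>m. open (G m)" "\<And>m. G m \<inter> X = (T ^^ m) -` U \<inter> X" by metis
  \<comment> \<open>Removing the open sets \<open>W m\<close> and \<open>G m\<close> for all
    \<open>m\<close> at once leaves a compact set whose orbits never meet those of \<open>V\<close>,
    so every time may be used, with \<open>q = 1\<close>. Each removed point lies in some
    \<open>A m\<close> or \<open>B m\<close>; there \<open>m\<close> is not 0, as \<open>K\<close>
    and \<open>K2\<close> are disjoint.\<close>
  define Y where "Y = K2 - (\<Union>m. W m) - (\<Union>m. G m)"
  have "sigma_sep TYPE('d) (V \<times> Y)"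
  proof (rule piece)
    show "compact Y" unfolding Y_def using cpt(3) W(1) G(1) by (intro compact_diff open_UN) auto
    show "Y \<subseteq> K2" by (auto simp: Y_def)
    show "(1::nat) \<ge> 1" by simp
    fix u v z z' assume z: "z \<in> V" "z' \<in> Y"
    show "(T ^^ (1 * u)) z \<noteq> (T ^^ (1 * v)) z'"
    proof
      assume "(T ^^ (1 * u)) z = (T ^^ (1 * v)) z'"
      then have eq: "(T ^^ u) z = (T ^^ v) z'" by simp
      have X: "z \<in> X" "z' \<in> X" "z \<in> U" using z sub by (auto simp: Y_def)
      have ny: "z' \<notin> W m" "z' \<notin> G m" for m using z by (auto simp: Y_def)
      show False
      proof (cases "u \<le> v")
        case True
        then have "z = (T ^^ (v - u)) z'" using funpow_cancel[OF X(1,2) eq] by simp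
        then have "z' \<in> G (v - u) \<inter> X" unfolding G(2) using X by simp
        then show False using ny by blast
      next
        case False
        then have "z' = (T ^^ (u - v)) z" using funpow_cancel[OF X(2,1) eq[symmetric]] by simp
        then have "z' \<in> X \<inter> W (u - v)" unfolding W(2) using X by blast
        then show False using ny by blast
      qed
    qed
  qed
  note Y = this
  have cover: "V \<times> K2 \<subseteq> (V \<times> Y \<union> (\<Union>m\<in>{1..}. V \<times> A m)) \<union> (\<Union>m\<in>{1..}. V \<times> B m)"
  proof safe
    fix z z' assume z: "z \<in> V" "z' \<in> K2" and nB: "(z, z') \<notin> (\<Union>m\<in>{1..}. V \<times> B m)"
      and nA: "(z, z') \<notin> (\<Union>m\<in>{1..}. V \<times> A m)"
    have nK: "z' \<notin> K" using z disj by blast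
    have z'X: "z' \<in> X" using z sub by blast
    have "z' \<notin> W m" for m
    proof
      assume "z' \<in> W m"
      then have "z' \<in> (T ^^ m) ` (X \<inter> U)" using W(2)[of m] z'X by blast
      then have *: "z' \<in> (T ^^ m) ` K" using sub(5) by blast
      then have "m \<noteq> 0" using nK by (cases m) auto
      then show False using nA z * by (auto simp: A_def)
    qed
    moreover have "z' \<notin> G m" for m
    proof
      assume "z' \<in> G m"
      then have "(T ^^ m) z' \<in> X \<inter> U" using G(2)[of m] z'X funpow_in by blast
      then have *: "(T ^^ m) z' \<in> K" using sub(5) by blast
      then have "m \<noteq> 0" using nK by (cases m) auto
      then show False using nB z * by (auto simp: B_def)
    qed
    ultimately show "z' \<in> Y" using z by (auto simp: Y_def)
  qed
  have "sigma_sep TYPE('d) (\<Union>m\<in>{1..}. V \<times> A m)" "sigma_sep TYPE('d) (\<Union>m\<in>{1..}. V \<times> B m)"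
    using A B by (auto intro: sigma_sep_UN)
  then have "sigma_sep TYPE('d) ((V \<times> Y \<union> (\<Union>m\<in>{1..}. V \<times> A m)) \<union> (\<Union>m\<in>{1..}. V \<times> B m))"
    using Y by (intro sigma_sep_Un)
  then have "sigma_sep TYPE('d) (V \<times> K2)" using cover by (rule sigma_sep_subset)
  moreover have "(X \<times> X) \<inter> cball (x, y) r \<subseteq> V \<times> K2"
    using cball_Pair_subset[of x y r] unfolding V_def K2_def by blast
  ultimately show ?thesis using r(1) sigma_sep_subset by blast
qed

lemma fine_pou_exists_subset:
  assumes "compact Y" "Y \<subseteq> X" "covering_dim_le (top_of_set Y) (int D)" "A \<subseteq> Y" "finite S" "\<delta> > 0"
  shows "\<exists>(I :: 'a set set) \<phi>. fine_pou A D S \<delta> I \<phi>"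
proof -
  obtain I :: "'a set set" and \<phi> where "fine_pou Y D S \<delta> I \<phi>"
    using fine_pou_exists[OF assms(1,2,3,5,6)] by blast
  then show ?thesis using fine_pou_subset assms(4) by blast
qed

lemma aperiodic_times:
  assumes "x \<in> X" "x \<notin> periodic_points X T" "(T ^^ s) x = (T ^^ t) x"
  shows "s = t"
proof (rule ccontr)
  assume "s \<noteq> t"
  then consider "s < t" | "t < s" by linarith
  then show False
  proof cases
    case 1
    then have "x = (T ^^ (t - s)) x" using funpow_cancel[OF assms(1,1,3)] by simp
    then show False using assms(1,2) 1 by (auto simp: periodic_points_def dest!: spec[of _ "t - s"])
  next
    case 2
    then have "x = (T ^^ (s - t)) x" using funpow_cancel[OF assms(1,1) assms(3)[symmetric]] by simp
    then show False using assms(1,2) 2 by (auto simp: periodic_points_def dest!: spec[of _ "s - t"])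
  qed
qed

text \<open>This is where closedness of the periodic set enters: it makes the aperiodic part a
  difference of a compact and a closed set. Its partitions of unity are restrictions from the
  nonwandering set.\<close>

lemma nice_aperiodic:
  assumes N: "covering_dim_le (top_of_set (nonwandering X T)) (int N)"
    and P: "closed (periodic_points X T)"
  shows "nice (nonwandering X T - periodic_points X T) N"
  unfolding nice_def
proof (intro conjI allI impI ballI)
  show "nonwandering X T - periodic_points X T \<subseteq> X" using nonwandering_subset by blast
  show "\<exists>C F. compact C \<and> closed F \<and> nonwandering X T - periodic_points X T = C - F"
    using compact_nonwandering P by blast
  show "\<exists>(I :: 'a set set) \<phi>. fine_pou (nonwandering X T - periodic_points X T) N S \<delta> I \<phi>"
    if "finite S" "\<delta> > 0" for S \<delta>
    using fine_pou_exists_subset[OF compact_nonwandering nonwandering_subset N _ that] by blast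
  fix x y s t assume x: "x \<in> nonwandering X T - periodic_points X T" and eq: "(T ^^ s) x = (T ^^ t) x"
  have "s = t" using aperiodic_times x eq nonwandering_subset by blast
  then show "(T ^^ s) y = (T ^^ t) y" by simp
qed

subsection \<open>Periodic points\<close>

lemma compact_periodic_points_le: "compact (periodic_points_le X T p)"
proof -
  have "compact {x\<in>X. dist ((T ^^ n) x) x = 0}" for n
  proof -
    have "closed {x\<in>X. dist ((T ^^ n) x) x = 0}"
      using compact_X cont_funpow
      by (intro continuous_closed_preimage_constant continuous_intros) (auto intro: compact_imp_closed)
    then have "compact (X \<inter> {x\<in>X. dist ((T ^^ n) x) x = 0})" by (rule compact_Int_closed[OF compact_X])
    moreover have "X \<inter> {x\<in>X. dist ((T ^^ n) x) x = 0} = {x\<in>X. dist ((T ^^ n) x) x = 0}" by blast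
    ultimately show ?thesis by (simp only:)
  qed
  then have "compact (\<Union>n\<in>{1..p}. {x\<in>X. dist ((T ^^ n) x) x = 0})" by (intro compact_UN) auto
  moreover have "(\<Union>n\<in>{1..p}. {x\<in>X. dist ((T ^^ n) x) x = 0}) = periodic_points_le X T p"
    by (auto simp: periodic_points_le_def)
  ultimately show ?thesis by (simp only:)
qed

lemma periodic_nonwandering: "periodic_points X T \<subseteq> nonwandering X T"
proof
  fix x assume "x \<in> periodic_points X T"
  then obtain n where n: "x \<in> X" "n \<ge> 1" "(T ^^ n) x = x" by (auto simp: periodic_points_def)
  then show "x \<in> nonwandering X T"
    unfolding nonwandering_iff by (auto intro!: exI[of _ n] bexI[of _ x])
qed

lemma periodic_le_subset: "periodic_points_le X T p \<subseteq> periodic_points X T"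
  by (auto simp: periodic_points_le_def periodic_points_def)

text \<open>At \<open>p = 0\<close> truncated subtraction makes the two sets equal, so the result is
  empty; at \<open>p = 1\<close> the subtracted set is empty and the fixed points remain.\<close>

definition exact_periodic :: "nat \<Rightarrow> 'a set" where
  "exact_periodic p = periodic_points_le X T p - periodic_points_le X T (p - 1)"

lemma exact_periodic_subset: "exact_periodic p \<subseteq> periodic_points X T" "exact_periodic p \<subseteq> X"
  using periodic_le_subset by (auto simp: exact_periodic_def periodic_points_le_def)

lemma exact_periodic_times:
  assumes "x \<in> exact_periodic p"
  shows "p \<ge> 1" "(T ^^ p) x = x" "(T ^^ s) x = (T ^^ t) x \<longleftrightarrow> s mod p = t mod p"
proof -
  have x: "x \<in> X" using assms exact_periodic_subset by blast
  obtain n where n: "n \<in> {1..p}" "(T ^^ n) x = x"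
    using assms by (auto simp: exact_periodic_def periodic_points_le_def)
  have no: "(T ^^ k) x \<noteq> x" if "1 \<le> k" "k < p" for k
    using assms that x by (auto simp: exact_periodic_def periodic_points_le_def)
  have "n = p" using no[of n] n by (metis atLeastAtMost_iff le_neq_implies_less)
  then show p: "p \<ge> 1" "(T ^^ p) x = x" using n by auto
  have mod: "(T ^^ (k mod p)) x = (T ^^ k) x" for k using p(2) by (rule funpow_mod_eq)
  have inj: "a = b" if "(T ^^ a) x = (T ^^ b) x" "a < p" "b < p" "a \<le> b" for a b
  proof (rule ccontr)
    assume "a \<noteq> b"
    then have "1 \<le> b - a" "b - a < p" using that by auto
    moreover have "x = (T ^^ (b - a)) x" using funpow_cancel[OF x x that(1,4)] .
    ultimately show False using no[of "b - a"] by simp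
  qed
  show "(T ^^ s) x = (T ^^ t) x \<longleftrightarrow> s mod p = t mod p"
  proof
    assume "(T ^^ s) x = (T ^^ t) x"
    then have eq: "(T ^^ (s mod p)) x = (T ^^ (t mod p)) x" by (simp only: mod)
    have lt: "s mod p < p" "t mod p < p" using p(1) by auto
    show "s mod p = t mod p"
      using inj[OF eq lt] inj[OF eq[symmetric] lt(2,1)] by (metis nat_le_linear)
  next
    assume "s mod p = t mod p"
    then show "(T ^^ s) x = (T ^^ t) x" by (metis mod)
  qed
qed

lemma periodic_exact:
  assumes "x \<in> periodic_points X T"
  obtains p where "p \<ge> 1" "x \<in> exact_periodic p"
proof -
  obtain n where n: "x \<in> X" "n \<ge> 1" "(T ^^ n) x = x" using assms by (auto simp: periodic_points_def)
  define p where "p = (LEAST p. x \<in> periodic_points_le X T p)"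
  have ex: "x \<in> periodic_points_le X T n" using n by (auto simp: periodic_points_le_def)
  then have xp: "x \<in> periodic_points_le X T p" unfolding p_def by (rule LeastI)
  then have p1: "p \<ge> 1" by (auto simp: periodic_points_le_def)
  then have "x \<notin> periodic_points_le X T (p - 1)"
    using not_less_Least[of "p - 1" "\<lambda>p. x \<in> periodic_points_le X T p"] unfolding p_def[symmetric] by simp
  then show ?thesis using that p1 xp by (simp add: exact_periodic_def)
qed

text \<open>\<open>Y\<close> is left open for two uses: the nonwandering set gives the crude order
  \<open>N\<close>, sufficient against aperiodic and wandering points, and the points of period at
  most \<open>p\<close> give the sharp order needed among periodic points.\<close>

lemma nice_periodic:
  assumes Y: "compact Y" "Y \<subseteq> X" "covering_dim_le (top_of_set Y) (int D)" and p: "periodic_points_le X T p \<subseteq> Y"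
  shows "nice (exact_periodic p) D"
  unfolding nice_def
proof (intro conjI allI impI ballI)
  show "exact_periodic p \<subseteq> X" by (rule exact_periodic_subset)
  show "\<exists>C F. compact C \<and> closed F \<and> exact_periodic p = C - F"
    unfolding exact_periodic_def using compact_periodic_points_le compact_imp_closed by blast
  have "exact_periodic p \<subseteq> Y" using p by (auto simp: exact_periodic_def)
  then show "\<exists>(I :: 'a set set) \<phi>. fine_pou (exact_periodic p) D S \<delta> I \<phi>" if "finite S" "\<delta> > 0" for S \<delta>
    using fine_pou_exists_subset[OF Y _ that] by blast
  fix x y s t assume x: "x \<in> exact_periodic p" "y \<in> exact_periodic p" and eq: "(T ^^ s) x = (T ^^ t) x"
  then show "(T ^^ s) y = (T ^^ t) y"
    using exact_periodic_times(3)[OF x(1)] exact_periodic_times(3)[OF x(2)] by blast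
qed

text \<open>A point of exact period \<open>p\<close> is separated from its \<open>m\<close>-th iterate unless its itinerary is
  invariant under the shift by \<open>gcd m p\<close>; this describes a subspace of codimension at least half.\<close>

lemma sigma_sep_orbit_graph:
  assumes A: "nice (exact_periodic p) D" and m: "0 < m" "m < p" and D: "2 * D < p * CARD('d)"
  shows "sigma_sep TYPE('d::finite) ((\<lambda>x. (x, (T ^^ m) x)) ` exact_periodic p)"
proof (rule sigma_sep_local)
  let ?E = "exact_periodic p"
  have cont: "continuous_on X (\<lambda>x. (x, (T ^^ m) x))" by (intro continuous_intros cont_funpow)
  show "sigma_compact ((\<lambda>x. (x, (T ^^ m) x)) ` ?E)"
    by (rule sigma_compact_image[OF nice_sigma_compact[OF A] continuous_on_subset[OF cont exact_periodic_subset(2)]])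
  fix z assume "z \<in> (\<lambda>x. (x, (T ^^ m) x)) ` ?E"
  then obtain x where x: "x \<in> ?E" "z = (x, (T ^^ m) x)" by blast
  define U where "U = {..<p}"
  define g where "g = gcd m p"
  \<comment> \<open>Invariance of the itinerary under the shift by \<open>g\<close> amounts to
    \<open>p - g\<close> equations: the value at each \<open>s\<close> from \<open>g\<close> on
    equals that at \<open>s mod g\<close>.\<close>
  define S where "S = {g..<p}"
  obtain r where r: "r > 0" "\<And>r'. r' \<le> r \<Longrightarrow> compact (?E \<inter> cball x r')"
    "\<And>r' s t y z. r' \<le> r \<Longrightarrow> s \<in> U \<Longrightarrow> t \<in> U \<Longrightarrow> y \<in> ?E \<inter> cball x r' \<Longrightarrow> z \<in> ?E \<inter> cball x r' \<Longrightarrow>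
      (T ^^ s) y = (T ^^ t) z \<Longrightarrow> (T ^^ s) x = (T ^^ t) x \<and> y = z \<and> (\<forall>w\<in>?E. (T ^^ s) w = (T ^^ t) w)"
    by (rule nice_local[OF A x(1), of U]) (simp add: U_def, blast)
  define K where "K = ?E \<inter> cball x r"
  have cK: "compact K" and KE: "K \<subseteq> ?E" using r(2)[of r] by (auto simp: K_def)
  have KX: "K \<subseteq> X" using KE exact_periodic_subset by blast
  have finU: "finite U" by (simp add: U_def)
  obtain I :: "real \<Rightarrow> 'a set set" and \<phi> where I: "\<forall>\<delta>>0. fine_pou K D U \<delta> (I \<delta>) (\<phi> \<delta>)"
    using nice_fine_pou[OF A finU KE] by blast
  have g: "g > 0" "g dvd m" "g dvd p" "g \<le> m" using m by (auto simp: g_def intro: gcd_le1_nat)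
  \<comment> \<open>A proper divisor is at most half of \<open>p\<close>, which turns
    \<open>2 * D < p * CARD('d)\<close> into the bound required for \<open>p - g\<close>
    comparisons.\<close>
  have "2 * g \<le> p"
  proof -
    obtain k where k: "p = g * k" using g(3) by blast
    have "g < p" using g(4) m(2) by linarith
    then have "k \<noteq> 0" "k \<noteq> 1" using k by auto
    then have "2 \<le> k" by linarith
    then show ?thesis using k by (metis mult.commute mult_le_mono2)
  qed
  then have "p \<le> 2 * (p - g)" by linarith
  then have "2 * D < 2 * (p - g) * CARD('d)" using D by (meson less_le_trans mult_le_mono1)
  then have Dg: "D < card S * CARD('d)" by (simp add: S_def)
  have "approximable (\<lambda>f :: 'a \<Rightarrow> real ^ 'd. \<forall>x\<in>K. \<exists>s\<in>S. f ((T ^^ s) x) \<noteq> f ((T ^^ (s mod g)) x))"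
  proof (rule approximable_diagonal[OF _ _ finU _ cK KX I[rule_format] _ Dg])
    show "finite S" "S \<subseteq> U" by (auto simp: S_def U_def)
    show "s mod g \<in> U - S" if "s \<in> S" for s
    proof -
      have "s mod g < g" using g(1) by simp
      then show ?thesis using g(4) m(2) by (simp add: S_def U_def)
    qed
    show "s = t \<and> y = y'" if "s \<in> U" "t \<in> U" "y \<in> K" "y' \<in> K" "(T ^^ s) y = (T ^^ t) y'" for s t y y'
    proof -
      have *: "(T ^^ s) x = (T ^^ t) x \<and> y = y'"
        using r(3)[of r s t y y'] that by (auto simp: K_def)
      then have "s mod p = t mod p" using exact_periodic_times(3)[OF x(1)] by blast
      then show ?thesis using * that(1,2) by (simp add: U_def)
    qed
  qed
  then have app: "approximable (sep ((\<lambda>x. (x, (T ^^ m) x)) ` K) :: ('a \<Rightarrow> real ^ 'd) \<Rightarrow> bool)"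
  proof (rule approximable_mono)
    fix f :: "'a \<Rightarrow> real ^ 'd" assume f: "\<forall>x\<in>K. \<exists>s\<in>S. f ((T ^^ s) x) \<noteq> f ((T ^^ (s mod g)) x)"
    have "\<exists>n. f ((T ^^ n) y) \<noteq> f ((T ^^ n) ((T ^^ m) y))" if y: "y \<in> K" for y
    proof (rule ccontr)
      assume "\<not> ?thesis"
      then have shift: "f ((T ^^ n) y) = f ((T ^^ (n + m)) y)" for n by (simp add: funpow_funpow)
      have shifts: "f ((T ^^ n) y) = f ((T ^^ (n + k * m)) y)" for n k
      proof (induction k)
        case (Suc k)
        then show ?case using shift[of "n + k * m"] by (simp add: add.commute add.left_commute)
      qed simp
      \<comment> \<open>Equal itineraries give invariance under the shift by \<open>m\<close>,
        periodicity gives it under the shift by \<open>p\<close>; by Bezout it then holds for the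
        shift by \<open>g\<close>, against the choice of \<open>f\<close>.\<close>
      obtain a b where ab: "m * a = p * b + g" unfolding g_def using m(1) bezout_nat[of m p] by blast
      have yE: "y \<in> ?E" using y KE by blast
      have gshift: "f ((T ^^ n) y) = f ((T ^^ (n + g)) y)" for n
      proof -
        have "(n + a * m) mod p = (n + g) mod p" using ab by (metis add.left_commute mod_mult_self4 mult.commute)
        then have "(T ^^ (n + a * m)) y = (T ^^ (n + g)) y" using exact_periodic_times(3)[OF yE] by blast
        then show ?thesis using shifts[of n a] by simp
      qed
      have "f ((T ^^ n) y) = f ((T ^^ (n + k * g)) y)" for n k
      proof (induction k)
        case (Suc k)
        then show ?case using gshift[of "n + k * g"] by (simp add: add.commute add.left_commute)
      qed simp
      from this[of "s mod g" "s div g" for s]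
      have "f ((T ^^ (s mod g)) y) = f ((T ^^ s) y)" for s by (simp add: add.commute)
      then show False using f y by metis
    qed
    then show "sep ((\<lambda>x. (x, (T ^^ m) x)) ` K) f" by (auto simp: sep_def)
  qed
  have comp: "compact ((\<lambda>x. (x, (T ^^ m) x)) ` K)"
    by (rule compact_continuous_image[OF continuous_on_subset[OF cont KX] cK])
  have sub: "(\<lambda>x. (x, (T ^^ m) x)) ` K \<subseteq> X \<times> X" using KX funpow_in by blast
  have "(\<lambda>x. (x, (T ^^ m) x)) ` ?E \<inter> cball z r \<subseteq> (\<lambda>x. (x, (T ^^ m) x)) ` K"
    using cball_Pair_subset[of x "(T ^^ m) x" r] unfolding x(2) K_def by blast
  from sigma_sep_compact[OF comp sub app this]
  show "\<exists>r>0. sigma_sep TYPE('d) ((\<lambda>x. (x, (T ^^ m) x)) ` ?E \<inter> cball z r)" using r(1) by blast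
qed

end

text \<open>Points without period offer as many distinct times as desired, so
  \<open>Suc (N + N)\<close> of them suffice whatever the dimension of the cube is.\<close>

lemma double_less_Suc_mult_card: "N + N < Suc (N + N) * CARD('d::finite)"
  by (metis One_nat_def Suc_leI lessI less_le_trans mult.right_neutral mult_le_mono2 zero_less_card_finite)

section \<open>Classes of pairs off the diagonal\<close>

context compact_system
begin

lemma sigma_compact_wandering: "sigma_compact (X - nonwandering X T)"
  by (rule sigma_compact_diff[OF compact_X compact_imp_closed[OF compact_nonwandering]])

lemma compact_diagonal: "compact ((\<lambda>x. (x, x)) ` X)"
  by (rule compact_continuous_image[OF _ compact_X]) (intro continuous_intros)

lemma sigma_sep_wandering_off_diagonal:
  assumes N: "covering_dim_le (top_of_set (nonwandering X T)) (int N)"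
  shows "sigma_sep TYPE('d::finite) ((X - nonwandering X T) \<times> (X - nonwandering X T) - (\<lambda>x. (x, x)) ` X)"
proof (rule sigma_sep_local)
  let ?W = "X - nonwandering X T"
  show "sigma_compact (?W \<times> ?W - (\<lambda>x. (x, x)) ` X)"
    by (intro sigma_compact_Diff_closed sigma_compact_Times sigma_compact_wandering
        compact_imp_closed compact_diagonal)
  fix z assume z: "z \<in> ?W \<times> ?W - (\<lambda>x. (x, x)) ` X"
  then obtain x y where xy: "z = (x, y)" "x \<in> X" "x \<notin> nonwandering X T" "y \<in> X" "y \<notin> nonwandering X T" "x \<noteq> y"
    by blast
  have M: "N + N < Suc (N + N) * CARD('d)" by (rule double_less_Suc_mult_card)
  obtain r where r: "r > 0" "sigma_sep TYPE('d) ((X \<times> X) \<inter> cball z r)"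
    using sigma_sep_wandering_local[OF N M xy(2-6)] unfolding xy(1) by blast
  have "sigma_sep TYPE('d) ((?W \<times> ?W - (\<lambda>x. (x, x)) ` X) \<inter> cball z r)"
    by (rule sigma_sep_subset[OF r(2)]) blast
  then show "\<exists>r>0. sigma_sep TYPE('d) ((?W \<times> ?W - (\<lambda>x. (x, x)) ` X) \<inter> cball z r)" using r(1) by blast
qed

lemma sigma_sep_wandering_nonwandering:
  assumes N: "covering_dim_le (top_of_set (nonwandering X T)) (int N)"
    and P: "closed (periodic_points X T)"
  shows "sigma_sep TYPE('d::finite) ((X - nonwandering X T) \<times> nonwandering X T)"
proof (rule sigma_sep_local)
  let ?O = "nonwandering X T"
  show "sigma_compact ((X - ?O) \<times> ?O)"
    by (intro sigma_compact_Times sigma_compact_wandering sigma_compact_compact compact_nonwandering)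
  fix z assume "z \<in> (X - ?O) \<times> ?O"
  then obtain x y where xy: "z = (x, y)" "x \<in> X" "x \<notin> ?O" "y \<in> ?O" by blast
  define M where "M = Suc (N + N)"
  have M: "N + N < M * CARD('d)" unfolding M_def by (rule double_less_Suc_mult_card)
  obtain U where U: "open U" "x \<in> U" "\<And>n y. n \<ge> 1 \<Longrightarrow> y \<in> X \<Longrightarrow> y \<in> U \<Longrightarrow> (T ^^ n) y \<notin> U"
    by (rule wandering_nbhd[OF xy(2,3)]) blast
  obtain r where r: "r > 0" "cball x r \<subseteq> U" using U(1,2) open_contains_cball by blast
  define K where "K = X \<inter> cball x r"
  have K: "compact K" "K \<subseteq> X" "K \<subseteq> U" using compact_X r(2) by (auto simp: K_def compact_Int_closed)
  have KO: "K \<inter> ?O = {}"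
  proof (rule ccontr)
    assume "K \<inter> ?O \<noteq> {}"
    then obtain k where "k \<in> ?O" "k \<in> U" using K by blast
    then obtain n v where "n \<ge> 1" "v \<in> X \<inter> U" "(T ^^ n) v \<in> U" using U(1) unfolding nonwandering_iff by blast
    then show False using U(3) by blast
  qed
  \<comment> \<open>On each stratum coincidences of iterates are uniform, so small compact pieces
    are tame. The nonwandering set as a whole need not have such a cover by neighbourhoods, but a
    countable cover by pieces of strata is enough for Baire.\<close>
  define \<A> where "\<A> = insert (?O - periodic_points X T) (range exact_periodic)"
  have nice: "nice A N" if "A \<in> \<A>" for A
  proof -
    have "nice (exact_periodic p) N" for p
      by (rule nice_periodic[OF compact_nonwandering nonwandering_subset N])
         (use periodic_le_subset periodic_nonwandering in blast)
    then show ?thesis using that nice_aperiodic[OF N P] by (auto simp: \<A>_def)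
  qed
  have "\<forall>A\<in>\<A>. \<exists>\<C>. countable \<C> \<and> A \<subseteq> \<Union>\<C> \<and> (\<forall>C\<in>\<C>. compact C \<and> C \<subseteq> A \<and>
     (\<forall>s<M. \<forall>t<M. \<forall>x\<in>C. \<forall>y\<in>C. (T ^^ s) x = (T ^^ t) y \<longrightarrow> x = y \<and> (\<forall>z\<in>C. (T ^^ s) z = (T ^^ t) z)))"
  proof
    fix A assume "A \<in> \<A>"
    from nice[OF this] obtain \<C> where C: "countable \<C>" "A \<subseteq> \<Union>\<C>" "\<And>C. C \<in> \<C> \<Longrightarrow> compact C \<and> C \<subseteq> A"
      "\<And>C s t x y. C \<in> \<C> \<Longrightarrow> s \<in> {..<M} \<Longrightarrow> t \<in> {..<M} \<Longrightarrow> x \<in> C \<Longrightarrow> y \<in> C \<Longrightarrow>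
        (T ^^ s) x = (T ^^ t) y \<Longrightarrow> x = y \<and> (\<forall>z\<in>C. (T ^^ s) z = (T ^^ t) z)"
      by (rule nice_tame_cover[where S = "{..<M}"]) (simp, blast)
    show "\<exists>\<C>. countable \<C> \<and> A \<subseteq> \<Union>\<C> \<and> (\<forall>C\<in>\<C>. compact C \<and> C \<subseteq> A \<and>
     (\<forall>s<M. \<forall>t<M. \<forall>x\<in>C. \<forall>y\<in>C. (T ^^ s) x = (T ^^ t) y \<longrightarrow> x = y \<and> (\<forall>z\<in>C. (T ^^ s) z = (T ^^ t) z)))"
    proof (intro exI[of _ \<C>] conjI ballI allI impI C(1,2))
      fix C assume CC: "C \<in> \<C>"
      show "compact C" "C \<subseteq> A" using C(3)[OF CC] by auto
      fix s t x y assume a: "s < M" "t < M" "x \<in> C" "y \<in> C" "(T ^^ s) x = (T ^^ t) y"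
      have st: "s \<in> {..<M}" "t \<in> {..<M}" using a by auto
      show "x = y" using C(4)[OF CC st a(3-5)] by blast
      show "(T ^^ s) z = (T ^^ t) z" if "z \<in> C" for z using C(4)[OF CC st a(3-5)] that by blast
    qed
  qed
  from bchoice[OF this] obtain \<C> where \<C>: "\<forall>A\<in>\<A>. countable (\<C> A) \<and> A \<subseteq> \<Union>(\<C> A) \<and> (\<forall>C\<in>\<C> A. compact C \<and> C \<subseteq> A \<and>
     (\<forall>s<M. \<forall>t<M. \<forall>x\<in>C. \<forall>y\<in>C. (T ^^ s) x = (T ^^ t) y \<longrightarrow> x = y \<and> (\<forall>z\<in>C. (T ^^ s) z = (T ^^ t) z)))" ..
  define CC where "CC = (\<Union>A\<in>\<A>. \<C> A)"
  have CC1: "countable CC" unfolding CC_def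
  proof (rule countable_UN)
    show "countable \<A>" by (simp add: \<A>_def)
    show "countable (\<C> A)" if "A \<in> \<A>" for A using bspec[OF \<C> that] by blast
  qed
  have CC2: "?O \<subseteq> \<Union>CC"
  proof
    fix w assume w: "w \<in> ?O"
    have "\<exists>A\<in>\<A>. w \<in> A"
    proof (cases "w \<in> periodic_points X T")
      case True
      then obtain p where "w \<in> exact_periodic p" by (rule periodic_exact)
      then show ?thesis by (auto simp: \<A>_def)
    qed (use w in \<open>auto simp: \<A>_def\<close>)
    then obtain A where A: "A \<in> \<A>" "w \<in> A" by blast
    then have "w \<in> \<Union>(\<C> A)" using bspec[OF \<C> A(1)] by blast
    then show "w \<in> \<Union>CC" using A(1) unfolding CC_def by blast
  qed
  have AO: "A \<subseteq> ?O" if "A \<in> \<A>" for A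
    using that exact_periodic_subset(1) periodic_nonwandering unfolding \<A>_def by blast
  have CC3: "compact C \<and> C \<subseteq> ?O" if C: "C \<in> CC" for C
  proof -
    obtain A where A: "A \<in> \<A>" "C \<in> \<C> A" using C unfolding CC_def by blast
    have "compact C \<and> C \<subseteq> A"
      using bspec[OF conjunct2[OF conjunct2[OF bspec[OF \<C> A(1)]]] A(2)] by (simp only: simp_thms)
    then show ?thesis using AO[OF A(1)] by blast
  qed
  have CC4: "u = v \<and> (\<forall>z\<in>C. (T ^^ s) z = (T ^^ t) z)"
    if C: "C \<in> CC" and st: "s < M" "t < M" "u \<in> C" "v \<in> C" "(T ^^ s) u = (T ^^ t) v" for C s t u v
  proof -
    obtain A where A: "A \<in> \<A>" "C \<in> \<C> A" using C unfolding CC_def by blast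
    have "\<forall>s<M. \<forall>t<M. \<forall>x\<in>C. \<forall>y\<in>C. (T ^^ s) x = (T ^^ t) y \<longrightarrow> x = y \<and> (\<forall>z\<in>C. (T ^^ s) z = (T ^^ t) z)"
      by (rule conjunct2[OF conjunct2[OF bspec[OF conjunct2[OF conjunct2[OF bspec[OF \<C> A(1)]]] A(2)]]])
    then show ?thesis using st by blast
  qed
  have "\<exists>(I :: 'a set set) \<phi>. fine_pou ?O N {..<M} \<delta> I \<phi>" if "\<delta> > 0" for \<delta>
    using fine_pou_exists_subset[OF compact_nonwandering nonwandering_subset N order_refl _ that, of "{..<M}"] by simp
  from fine_pou_choice[OF this] obtain I :: "real \<Rightarrow> 'a set set" and \<phi> where I: "\<forall>\<delta>>0. fine_pou ?O N {..<M} \<delta> (I \<delta>) (\<phi> \<delta>)"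
    by blast
  have "approximable (sep (K \<times> ?O) :: ('a \<Rightarrow> real ^ 'd) \<Rightarrow> bool)"
  proof (rule approximable_sep_wandering_nonwandering[OF N M K(1,2) _ KO CC1 CC2 CC3 _ CC4,
        where I = "\<lambda>_. I" and \<psi> = "\<lambda>_. \<phi>"])
    show "u = v" if "x \<in> K" "y \<in> K" "(T ^^ u) x = (T ^^ v) y" for u v x y
      by (rule wandering_times[OF U(3) _ _ _ _ that(3)]) (use that K in auto)
    show "fine_pou C N {..<M} \<delta> (I \<delta>) (\<phi> \<delta>)" if "C \<in> CC" "\<delta> > 0" for C \<delta>
      using fine_pou_subset[OF I[rule_format, OF that(2)]] CC3[OF that(1)] by blast
  qed
  moreover have "((X - ?O) \<times> ?O) \<inter> cball z r \<subseteq> K \<times> ?O"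
    using cball_Pair_subset[of x y r] unfolding xy(1) K_def by blast
  moreover have "K \<times> ?O \<subseteq> X \<times> X" using K(2) nonwandering_subset by blast
  ultimately have "sigma_sep TYPE('d) (((X - ?O) \<times> ?O) \<inter> cball z r)"
    by (intro sigma_sep_compact[OF compact_Times[OF K(1) compact_nonwandering]])
  then show "\<exists>r>0. sigma_sep TYPE('d) (((X - ?O) \<times> ?O) \<inter> cball z r)" using r(1) by blast
qed

lemma sigma_sep_aperiodic_off_diagonal:
  assumes N: "covering_dim_le (top_of_set (nonwandering X T)) (int N)"
    and P: "closed (periodic_points X T)"
  defines "A \<equiv> nonwandering X T - periodic_points X T"
  shows "sigma_sep TYPE('d::finite) (A \<times> A - (\<lambda>x. (x, x)) ` X)"
proof (rule sigma_sep_local)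
  have A: "nice A N" unfolding A_def by (rule nice_aperiodic[OF N P])
  show "sigma_compact (A \<times> A - (\<lambda>x. (x, x)) ` X)"
    by (intro sigma_compact_Diff_closed sigma_compact_Times nice_sigma_compact[OF A]
        compact_imp_closed compact_diagonal)
  fix z assume "z \<in> A \<times> A - (\<lambda>x. (x, x)) ` X"
  then obtain x y where xy: "z = (x, y)" "x \<in> A" "y \<in> A" "x \<noteq> y"
    using nice_subset[OF A] by blast
  have X: "x \<in> X" "y \<in> X" using xy nice_subset[OF A] by auto
  have at: "s = t" if "(T ^^ s) w = (T ^^ t) w" "w \<in> A" for s t w
    using aperiodic_times[OF _ _ that(1)] that(2) nice_subset[OF A] by (auto simp: A_def)
  define M where "M = Suc (N + N)"
  have M: "N + N < M * CARD('d)" unfolding M_def by (rule double_less_Suc_mult_card)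
  \<comment> \<open>If one point is the \<open>m\<close>-th iterate of the other, then sampling at
    multiples of \<open>m + 1\<close> avoids every coincidence; if neither is an iterate of the
    other, then all times are free.\<close>
  have "\<exists>q\<ge>1. \<forall>s t. (T ^^ (q * s)) x \<noteq> (T ^^ (q * t)) y"
  proof (cases "\<exists>m. x = (T ^^ m) y \<or> y = (T ^^ m) x")
    case True
    then obtain m where m: "x = (T ^^ m) y \<or> y = (T ^^ m) x" by blast
    have "m \<noteq> 0" using m xy(4) by (cases m) auto
    then have nd: "\<not> (m + 1) dvd m" by (simp add: nat_dvd_not_less)
    have "(T ^^ ((m + 1) * s)) x \<noteq> (T ^^ ((m + 1) * t)) y" for s t
    proof
      assume eq: "(T ^^ ((m + 1) * s)) x = (T ^^ ((m + 1) * t)) y"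
      show False using m
      proof
        assume "x = (T ^^ m) y"
        then have "(T ^^ ((m + 1) * s + m)) y = (T ^^ ((m + 1) * t)) y" using eq by (simp only: funpow_funpow)
        from at[OF this xy(3)] have "(m + 1) dvd m" by (metis dvd_add_right_iff dvd_triv_left)
        then show False using nd by blast
      next
        assume "y = (T ^^ m) x"
        then have "(T ^^ ((m + 1) * t + m)) x = (T ^^ ((m + 1) * s)) x" using eq by (simp only: funpow_funpow)
        from at[OF this xy(2)] have "(m + 1) dvd m" by (metis dvd_add_right_iff dvd_triv_left)
        then show False using nd by blast
      qed
    qed
    then show ?thesis by (intro exI[of _ "m + 1"]) auto
  next
    case False
    have "(T ^^ (1 * s)) x \<noteq> (T ^^ (1 * t)) y" for s t
    proof
      assume "(T ^^ (1 * s)) x = (T ^^ (1 * t)) y"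
      then have eq: "(T ^^ s) x = (T ^^ t) y" by simp
      show False
      proof (cases "s \<le> t")
        case True
        then show False using funpow_cancel[OF X eq] False \<open>\<nexists>m. x = (T ^^ m) y \<or> y = (T ^^ m) x\<close> by blast
      next
        case False
        then have "t \<le> s" by simp
        then show False using funpow_cancel[OF X(2,1) eq[symmetric]] \<open>\<nexists>m. x = (T ^^ m) y \<or> y = (T ^^ m) x\<close> by blast
      qed
    qed
    then show ?thesis by blast
  qed
  then obtain q where q: "q \<ge> 1" "\<And>s t. (T ^^ (q * s)) x \<noteq> (T ^^ (q * t)) y" by blast
  define S where "S = (\<lambda>s. q * s) ` {..<M}"
  have S: "finite S" "card S = M" using q(1) by (auto simp: S_def card_image inj_on_def)
  have "\<exists>r>0. sigma_sep TYPE('d) ((A \<times> A) \<inter> cball (x, y) r)"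
  proof (rule nice_pair_sigma_sep[OF A A xy(2,3) S(1)])
    show "s = t" if "(T ^^ s) x = (T ^^ t) x" for s t using at[OF that xy(2)] .
    show "(T ^^ s) x \<noteq> (T ^^ t) y" if "s \<in> S" "t \<in> S" for s t using that q(2) by (auto simp: S_def)
    show "N + N < card S * CARD('d)" using M S by simp
  qed
  then obtain r where r: "r > 0" "sigma_sep TYPE('d) ((A \<times> A) \<inter> cball (x, y) r)" by blast
  have "sigma_sep TYPE('d) ((A \<times> A - (\<lambda>x. (x, x)) ` X) \<inter> cball z r)"
    unfolding xy(1) by (rule sigma_sep_subset[OF r(2)]) blast
  then show "\<exists>r>0. sigma_sep TYPE('d) ((A \<times> A - (\<lambda>x. (x, x)) ` X) \<inter> cball z r)" using r(1) by blast
qed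

lemma sigma_sep_aperiodic_periodic:
  assumes N: "covering_dim_le (top_of_set (nonwandering X T)) (int N)"
    and P: "closed (periodic_points X T)"
  defines "A \<equiv> nonwandering X T - periodic_points X T"
  shows "sigma_sep TYPE('d::finite) (A \<times> exact_periodic p)"
proof (rule sigma_sep_local)
  have A: "nice A N" unfolding A_def by (rule nice_aperiodic[OF N P])
  have E: "nice (exact_periodic p) N"
    by (rule nice_periodic[OF compact_nonwandering nonwandering_subset N])
       (use periodic_le_subset periodic_nonwandering in blast)
  show "sigma_compact (A \<times> exact_periodic p)"
    by (intro sigma_compact_Times nice_sigma_compact[OF A] nice_sigma_compact[OF E])
  fix z assume "z \<in> A \<times> exact_periodic p"
  then obtain x y where xy: "z = (x, y)" "x \<in> A" "y \<in> exact_periodic p" by blast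
  have X: "x \<in> X" "y \<in> X" using xy nice_subset[OF A] nice_subset[OF E] by auto
  have at: "s = t" if "(T ^^ s) x = (T ^^ t) x" for s t
    using aperiodic_times[OF _ _ that] xy(2) X by (auto simp: A_def)
  define M where "M = Suc (N + N)"
  have M: "N + N < M * CARD('d)" unfolding M_def by (rule double_less_Suc_mult_card)
  have "\<exists>r>0. sigma_sep TYPE('d) ((A \<times> exact_periodic p) \<inter> cball (x, y) r)"
  proof (rule nice_pair_sigma_sep[OF A E xy(2,3), of "{..<M}"])
    show "s = t" if "(T ^^ s) x = (T ^^ t) x" for s t using at[OF that] .
    show "(T ^^ s) x \<noteq> (T ^^ t) y" for s t
    proof
      assume eq: "(T ^^ s) x = (T ^^ t) y"
      \<comment> \<open>A common iterate would make the orbit of \<open>x\<close> eventually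
        periodic with period \<open>p\<close>, contrary to aperiodicity.\<close>
      have "(T ^^ (p + s)) x = (T ^^ (p + t)) y" using eq by (simp only: funpow_funpow[symmetric])
      also have "\<dots> = (T ^^ t) y" using exact_periodic_times(3)[OF xy(3), of "p + t" t] by simp
      also have "\<dots> = (T ^^ s) x" using eq by simp
      finally have "p + s = s" by (rule at)
      then show False using exact_periodic_times(1)[OF xy(3)] by simp
    qed
    show "N + N < card {..<M} * CARD('d)" using M by simp
  qed simp
  then show "\<exists>r>0. sigma_sep TYPE('d) ((A \<times> exact_periodic p) \<inter> cball z r)" unfolding xy(1) .
qed

text \<open>The point of larger period \<open>p\<close> supplies \<open>p\<close> distinct times,
  and \<open>D + D' < (p + q) * CARD('d) / 2 \<le> p * CARD('d)\<close>. The graphs removed range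
  over all points of period at most \<open>p\<close>, and not only over those of exact period, so
  that the removed set is compact.\<close>

lemma sigma_sep_periodic_distinct_orbits:
  assumes E: "nice (exact_periodic p) D" "nice (exact_periodic q) D'"
    and D: "2 * D < p * CARD('d)" "2 * D' < q * CARD('d)" and pq: "q \<le> p"
  shows "sigma_sep TYPE('d::finite) (exact_periodic p \<times> exact_periodic q -
     (\<Union>m\<in>{..<p}. (\<lambda>x. (x, (T ^^ m) x)) ` periodic_points_le X T p))"
proof (rule sigma_sep_local)
  let ?G = "\<Union>m\<in>{..<p}. (\<lambda>x. (x, (T ^^ m) x)) ` periodic_points_le X T p"
  have PX: "periodic_points_le X T p \<subseteq> X" by (auto simp: periodic_points_le_def)
  have "compact ((\<lambda>x. (x, (T ^^ m) x)) ` periodic_points_le X T p)" for m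
    by (rule compact_continuous_image[OF _ compact_periodic_points_le])
       (intro continuous_intros continuous_on_subset[OF cont_funpow PX])
  then have G: "compact ?G" by (intro compact_UN) auto
  show "sigma_compact (exact_periodic p \<times> exact_periodic q - ?G)"
    by (intro sigma_compact_Diff_closed sigma_compact_Times nice_sigma_compact[OF E(1)] nice_sigma_compact[OF E(2)]
        compact_imp_closed G)
  fix z assume z: "z \<in> exact_periodic p \<times> exact_periodic q - ?G"
  then obtain x y where xy: "z = (x, y)" "x \<in> exact_periodic p" "y \<in> exact_periodic q" by blast
  have X: "x \<in> X" "y \<in> X" using xy exact_periodic_subset by auto
  have ny: "y \<noteq> (T ^^ m) x" if "m < p" for m
    using z that xy unfolding exact_periodic_def by blast
  note px = exact_periodic_times[OF xy(2)]
  note py = exact_periodic_times[OF xy(3)]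
  have "\<exists>r>0. sigma_sep TYPE('d) ((exact_periodic p \<times> exact_periodic q) \<inter> cball (x, y) r)"
  proof (rule nice_pair_sigma_sep[OF E xy(2,3), of "{..<p}"])
    show "s = t" if "s \<in> {..<p}" "t \<in> {..<p}" "(T ^^ s) x = (T ^^ t) x" for s t
      using that px(3)[of s t] by simp
    show "(T ^^ s) x \<noteq> (T ^^ t) y" if st: "s \<in> {..<p}" "t \<in> {..<p}" for s t
    proof
      assume eq: "(T ^^ s) x = (T ^^ t) y"
      \<comment> \<open>\<open>q * p\<close> is a multiple of the period of \<open>y\<close> and at
        least \<open>t\<close>, so following \<open>(T ^^ t) y\<close> for the remaining
        \<open>q * p - t\<close> steps leads back to \<open>y\<close>.\<close>
      have le: "t \<le> q * p" using st(2) py(1) by (metis lessThan_iff less_imp_le mult.left_neutral mult_le_mono le_trans)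
      have "(q * p - t + s) mod p < p" using px(1) by simp
      have "y = (T ^^ (q * p)) y" using py(3)[of "q * p" 0] by simp
      also have "\<dots> = (T ^^ (q * p - t)) ((T ^^ t) y)" using le by (simp add: funpow_funpow)
      also have "\<dots> = (T ^^ (q * p - t + s)) x" using eq by (simp add: funpow_funpow[symmetric])
      also have "\<dots> = (T ^^ ((q * p - t + s) mod p)) x" using px(3) by (metis mod_mod_trivial)
      finally show False using ny \<open>(q * p - t + s) mod p < p\<close> by blast
    qed
    have "q * CARD('d) \<le> p * CARD('d)" using pq by simp
    then have "D + D' < p * CARD('d)" using D by linarith
    then show "D + D' < card {..<p} * CARD('d)" by simp
  qed simp
  then obtain r where r: "r > 0" "sigma_sep TYPE('d) ((exact_periodic p \<times> exact_periodic q) \<inter> cball (x, y) r)" by blast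
  have "sigma_sep TYPE('d) ((exact_periodic p \<times> exact_periodic q - ?G) \<inter> cball z r)"
    unfolding xy(1) by (rule sigma_sep_subset[OF r(2)]) blast
  then show "\<exists>r>0. sigma_sep TYPE('d) ((exact_periodic p \<times> exact_periodic q - ?G) \<inter> cball z r)" using r(1) by blast
qed

lemma sigma_sep_off_diagonal:
  assumes N: "covering_dim_le (top_of_set (nonwandering X T)) (int N)"
    and P: "closed (periodic_points X T)"
    and D: "\<And>p. p \<ge> 1 \<Longrightarrow> \<exists>D. covering_dim_le (top_of_set (periodic_points_le X T p)) (int D) \<and> 2 * D < p * CARD('d)"
  shows "sigma_sep TYPE('d::finite) {(x, y). x \<in> X \<and> y \<in> X \<and> x \<noteq> y}"
proof -
  let ?O = "nonwandering X T" and ?E = exact_periodic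
  define \<Delta> where "\<Delta> = (\<lambda>x. (x, x)) ` X"
  define A where "A = ?O - periodic_points X T"
  define G where "G p m = (\<lambda>x. (x, (T ^^ m) x)) ` ?E p" for p m
  define R where "R p q = ?E p \<times> ?E q - (\<Union>m\<in>{..<p}. (\<lambda>x. (x, (T ^^ m) x)) ` periodic_points_le X T p)" for p q
  have "\<exists>D. nice (?E p) D \<and> 2 * D < p * CARD('d)" if p: "p \<ge> 1" for p
  proof -
    from D[OF p] obtain D where D: "covering_dim_le (top_of_set (periodic_points_le X T p)) (int D)" "2 * D < p * CARD('d)"
      by blast
    have "nice (?E p) D"
      by (rule nice_periodic[OF compact_periodic_points_le _ D(1)]) (auto simp: periodic_points_le_def)
    with D(2) show ?thesis by blast
  qed
  then have E: "\<forall>p\<in>{1..}. \<exists>D. nice (?E p) D \<and> 2 * D < p * CARD('d)" by simp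
  from bchoice[OF E] obtain d where d: "\<And>p. p \<ge> 1 \<Longrightarrow> nice (?E p) (d p)" "\<And>p. p \<ge> 1 \<Longrightarrow> 2 * d p < p * CARD('d)"
    by auto
  have R: "sigma_sep TYPE('d) (R p q)" if "q \<ge> 1" "q \<le> p" for p q
    unfolding R_def using that d by (intro sigma_sep_periodic_distinct_orbits[of p "d p" q "d q"]) auto
  have G: "sigma_sep TYPE('d) (G p m)" if "0 < m" "m < p" for p m
    unfolding G_def using that d by (intro sigma_sep_orbit_graph[of p "d p" m]) auto
  define W1 where "W1 = (X - ?O) \<times> (X - ?O) - \<Delta>"
  define W2 where "W2 = (X - ?O) \<times> ?O"
  define A1 where "A1 = A \<times> A - \<Delta>"
  define A2 where "A2 = (\<Union>p. A \<times> ?E p)"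
  define Q1 where "Q1 = (\<Union>p. \<Union>q\<in>{1..p}. R p q)"
  define Q2 where "Q2 = (\<Union>p. \<Union>m\<in>{0<..<p}. G p m)"
  have W: "sigma_sep TYPE('d) W1" "sigma_sep TYPE('d) W2" and A1: "sigma_sep TYPE('d) A1"
    unfolding W1_def W2_def A1_def \<Delta>_def A_def
    by (rule sigma_sep_wandering_off_diagonal[OF N] sigma_sep_wandering_nonwandering[OF N P] sigma_sep_aperiodic_off_diagonal[OF N P])+
  have A2: "sigma_sep TYPE('d) A2"
    unfolding A2_def A_def by (intro sigma_sep_UN sigma_sep_aperiodic_periodic[OF N P]) simp
  have Q1: "sigma_sep TYPE('d) Q1"
    unfolding Q1_def by (intro sigma_sep_UN R) simp_all
  have Q2: "sigma_sep TYPE('d) Q2"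
    unfolding Q2_def by (intro sigma_sep_UN G) simp_all
  define Z where "Z = W1 \<union> (W2 \<union> (A1 \<union> (A2 \<union> (Q1 \<union> Q2))))"
  have Z: "sigma_sep TYPE('d) Z" unfolding Z_def by (intro sigma_sep_Un W A1 A2 Q1 Q2)
  have "(x, y) \<in> Z \<or> (y, x) \<in> Z" if x: "x \<in> X" "y \<in> X" "x \<noteq> y" for x y
  proof -
    have nd: "(x, y) \<notin> \<Delta>" using x(3) by (auto simp: \<Delta>_def)
    consider "x \<notin> ?O" "y \<notin> ?O" | "x \<notin> ?O" "y \<in> ?O" | "x \<in> ?O" "y \<notin> ?O" | "x \<in> A" "y \<in> A"
      | "x \<in> A" "y \<in> periodic_points X T" | "x \<in> periodic_points X T" "y \<in> A"
      | "x \<in> periodic_points X T" "y \<in> periodic_points X T" unfolding A_def by blast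
    then show ?thesis
    proof cases
      case 1
      then have "(x, y) \<in> W1" using x nd unfolding W1_def by blast
      then show ?thesis unfolding Z_def by blast
    next
      case 2
      then have "(x, y) \<in> W2" using x unfolding W2_def by blast
      then show ?thesis unfolding Z_def by blast
    next
      case 3
      then have "(y, x) \<in> W2" using x unfolding W2_def by blast
      then show ?thesis unfolding Z_def by blast
    next
      case 4
      then have "(x, y) \<in> A1" using nd unfolding A1_def by blast
      then show ?thesis unfolding Z_def by blast
    next
      case 5
      obtain p where "y \<in> ?E p" using 5(2) by (rule periodic_exact)
      then have "(x, y) \<in> A2" using 5(1) unfolding A2_def by blast
      then show ?thesis unfolding Z_def by blast
    next
      case 6
      obtain p where "x \<in> ?E p" using 6(1) by (rule periodic_exact)
      then have "(y, x) \<in> A2" using 6(2) unfolding A2_def by blast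
      then show ?thesis unfolding Z_def by blast
    next
      case 7
      obtain p where p: "p \<ge> 1" "x \<in> ?E p" using 7(1) by (rule periodic_exact)
      obtain q where q: "q \<ge> 1" "y \<in> ?E q" using 7(2) by (rule periodic_exact)
      \<comment> \<open>The larger period comes first, as the choice of times requires. Outside
        \<open>R a b\<close> the second point is an iterate of the first, and
        \<open>u \<noteq> v\<close> excludes the zeroth one.\<close>
      have ordered: "(u, v) \<in> Q1 \<or> (u, v) \<in> Q2"
        if u: "u \<in> ?E a" "v \<in> ?E b" and ab: "1 \<le> b" "b \<le> a" and "u \<noteq> v" for u v a b
      proof (cases "(u, v) \<in> R a b")
        case True
        moreover have "b \<in> {1..a}" using ab by simp
        ultimately have "(u, v) \<in> Q1" unfolding Q1_def by blast
        then show ?thesis by blast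
      next
        case False
        then obtain m where m: "m < a" "v = (T ^^ m) u" using u unfolding R_def by blast
        have "m \<noteq> 0" using m \<open>u \<noteq> v\<close> by (cases m) auto
        then have m': "m \<in> {0<..<a}" using m by simp
        have "(u, v) \<in> G a m" using m u unfolding G_def by blast
        then have "(u, v) \<in> Q2" using m' unfolding Q2_def by blast
        then show ?thesis by blast
      qed
      show ?thesis
      proof (cases "q \<le> p")
        case True
        then show ?thesis using ordered[OF p(2) q(2) q(1) _ x(3)] unfolding Z_def by blast
      next
        case False
        then show ?thesis using ordered[OF q(2) p(2) p(1) _ x(3)[symmetric]] unfolding Z_def by auto
      qed
    qed
  qed
  then have sub: "{(x, y). x \<in> X \<and> y \<in> X \<and> x \<noteq> y} \<subseteq> Z \<union> prod.swap ` Z" by force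
  show ?thesis by (rule sigma_sep_subset[OF sigma_sep_Un[OF Z sigma_sep_swap[OF Z]] sub])
qed

end

subsection \<open>The comeagre set of embeddings\<close>

lemma covering_dim_le_mono:
  assumes "covering_dim_le Y n" "n \<le> m"
  shows "covering_dim_le Y m"
  unfolding covering_dim_le_def
proof (intro allI impI)
  fix \<U> assume "finite_open_cover Y \<U>"
  then obtain \<V> where "finite_open_cover Y \<V>" "refines \<V> \<U>"
    "\<forall>x\<in>topspace Y. int (card {V \<in> \<V>. x \<in> V}) \<le> n + 1"
    using assms(1) unfolding covering_dim_le_def by blast
  then show "\<exists>\<V>. finite_open_cover Y \<V> \<and> refines \<V> \<U> \<and>
      (\<forall>x\<in>topspace Y. int (card {V \<in> \<V>. x \<in> V}) \<le> m + 1)"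
    using assms(2) by (intro exI[of _ \<V>]) force
qed

text \<open>The counting needs natural numbers, so a negative dimension bound, which is possible for
  the empty set, is raised to 0; positivity of \<open>c\<close> makes this harmless.\<close>

lemma covering_dim_lessD:
  assumes "covering_dim Y < c" "c > 0"
  obtains D where "covering_dim_le Y (int D)" "ereal (real D) < c"
proof -
  obtain n :: int where n: "covering_dim_le Y n" "ereal (of_int n) < c"
    using assms(1) unfolding covering_dim_def Inf_less_iff by blast
  show ?thesis
  proof (rule that[of "nat n"])
    show "covering_dim_le Y (int (nat n))" by (rule covering_dim_le_mono[OF n(1)]) simp
    show "ereal (real (nat n)) < c" using n(2) assms(2) by (cases "n \<ge> 0") (auto simp: zero_ereal_def)
  qed
qed

lemma nowhere_dense_in_subset_Diff:
  assumes "openin Y G" "Y closure_of G = topspace Y" "A \<subseteq> topspace Y - G"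
  shows "nowhere_dense_in Y A"
proof -
  have "Y closure_of A \<subseteq> topspace Y - G"
    using assms(1,3) by (intro closure_of_minimal) auto
  then have "Y interior_of (Y closure_of A) \<subseteq> Y interior_of (topspace Y - G)"
    by (rule interior_of_mono)
  also have "\<dots> = {}" using assms(2) by (simp add: interior_of_complement)
  finally show ?thesis using assms(3) unfolding nowhere_dense_in_def by blast
qed

context compact_system
begin

lemma robust_sep:
  assumes "compact C" "C \<subseteq> X \<times> X"
  shows "robust (sep C :: ('a \<Rightarrow> real ^ 'd) \<Rightarrow> bool)"
proof -
  have "robust (\<lambda>f :: 'a \<Rightarrow> real ^ 'd. \<forall>z\<in>C. \<exists>n\<in>UNIV. f ((T ^^ n) (fst z)) - f ((T ^^ n) (snd z)) \<noteq> 0)"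
  proof (rule robust_nonvanishing[OF assms(1)])
    have X: "fst ` C \<subseteq> X" "snd ` C \<subseteq> X" using assms(2) by auto
    show "continuous_on C (\<lambda>z. f ((T ^^ n) (fst z)) - f ((T ^^ n) (snd z)))"
      if f: "cube_fun f" for n and f :: "'a \<Rightarrow> real ^ 'd"
    proof -
      have fX: "continuous_on X f" using f by (simp add: cube_fun_def)
      have fn: "continuous_on X (\<lambda>x. f ((T ^^ n) x))"
        by (rule continuous_on_compose2[OF fX cont_funpow]) (use funpow_in in blast)
      show ?thesis
        by (intro continuous_on_diff continuous_on_compose2[OF fn] continuous_intros X)
    qed
    fix n z i \<eta> and f g :: "'a \<Rightarrow> real ^ 'd" assume z: "z \<in> C" and n: "near \<eta> f g"
    have "(T ^^ n) (fst z) \<in> X" "(T ^^ n) (snd z) \<in> X" using z assms(2) funpow_in by auto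
    then have "\<bar>g ((T ^^ n) (fst z)) $ i - f ((T ^^ n) (fst z)) $ i\<bar> \<le> \<eta>"
      "\<bar>g ((T ^^ n) (snd z)) $ i - f ((T ^^ n) (snd z)) $ i\<bar> \<le> \<eta>"
      using n by (auto simp: near_def)
    then show "\<bar>(g ((T ^^ n) (fst z)) - g ((T ^^ n) (snd z))) $ i - (f ((T ^^ n) (fst z)) - f ((T ^^ n) (snd z))) $ i\<bar> \<le> 2 * \<eta>"
      unfolding vector_minus_component by linarith
  qed
  then show ?thesis by (simp add: sep_def[abs_def] split_beta)
qed

lemma not_sep_if_orbit_map_eq:
  assumes "(x, y) \<in> C" "orbit_map X T f x = orbit_map X T f y"
  shows "\<not> sep C f"
proof
  assume "sep C f"
  then obtain n where "f ((T ^^ n) x) \<noteq> f ((T ^^ n) y)" using assms(1) by (auto simp: sep_def)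
  moreover have "f (iterate X T (int n) x) = f (iterate X T (int n) y)"
    using assms(2) unfolding orbit_map_def by metis
  ultimately show False by (simp add: iterate_def)
qed

lemma comeagre_orbit_embedding:
  assumes "sigma_sep TYPE('d::finite) {(x, y). x \<in> X \<and> y \<in> X \<and> x \<noteq> y}" and "X \<noteq> {}"
  shows "comeagre_in (mtopology_of (cube_funspace X :: ('a \<Rightarrow> real ^ 'd) metric))
           {f \<in> mspace (cube_funspace X). orbit_embedding X T f}"
proof -
  let ?M = "mtopology_of (cube_funspace X :: ('a \<Rightarrow> real ^ 'd) metric)"
  obtain \<C> where \<C>: "countable \<C>" "\<forall>C\<in>\<C>. sep_compact TYPE('d) C" "{(x, y). x \<in> X \<and> y \<in> X \<and> x \<noteq> y} \<subseteq> \<Union>\<C>"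
    using assms(1) unfolding sigma_sep_def by blast
  \<comment> \<open>The complement has to be equal to a union of nowhere dense sets, not just
    contained in one; hence the condition of not being an embedding is part of each
    \<open>B C\<close>.\<close>
  define B where "B C = {f \<in> mspace (cube_funspace X :: ('a \<Rightarrow> real ^ 'd) metric). \<not> orbit_embedding X T f \<and> \<not> sep C f}" for C
  have "nowhere_dense_in ?M (B C)" if "C \<in> \<C>" for C
  proof -
    have C: "compact C" "C \<subseteq> X \<times> X" "approximable (sep C :: ('a \<Rightarrow> real ^ 'd) \<Rightarrow> bool)"
      using \<C>(2) that by (auto simp: sep_compact_def)
    have rob: "robust (sep C :: ('a \<Rightarrow> real ^ 'd) \<Rightarrow> bool)" by (rule robust_sep[OF C(1,2)])
    show ?thesis
    proof (rule nowhere_dense_in_subset_Diff)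
      show "openin ?M {f \<in> mspace (cube_funspace X). sep C f}" by (rule robust_open[OF rob assms(2)])
      show "?M closure_of {f \<in> mspace (cube_funspace X). sep C f} = topspace ?M"
        using approximable_dense[OF rob C(3) assms(2)] by simp
    qed (auto simp: B_def)
  qed
  moreover have "topspace ?M - {f \<in> mspace (cube_funspace X). orbit_embedding X T f} = \<Union>(B ` \<C>)"
  proof (intro equalityI subsetI)
    fix f assume "f \<in> topspace ?M - {f \<in> mspace (cube_funspace X). orbit_embedding X T f}"
    then have f: "f \<in> mspace (cube_funspace X)" "\<not> orbit_embedding X T f" by auto
    then obtain x y where xy: "x \<in> X" "y \<in> X" "x \<noteq> y" "orbit_map X T f x = orbit_map X T f y"
      unfolding orbit_embedding_def inj_on_def by blast
    then obtain C where "C \<in> \<C>" "(x, y) \<in> C" using \<C>(3) by blast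
    then show "f \<in> \<Union>(B ` \<C>)" using not_sep_if_orbit_map_eq[OF _ xy(4)] f unfolding B_def by blast
  qed (auto simp: B_def)
  ultimately show ?thesis
    unfolding comeagre_in_def using \<C>(1) by (intro conjI exI[of _ "B ` \<C>"]) auto
qed

end

lemma compact_system_if_tds:
  assumes "tds X T"
  shows "compact_system X T"
proof
  have T: "homeomorphic_map (top_of_set X) (top_of_set X) T" and "compact X"
    using assms by (auto simp: tds_def)
  then show "compact X" by simp
  show "continuous_on X T" using homeomorphic_imp_continuous_map[OF T] by simp
  show "inj_on T X" using homeomorphic_imp_injective_map[OF T] by simp
  show "T ` X = X" using homeomorphic_imp_surjective_map[OF T] by simp
qed

theorem theorem7p3:
  fixes X :: "'a::metric_space set" and T :: "'a \<Rightarrow> 'a"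
  assumes "tds X T"
    and "covering_dim (top_of_set (nonwandering X T)) < \<infinity>"
    and "closedin (top_of_set X) (periodic_points X T)"
    and "perdim_less X T (real CARD('d) / 2)"
  shows "comeagre_in (mtopology_of (cube_funspace X :: ('a \<Rightarrow> real ^ 'd) metric))
           {f \<in> mspace (cube_funspace X). orbit_embedding X T f}"
proof (cases "X = {}")
  case True
  \<comment> \<open>Every map on the empty set is injective, so the complement is empty, the union
    of an empty family.\<close>
  then show ?thesis
    unfolding comeagre_in_def by (intro conjI exI[of _ "{}"]) (auto simp: orbit_embedding_def)
next
  case False
  interpret compact_system X T by (rule compact_system_if_tds[OF assms(1)])
  obtain N where N: "covering_dim_le (top_of_set (nonwandering X T)) (int N)"
    by (rule covering_dim_lessD[OF assms(2)]) auto
  have P: "closed (periodic_points X T)"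
    using assms(3) compact_imp_closed[OF compact_X] closedin_closed_trans by blast
  have "\<exists>D. covering_dim_le (top_of_set (periodic_points_le X T p)) (int D) \<and> 2 * D < p * CARD('d)"
    if p: "p \<ge> 1" for p
  proof -
    have "covering_dim (top_of_set (periodic_points_le X T p)) / ereal (real p) < ereal (real CARD('d) / 2)"
      using assms(4) p unfolding perdim_less_def by blast
    then have "covering_dim (top_of_set (periodic_points_le X T p)) < ereal (real CARD('d) / 2) * ereal (real p)"
      using p by (subst (asm) ereal_divide_less_iff) auto
    then have "covering_dim (top_of_set (periodic_points_le X T p)) < ereal (real CARD('d) / 2 * real p)" by simp
    then obtain D where D: "covering_dim_le (top_of_set (periodic_points_le X T p)) (int D)"
      "ereal (real D) < ereal (real CARD('d) / 2 * real p)"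
      by (rule covering_dim_lessD) (use p in auto)
    \<comment> \<open>Passing to integers keeps the inequality strict, which the vertex counts
      depend on.\<close>
    have "real (2 * D) < real (p * CARD('d))" using D(2) by (simp add: field_simps)
    then have "2 * D < p * CARD('d)" by (simp only: of_nat_less_iff)
    with D(1) show ?thesis by blast
  qed
  from comeagre_orbit_embedding[OF sigma_sep_off_diagonal[OF N P this] False] show ?thesis .
qed

end
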